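(* Let $n,r$ be positive integers, $\mathscr{A}=\mathbb{Q}(q)$. The following statements hold. (1) For $1\le l\le r$, there is an algebra homomorphism $\Xi_l:\mathfrak{HH}^l_r\to\mathrm{End}_{\mathscr{A}}(\underline{V}^{\otimes r}_l)$ defined by sending $\mathrm{T}_{s_i}\mapsto\Psi|_l(T_{s_i})$ and $x_\sigma\mapsto\psi_\sigma^{\underline{l}}$. (2) For $l=0$, there is an algebra homomorphism $\Xi_0:\mathfrak{HH}^0_r\to\mathrm{End}_{\mathscr{A}}(\underline{V}^{\otimes r}_0)$ defined by sending $\mathrm{T}_{s_i}\mapsto\Psi|_0(T_{s_i})=q^{-1}\mathrm{id}$. (3) For any $l\in\{0,1,\dots,r\}$ and any $g\in\mathbf{U}_q(\mathfrak{gl}_n)\hookrightarrow\mathbf{U}_q(\mathfrak{gl}_{n+1})$, $\Phi(g)$ commutes with every element of $\Xi_l(\mathfrak{HH}^l_r)$ in $\mathrm{End}_{\mathscr{A}}(\underline{V}^{\otimes r}_l)$. (4) On $\underline{V}^{\otimes r}$ there is a representation $\Xi$ of $\mathfrak{HH}_r$ defined by: (4.1) $\Xi(\mathrm{T}_{s_i})=\Psi(T_{s_i})$ for all $1\le i\le r-1$; (4.2) for $1\le l\le r$ and $\sigma\in\mathfrak{S}_l$, $\Xi(x^{(l)}_\sigma)|_{\underline{V}^{\otimes r}_l}=\Xi_l(x_\sigma)$ and $\Xi(x^{(l)}_\sigma)|_{\underline{V}^{\otimes r}_k}=0$ for $k\neq l$.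
   Context: Ground field: $\mathscr{A}=\mathbb{Q}(q)$, with $q$ transcendental over $\mathbb{Q}$. Quantum group. For $m\ge 1$, $\mathbf{U}_q(\mathfrak{gl}_m)$ is the associative unital $\mathbb{Q}(q)$-algebra generated by $E_i,F_i$ ($1\le i\le m-1$) and $H_a,H_a^{-1}$ ($1\le a\le m$), with $K_i:=H_iH_{i+1}^{-1}$, subject to: $H_aH_a^{-1}=H_a^{-1}H_a=1$, $H_aH_b=H_bH_a$; $H_iE_iH_i^{-1}=qE_i$, $H_iF_iH_i^{-1}=q^{-1}F_i$; $H_{i+1}E_iH_{i+1}^{-1}=q^{-1}E_i$, $H_{i+1}F_iH_{i+1}^{-1}=qF_i$; $H_kE_iH_k^{-1}=E_i$, $H_kF_iH_k^{-1}=F_i$ for $k\ne i,i+1$; $E_iF_j-F_jE_i=\delta_{ij}\frac{K_i-K_i^{-1}}{q-q^{-1}}$; $E_iE_j=E_jE_i$, $F_iF_j=F_jF_i$ if $|i-j|>1$; $E_i^2E_j-(q+q^{-1})E_iE_jE_i+E_jE_i^2=0$ and $F_i^2F_j-(q+q^{-1})F_iF_jF_i+F_jF_i^2=0$ if $|i-j|=1$. Its comultiplication is $H_a\mapsto H_a\otimes H_a$, $E_i\mapsto 1\otimes E_i+E_i\otimes K_i^{-1}$, $F_i\mapsto F_i\otimes 1+K_i\otimes F_i$. The embedding $\mathbf{U}_q(\mathfrak{gl}_n)\hookrightarrow\mathbf{U}_q(\mathfrak{gl}_{n+1})$ sends each generator to the generator of the same name. Natural module. $V$ has basis $\eta_1,\dots,\eta_n$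 and $\underline{V}=V\oplus\mathbb{Q}(q)\eta_{n+1}$. $\mathbf{U}_q(\mathfrak{gl}_{n+1})$ acts on $\underline{V}$ by $H_i\eta_i=q\eta_i$, $H_i\eta_j=\eta_j$ ($j\ne i$); $F_i\eta_i=\eta_{i+1}$, $F_i\eta_j=0$ ($j\neq i$); $E_i\eta_{i+1}=\eta_i$, $E_i\eta_j=0$ ($j\ne i+1$); it acts on $\underline{V}^{\otimes r}$ through the iterated comultiplication. This representation is $\Phi$. Hecke algebra. $\mathbf{H}(\mathfrak{S}_m)$ is the unital $\mathbb{Q}(q)$-algebra generated by $T_{s_i}$ ($1\le i\le m-1$, $s_i=(i,i+1)$) with $(T_{s_i}+q)(T_{s_i}-q^{-1})=0$, $T_{s_i}T_{s_{i+1}}T_{s_i}=T_{s_{i+1}}T_{s_i}T_{s_{i+1}}$, $T_{s_i}T_{s_j}=T_{s_j}T_{s_i}$ for $|i-j|>1$; $T_\sigma=T_{s_{i_1}}\cdots T_{s_{i_k}}$ for a reduced expression $\sigma=s_{i_1}\cdots s_{i_k}$. The length function is $\ell$. For a vector space with ordered basis $\eta_1,\eta_2,\dots$, $T_{s_i}$ acts on the $m$-th tensor power by the operator sending $M_f=\eta_{f(1)}\otimes\cdots\otimes\eta_{f(m)}$ to $M_{fs_i}$ if $f(i)<f(i+1)$, to $M_{fs_i}+(q^{-1}-q)M_f$ if $f(i)>f(i+1)$, and to $q^{-1}M_f$ if $f(i)=f(i+1)$, where $(fs_i)(j)=f(s_i(j))$. The resulting representation (product of generators going to composition of operators) is denoted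 $\Psi$ on $\underline{V}^{\otimes r}$ and $\Psi^V_l$ for $\mathbf{H}(\mathfrak{S}_l)$ on $V^{\otimes l}$. Subspaces. For $I\subseteq\{1,\dots,r\}$ let $\underline{V}^{\otimes r}_I$ be the span of the $\eta_{j_1}\otimes\cdots\otimes\eta_{j_r}$ with $1\le j_k\le n$ for $k\in I$ and $j_k=n+1$ for $k\notin I$; $\underline{V}^{\otimes r}_l=\bigoplus_{\#I=l}\underline{V}^{\otimes r}_I$, so $\underline{V}^{\otimes r}=\bigoplus_{l=0}^r\underline{V}^{\otimes r}_l$. Let $\underline{l}=\{1,\dots,l\}$, so $\underline{V}^{\otimes r}_{\underline{l}}=V^{\otimes l}\otimes\eta_{n+1}^{\otimes(r-l)}$. Each $\underline{V}^{\otimes r}_l$ is stable under $\Psi$, and $\Psi|_l$ is the restriction of $\Psi$ to it. For $\sigma\in\mathfrak{S}_l$, $\psi^{\underline{l}}_\sigma\in\mathrm{End}_{\mathscr{A}}(\underline{V}^{\otimes r}_l)$ is the operator equal to $\Psi^V_l(T_\sigma)\otimes\mathrm{id}^{\otimes(r-l)}$ on $\underline{V}^{\otimes r}_{\underline{l}}$ and $0$ on $\underline{V}^{\otimes r}_I$ for $\#I=l$, $I\neq\underline{l}$. Algebras. For $1\le l\le r$, $\mathfrak{HH}^l_r$ is the unital associative $\mathscr{A}$-algebra with generators $\mathrm{T}_{s_i}$ ($1\le i\le r-1$) and $x_\sigma$ ($\sigma\in\mathfrak{S}_l$) and relations: the $\mathrm{T}_{s_i}$ satisfy the defining relations of $\mathbf{H}(\mathfrak{S}_r)$;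 for $1\le i<l$, each of the products $x_\sigma x_{s_i}$ and $x_\sigma\mathrm{T}_{s_i}$ equals $x_{\sigma s_i}$ if $\ell(\sigma s_i)=\ell(\sigma)+1$ and $x_{\sigma s_i}+(q^{-1}-q)x_\sigma$ if $\ell(\sigma s_i)=\ell(\sigma)-1$; each of the products $x_{s_i}x_\sigma$ and $\mathrm{T}_{s_i}x_\sigma$ equals $x_{s_i\sigma}$ if $\ell(s_i\sigma)=\ell(\sigma)+1$ and $x_{s_i\sigma}+(q^{-1}-q)x_\sigma$ if $\ell(s_i\sigma)=\ell(\sigma)-1$; and $\mathrm{T}_{s_i}x_\sigma=q^{-1}x_\sigma=x_\sigma\mathrm{T}_{s_i}$ for $l<i\le r-1$ (no such relation when $l=r$). By convention $\mathfrak{HH}^0_r=\mathbf{H}(\mathfrak{S}_r)$ (with $\mathrm{T}_{s_i}=T_{s_i}$). The duplex Hecke algebra $\mathfrak{HH}_r$ is the unital associative $\mathscr{A}$-algebra with generators $\mathrm{T}_{s_i}$ ($1\le i\le r-1$) and $x^{(l)}_\sigma$ ($\sigma\in\mathfrak{S}_l$, $1\le l\le r$), with, for every $l$, the relations of $\mathfrak{HH}^l_r$ with $x_\sigma$ replaced by $x_\sigma^{(l)}$, and additionally $x^{(l)}_\sigma x^{(k)}_\gamma=0$ for $\sigma\in\mathfrak{S}_l$, $\gamma\in\mathfrak{S}_k$, $k\ne l$. *)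

theory Defs
  imports
    "HOL-Computational_Algebra.Fraction_Field"
    "HOL-Computational_Algebra.Polynomial"
    "HOL-Combinatorics.Permutations"
    "HOL-Library.Poly_Mapping"
    "HOL-Library.FuncSet"
    "HOL-Algebra.Module"
    "HOL-Algebra.QuotRing"
begin

section \<open>The ground field\<close>

type_synonym rat_q = "rat poly fract"

definition q :: rat_q
  where "q = Fraction_Field.Fract [:0, 1:] 1"


section \<open>Free algebras and tensor powers\<close>

text \<open>
  With concatenation as the monoid operation on lists, the convolution product of
  \<open>Poly_Mapping\<close> makes \<open>'a list \<Rightarrow>\<^sub>0 rat_q\<close> the free unital associative algebra on
  \<open>'a\<close>, that is, the tensor algebra of the vector space with basis \<open>'a\<close>. The type is used for
  both purposes: for presentations by generators and relations, and, with \<open>'a = nat\<close>, as the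
  home of all tensor powers. In the latter case \<open>wd [j\<^sub>1, \<dots>, j\<^sub>m]\<close> is
  \<open>\<eta>\<^bsub>j\<^sub>1\<^esub> \<otimes> \<dots> \<otimes> \<eta>\<^bsub>j\<^sub>m\<^esub>\<close> and the product \<open>u * v\<close> is \<open>u \<otimes> v\<close>.
\<close>

instantiation list :: (type) monoid_add
begin

definition zero_list_def: "0 = []"

definition plus_list_def: "xs + ys = xs @ ys"

instance
  by standard (simp_all add: zero_list_def plus_list_def)

end

type_synonym 'a falg = "'a list \<Rightarrow>\<^sub>0 rat_q"

definition wd :: "'a list \<Rightarrow> 'a falg"
  where "wd w = Poly_Mapping.single w 1"

definition scl :: "rat_q \<Rightarrow> 'a falg \<Rightarrow> 'a falg"
  where "scl c p = Poly_Mapping.map ((*) c) p"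

lemma lookup_scl: "Poly_Mapping.lookup (scl c p) w = c * Poly_Mapping.lookup p w"
  by (simp add: scl_def Poly_Mapping.map.rep_eq when_def)

interpretation falg: vector_space "scl :: rat_q \<Rightarrow> 'a falg \<Rightarrow> 'a falg"
  by standard (simp_all add: poly_mapping_eq_iff fun_eq_iff lookup_scl lookup_add algebra_simps)

definition lin_ext :: "('a list \<Rightarrow> 'b falg) \<Rightarrow> 'a falg \<Rightarrow> 'b falg"
  where "lin_ext b v = (\<Sum>w\<in>Poly_Mapping.keys v. scl (Poly_Mapping.lookup v w) (b w))"

text \<open>
  The operator \<open>A \<otimes> B\<close>, where \<open>A\<close> acts on the first \<open>k\<close> tensor factors and \<open>B\<close> on the others.
\<close>

definition tensor_op ::
    "nat \<Rightarrow> ('a falg \<Rightarrow> 'a falg) \<Rightarrow> ('a falg \<Rightarrow> 'a falg) \<Rightarrow> 'a falg \<Rightarrow> 'a falg"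
  where "tensor_op k A B = lin_ext (\<lambda>w. A (wd (take k w)) * B (wd (drop k w)))"


section \<open>Algebras\<close>

text \<open>
  Algebras over \<open>rat_q\<close> are module records of the library, the scalars being all of \<open>rat_q\<close>.
\<close>

definition alg_hom ::
    "(rat_q, 'a, 'm) module_scheme \<Rightarrow> (rat_q, 'b, 'k) module_scheme \<Rightarrow> ('a \<Rightarrow> 'b) set"
  where "alg_hom A B =
    {h \<in> ring_hom A B. \<forall>c. \<forall>x\<in>carrier A. h (c \<odot>\<^bsub>A\<^esub> x) = c \<odot>\<^bsub>B\<^esub> h x}"

text \<open>
  Endomorphisms of a subspace \<open>W\<close> are taken extensional, i.e. undefined outside \<open>W\<close>, so that
  equality of endomorphisms is equality of functions.
\<close>

definition End_alg :: "'a falg set \<Rightarrow> (rat_q, 'a falg \<Rightarrow> 'a falg) module"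
  where "End_alg W =
    \<lparr>carrier = {f \<in> W \<rightarrow>\<^sub>E W. (\<forall>u\<in>W. \<forall>v\<in>W. f (u + v) = f u + f v) \<and>
                            (\<forall>c. \<forall>v\<in>W. f (scl c v) = scl c (f v))},
     mult = compose W,
     one = (\<lambda>v\<in>W. v),
     zero = (\<lambda>v\<in>W. 0),
     add = (\<lambda>f g. \<lambda>v\<in>W. f v + g v),
     smult = (\<lambda>c f. \<lambda>v\<in>W. scl c (f v))\<rparr>"

definition free_alg :: "'g set \<Rightarrow> 'g falg ring"
  where "free_alg G =
    \<lparr>carrier = {p. Poly_Mapping.keys p \<subseteq> lists G}, mult = (*), one = 1, zero = 0, add = (+)\<rparr>"

text \<open>
  A presentation consists of the set of generators and the set of relators; a relation
  \<open>u = v\<close> is the relator \<open>u - v\<close>.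
\<close>

type_synonym 'g pres = "'g set \<times> 'g falg set"

definition rel_ideal :: "'g pres \<Rightarrow> 'g falg set"
  where "rel_ideal P = genideal (free_alg (fst P)) (snd P)"

definition cls :: "'g pres \<Rightarrow> 'g falg \<Rightarrow> 'g falg set"
  where "cls P p = a_r_coset (free_alg (fst P)) (rel_ideal P) p"

definition pres_alg :: "'g pres \<Rightarrow> (rat_q, 'g falg set) module"
  where "pres_alg P =
    ring.extend (FactRing (free_alg (fst P)) (rel_ideal P))
      (module.fields (\<lambda>c X. \<Union>p\<in>X. cls P (scl c p)))"

definition free_eval ::
    "(rat_q, 'b, 'm) module_scheme \<Rightarrow> ('g \<Rightarrow> 'b) \<Rightarrow> 'g falg \<Rightarrow> 'b"
  where "free_eval B \<phi> p =
    (\<Oplus>\<^bsub>B\<^esub>w\<in>Poly_Mapping.keys p.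
      Poly_Mapping.lookup p w \<odot>\<^bsub>B\<^esub> foldr (\<lambda>g y. \<phi> g \<otimes>\<^bsub>B\<^esub> y) w \<one>\<^bsub>B\<^esub>)"

text \<open>
  The homomorphism from a presented algebra to \<open>B\<close> that sends each generator \<open>g\<close> to \<open>\<phi> g\<close>,
  provided the elements \<open>\<phi> g\<close> satisfy the relations.
\<close>

definition induced_hom ::
    "(rat_q, 'b, 'm) module_scheme \<Rightarrow> ('g \<Rightarrow> 'b) \<Rightarrow> 'g falg set \<Rightarrow> 'b"
  where "induced_hom B \<phi> X = the_elem (free_eval B \<phi> ` X)"


section \<open>The spaces\<close>

definition tensor_power :: "nat \<Rightarrow> nat \<Rightarrow> nat falg set"
  where "tensor_power m r = falg.span {wd w | w. length w = r \<and> set w \<subseteq> {1..m}}"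

definition V_words :: "nat \<Rightarrow> nat \<Rightarrow> nat set \<Rightarrow> nat list set"
  where "V_words n r I = {w. length w = r \<and>
    (\<forall>k\<in>{1..r}. if k \<in> I then w ! (k - 1) \<in> {1..n} else w ! (k - 1) = n + 1)}"

definition V_set :: "nat \<Rightarrow> nat \<Rightarrow> nat set \<Rightarrow> nat falg set"
  where "V_set n r I = falg.span (wd ` V_words n r I)"

definition V_level :: "nat \<Rightarrow> nat \<Rightarrow> nat \<Rightarrow> nat falg set"
  where "V_level n r l = falg.span (\<Union>{V_set n r I | I. I \<subseteq> {1..r} \<and> card I = l})"


section \<open>The quantum group and its action\<close>

datatype uq_gen = E nat | F nat | H nat | Hinv nat

definition K_word :: "nat \<Rightarrow> uq_gen list"
  where "K_word i = [H i, Hinv (i + 1)]"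

definition Kinv_word :: "nat \<Rightarrow> uq_gen list"
  where "Kinv_word i = [H (i + 1), Hinv i]"

inductive_set uq_rels :: "nat \<Rightarrow> uq_gen falg set" for m :: nat where
  H_Hinv: "a \<in> {1..m} \<Longrightarrow> wd [H a, Hinv a] - 1 \<in> uq_rels m"
| Hinv_H: "a \<in> {1..m} \<Longrightarrow> wd [Hinv a, H a] - 1 \<in> uq_rels m"
| H_H: "a \<in> {1..m} \<Longrightarrow> b \<in> {1..m} \<Longrightarrow> wd [H a, H b] - wd [H b, H a] \<in> uq_rels m"
| H_E: "i \<in> {1..<m} \<Longrightarrow> wd [H i, E i, Hinv i] - scl q (wd [E i]) \<in> uq_rels m"
| H_F: "i \<in> {1..<m} \<Longrightarrow> wd [H i, F i, Hinv i] - scl (inverse q) (wd [F i]) \<in> uq_rels m"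
| H_Suc_E: "i \<in> {1..<m} \<Longrightarrow>
    wd [H (i + 1), E i, Hinv (i + 1)] - scl (inverse q) (wd [E i]) \<in> uq_rels m"
| H_Suc_F: "i \<in> {1..<m} \<Longrightarrow>
    wd [H (i + 1), F i, Hinv (i + 1)] - scl q (wd [F i]) \<in> uq_rels m"
| H_other_E: "i \<in> {1..<m} \<Longrightarrow> k \<in> {1..m} \<Longrightarrow> k \<noteq> i \<Longrightarrow> k \<noteq> i + 1 \<Longrightarrow>
    wd [H k, E i, Hinv k] - wd [E i] \<in> uq_rels m"
| H_other_F: "i \<in> {1..<m} \<Longrightarrow> k \<in> {1..m} \<Longrightarrow> k \<noteq> i \<Longrightarrow> k \<noteq> i + 1 \<Longrightarrow>
    wd [H k, F i, Hinv k] - wd [F i] \<in> uq_rels m"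
| E_F: "i \<in> {1..<m} \<Longrightarrow> j \<in> {1..<m} \<Longrightarrow>
    wd [E i, F j] - wd [F j, E i] -
      (if i = j then scl (inverse (q - inverse q)) (wd (K_word i) - wd (Kinv_word i)) else 0)
    \<in> uq_rels m"
| E_E: "i \<in> {1..<m} \<Longrightarrow> j \<in> {1..<m} \<Longrightarrow> \<bar>int i - int j\<bar> > 1 \<Longrightarrow>
    wd [E i, E j] - wd [E j, E i] \<in> uq_rels m"
| F_F: "i \<in> {1..<m} \<Longrightarrow> j \<in> {1..<m} \<Longrightarrow> \<bar>int i - int j\<bar> > 1 \<Longrightarrow>
    wd [F i, F j] - wd [F j, F i] \<in> uq_rels m"
| Serre_E: "i \<in> {1..<m} \<Longrightarrow> j \<in> {1..<m} \<Longrightarrow> \<bar>int i - int j\<bar> = 1 \<Longrightarrow>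
    wd [E i, E i, E j] - scl (q + inverse q) (wd [E i, E j, E i]) + wd [E j, E i, E i]
    \<in> uq_rels m"
| Serre_F: "i \<in> {1..<m} \<Longrightarrow> j \<in> {1..<m} \<Longrightarrow> \<bar>int i - int j\<bar> = 1 \<Longrightarrow>
    wd [F i, F i, F j] - scl (q + inverse q) (wd [F i, F j, F i]) + wd [F j, F i, F i]
    \<in> uq_rels m"

definition uq_pres :: "nat \<Rightarrow> uq_gen pres"
  where "uq_pres m = (E ` {1..<m} \<union> F ` {1..<m} \<union> H ` {1..m} \<union> Hinv ` {1..m}, uq_rels m)"

definition uq_embed :: "nat \<Rightarrow> uq_gen falg set \<Rightarrow> uq_gen falg set"
  where "uq_embed n =
    induced_hom (pres_alg (uq_pres (n + 1))) (\<lambda>g. cls (uq_pres (n + 1)) (wd [g]))"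

text \<open>\<open>comult g\<close> lists the pairs \<open>(a, b)\<close> of words whose tensors \<open>a \<otimes> b\<close> sum to the comultiplication of \<open>g\<close>.\<close>

primrec comult :: "uq_gen \<Rightarrow> (uq_gen list \<times> uq_gen list) list" where
  "comult (E i) = [([], [E i]), ([E i], Kinv_word i)]"
| "comult (F i) = [([F i], []), (K_word i, [F i])]"
| "comult (H a) = [([H a], [H a])]"
| "comult (Hinv a) = [([Hinv a], [Hinv a])]"

primrec nat_basis :: "uq_gen \<Rightarrow> nat \<Rightarrow> nat falg" where
  "nat_basis (E i) j = (if j = i + 1 then wd [i] else 0)"
| "nat_basis (F i) j = (if j = i then wd [i + 1] else 0)"
| "nat_basis (H i) j = (if j = i then scl q (wd [j]) else wd [j])"
| "nat_basis (Hinv i) j = (if j = i then scl (inverse q) (wd [j]) else wd [j])"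

definition nat_op :: "uq_gen \<Rightarrow> nat falg \<Rightarrow> nat falg"
  where "nat_op g = lin_ext (\<lambda>w. nat_basis g (hd w))"

definition word_op :: "('g \<Rightarrow> 'v \<Rightarrow> 'v) \<Rightarrow> 'g list \<Rightarrow> 'v \<Rightarrow> 'v"
  where "word_op \<rho> gs = foldr (\<lambda>g f. \<rho> g \<circ> f) gs id"

text \<open>
  The action of a generator on the \<open>r\<close>-th tensor power. The zeroth power is the trivial module
  given by the counit, which makes the first power the natural module.
\<close>

primrec uq_op :: "nat \<Rightarrow> uq_gen \<Rightarrow> nat falg \<Rightarrow> nat falg" where
  "uq_op 0 = (\<lambda>g. case g of E _ \<Rightarrow> (\<lambda>v. 0) | F _ \<Rightarrow> (\<lambda>v. 0) | H _ \<Rightarrow> id | Hinv _ \<Rightarrow> id)"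
| "uq_op (Suc r) = (\<lambda>g v.
    \<Sum>(a, b)\<leftarrow>comult g. tensor_op 1 (word_op nat_op a) (word_op (uq_op r) b) v)"

definition Phi :: "nat \<Rightarrow> nat \<Rightarrow> uq_gen falg set \<Rightarrow> nat falg \<Rightarrow> nat falg"
  where "Phi m r = induced_hom (End_alg (tensor_power m r))
    (\<lambda>g. restrict (uq_op r g) (tensor_power m r))"


section \<open>Symmetric groups, Hecke algebras and their action\<close>

abbreviation srefl :: "nat \<Rightarrow> nat \<Rightarrow> nat"
  where "srefl i \<equiv> Transposition.transpose i (i + 1)"

definition srefl_prod :: "nat list \<Rightarrow> nat \<Rightarrow> nat"
  where "srefl_prod is = foldr (\<lambda>i f. srefl i \<circ> f) is id"

definition len :: "nat \<Rightarrow> (nat \<Rightarrow> nat) \<Rightarrow> nat"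
  where "len m \<sigma> = (LEAST k. \<exists>is. set is \<subseteq> {1..<m} \<and> length is = k \<and> srefl_prod is = \<sigma>)"

definition reduced_word :: "nat \<Rightarrow> (nat \<Rightarrow> nat) \<Rightarrow> nat list"
  where "reduced_word m \<sigma> =
    (SOME is. set is \<subseteq> {1..<m} \<and> length is = len m \<sigma> \<and> srefl_prod is = \<sigma>)"

text \<open>
  \<open>X l \<sigma>\<close> stands for the generator \<open>x\<^sub>\<sigma>\<^bsup>(l)\<^esup>\<close>; it does not occur in the Hecke algebras.
\<close>

datatype hecke_gen = T nat | X nat "nat \<Rightarrow> nat"

inductive_set hecke_rels :: "nat \<Rightarrow> hecke_gen falg set" for m :: nat where
  quadratic: "i \<in> {1..<m} \<Longrightarrow> (wd [T i] + scl q 1) * (wd [T i] - scl (inverse q) 1) \<in> hecke_rels m"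
| braid: "i \<in> {1..<m} \<Longrightarrow> i + 1 \<in> {1..<m} \<Longrightarrow>
    wd [T i, T (i + 1), T i] - wd [T (i + 1), T i, T (i + 1)] \<in> hecke_rels m"
| far: "i \<in> {1..<m} \<Longrightarrow> j \<in> {1..<m} \<Longrightarrow> \<bar>int i - int j\<bar> > 1 \<Longrightarrow>
    wd [T i, T j] - wd [T j, T i] \<in> hecke_rels m"

definition hecke_pres :: "nat \<Rightarrow> hecke_gen pres"
  where "hecke_pres m = (T ` {1..<m}, hecke_rels m)"

definition T_perm :: "nat \<Rightarrow> (nat \<Rightarrow> nat) \<Rightarrow> hecke_gen falg set"
  where "T_perm m \<sigma> = cls (hecke_pres m) (wd (map T (reduced_word m \<sigma>)))"

text \<open>The \<open>i\<close>-th tensor factor is the list entry with index \<open>i - 1\<close>.\<close>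

definition hecke_basis :: "nat \<Rightarrow> nat list \<Rightarrow> nat falg"
  where "hecke_basis i w =
    (let a = w ! (i - 1); b = w ! i; w' = w[i - 1 := b, i := a] in
      if a < b then wd w'
      else if a > b then wd w' + scl (inverse q - q) (wd w)
      else scl (inverse q) (wd w))"

definition Psi :: "nat \<Rightarrow> nat \<Rightarrow> hecke_gen falg set \<Rightarrow> nat falg \<Rightarrow> nat falg"
  where "Psi m r = induced_hom (End_alg (tensor_power m r))
    (\<lambda>g. case g of T i \<Rightarrow> restrict (lin_ext (hecke_basis i)) (tensor_power m r)
                 | X _ _ \<Rightarrow> undefined)"

definition psi :: "nat \<Rightarrow> nat \<Rightarrow> nat \<Rightarrow> (nat \<Rightarrow> nat) \<Rightarrow> nat falg \<Rightarrow> nat falg"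
  where "psi n r l \<sigma> = restrict
    (lin_ext (\<lambda>w. if w \<in> V_words n r {1..l}
                  then tensor_op l (Psi n l (T_perm l \<sigma>)) id (wd w) else 0))
    (V_level n r l)"


section \<open>The duplex Hecke algebras\<close>

inductive_set x_rels :: "nat \<Rightarrow> nat \<Rightarrow> hecke_gen falg set" for l r :: nat where
  right_up: "\<sigma> permutes {1..l} \<Longrightarrow> i \<in> {1..<l} \<Longrightarrow> g \<in> {X l (srefl i), T i} \<Longrightarrow>
    len l (\<sigma> \<circ> srefl i) = len l \<sigma> + 1 \<Longrightarrow>
    wd [X l \<sigma>, g] - wd [X l (\<sigma> \<circ> srefl i)] \<in> x_rels l r"
| right_down: "\<sigma> permutes {1..l} \<Longrightarrow> i \<in> {1..<l} \<Longrightarrow> g \<in> {X l (srefl i), T i} \<Longrightarrow>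
    len l (\<sigma> \<circ> srefl i) + 1 = len l \<sigma> \<Longrightarrow>
    wd [X l \<sigma>, g] - (wd [X l (\<sigma> \<circ> srefl i)] + scl (inverse q - q) (wd [X l \<sigma>])) \<in> x_rels l r"
| left_up: "\<sigma> permutes {1..l} \<Longrightarrow> i \<in> {1..<l} \<Longrightarrow> g \<in> {X l (srefl i), T i} \<Longrightarrow>
    len l (srefl i \<circ> \<sigma>) = len l \<sigma> + 1 \<Longrightarrow>
    wd [g, X l \<sigma>] - wd [X l (srefl i \<circ> \<sigma>)] \<in> x_rels l r"
| left_down: "\<sigma> permutes {1..l} \<Longrightarrow> i \<in> {1..<l} \<Longrightarrow> g \<in> {X l (srefl i), T i} \<Longrightarrow>
    len l (srefl i \<circ> \<sigma>) + 1 = len l \<sigma> \<Longrightarrow>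
    wd [g, X l \<sigma>] - (wd [X l (srefl i \<circ> \<sigma>)] + scl (inverse q - q) (wd [X l \<sigma>])) \<in> x_rels l r"
| T_x: "\<sigma> permutes {1..l} \<Longrightarrow> l < i \<Longrightarrow> i \<in> {1..<r} \<Longrightarrow>
    wd [T i, X l \<sigma>] - scl (inverse q) (wd [X l \<sigma>]) \<in> x_rels l r"
| x_T: "\<sigma> permutes {1..l} \<Longrightarrow> l < i \<Longrightarrow> i \<in> {1..<r} \<Longrightarrow>
    wd [X l \<sigma>, T i] - scl (inverse q) (wd [X l \<sigma>]) \<in> x_rels l r"

definition HH_pres :: "nat \<Rightarrow> nat \<Rightarrow> hecke_gen pres"
  where "HH_pres l r =
    (if l = 0 then hecke_pres r
     else (T ` {1..<r} \<union> {X l \<sigma> | \<sigma>. \<sigma> permutes {1..l}}, hecke_rels r \<union> x_rels l r))"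

definition duplex_pres :: "nat \<Rightarrow> hecke_gen pres"
  where "duplex_pres r =
    (T ` {1..<r} \<union> {X l \<sigma> | l \<sigma>. l \<in> {1..r} \<and> \<sigma> permutes {1..l}},
     hecke_rels r \<union> (\<Union>l\<in>{1..r}. x_rels l r) \<union>
     {wd [X l \<sigma>, X k \<gamma>] | l k \<sigma> \<gamma>. l \<in> {1..r} \<and> k \<in> {1..r} \<and> k \<noteq> l \<and>
        \<sigma> permutes {1..l} \<and> \<gamma> permutes {1..k}})"

abbreviation uq :: "nat \<Rightarrow> (rat_q, uq_gen falg set) module"
  where "uq m \<equiv> pres_alg (uq_pres m)"

abbreviation HH :: "nat \<Rightarrow> nat \<Rightarrow> (rat_q, hecke_gen falg set) module"
  where "HH l r \<equiv> pres_alg (HH_pres l r)"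

abbreviation duplex :: "nat \<Rightarrow> (rat_q, hecke_gen falg set) module"
  where "duplex r \<equiv> pres_alg (duplex_pres r)"

end

theory Submission
  imports Defs
begin

text \<open>
  Everything is reduced to operators on the full tensor power \<open>W\<close>. Let \<open>\<pi>\<^sub>l\<close> be the projection of \<open>W\<close>
  onto \<open>V\<^bsup>\<otimes>l\<^esup> \<otimes> \<eta>\<^bsub>n+1\<^esub>\<^bsup>\<otimes>(r-l)\<^esup>\<close> along the other basis words. Then \<open>\<psi>\<^sub>\<sigma>\<close> is the restriction of
  \<open>T\<^sub>\<sigma> \<circ> \<pi>\<^sub>l\<close>, where \<open>\<pi>\<^sub>l\<close> commutes with \<open>T\<^sub>i\<close> for \<open>i \<noteq> l\<close>, \<open>T\<^sub>i\<close> is the scalar \<open>q\<^sup>-\<^sup>1\<close> on the image of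
  \<open>\<pi>\<^sub>l\<close> for \<open>i > l\<close>, and \<open>\<pi>\<^sub>l \<pi>\<^sub>k = 0\<close> for \<open>l \<noteq> k\<close>. Together with Matsumoto's theorem, which makes
  \<open>T\<^sub>\<sigma>\<close> independent of the reduced word, this gives all relations. The quantum group of \<open>\<gg>\<ll>\<^sub>n\<close>
  neither creates nor destroys the letter \<open>n + 1\<close>, so it commutes with \<open>\<pi>\<^sub>l\<close>, and it commutes with the
  \<open>T\<^sub>i\<close> by a computation on two tensor factors; hence it commutes with all generators.
\<close>

section \<open>Linear maps and free algebras\<close>

text \<open>Operators are total linear maps on all words and are cut down to a subspace only when an
  algebra homomorphism is asked for. The relations hold on words of length r in arbitrary letters,
  so one verification covers \<open>tensor_power\<close> and every \<open>V_level\<close>. Likewise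
  one family \<open>duplex_op\<close> serves all l at once, as the generators and relators of
  \<open>HH_pres l r\<close> are among those of \<open>duplex_pres r\<close>. In general T_l does
  not commute with \<pi>_l; this does no harm because no relation couples \<open>T l\<close> with
  \<open>X l \<sigma>\<close>. The real obstacle is that T_\<sigma> is built from an arbitrarily
  chosen reduced word, whereas the relations compare the words chosen for \<sigma> and for its
  products with simple reflections. The relations of the quantum group are proved by induction on
  the number of tensor factors: comultiplication splits off the first factor and leaves a relation
  on the others, together with cross terms that are matched by moving each H past E and F at the
  cost of a power of q.\<close>

abbreviation lin :: "('a falg \<Rightarrow> 'b falg) \<Rightarrow> bool"
  where "lin \<equiv> Vector_Spaces.linear scl scl"

interpretation falg_pair: vector_space_pair
  "scl :: rat_q \<Rightarrow> 'a falg \<Rightarrow> 'a falg" "scl :: rat_q \<Rightarrow> 'b falg \<Rightarrow> 'b falg" ..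

lemmas lin_simps = falg_pair.linear_add falg_pair.linear_scale falg_pair.linear_diff
  falg_pair.linear_neg falg_pair.linear_0

lemma linI:
  assumes "\<And>u v. f (u + v) = f u + f v" "\<And>c u. f (scl c u) = scl c (f u)"
  shows "lin f"
  unfolding Vector_Spaces.linear_iff
  by (intro conjI falg.vector_space_axioms allI assms)

lemma lin_compose: "lin f \<Longrightarrow> lin g \<Longrightarrow> lin (\<lambda>x. g (f x))"
  by (auto intro!: linI simp: lin_simps)

lemma lin_add: "lin f \<Longrightarrow> lin g \<Longrightarrow> lin (\<lambda>x. f x + g x)"
  by (auto intro!: linI simp: lin_simps falg.scale_right_distrib)

lemma lin_scl: "lin f \<Longrightarrow> lin (\<lambda>x. scl c (f x))"
  by (auto intro!: linI simp: lin_simps falg.scale_right_distrib mult.commute)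

lemma lin_zero: "lin (\<lambda>x. 0)"
  by (auto intro!: linI)

lemma lin_id: "lin (\<lambda>x. x)" "lin id"
  by (auto intro!: linI)

lemma keys_wd [simp]: "Poly_Mapping.keys (wd w) = {w}"
  by (simp add: wd_def)

lemma lookup_wd: "Poly_Mapping.lookup (wd w) w' = (if w = w' then 1 else 0)"
  by (simp add: wd_def lookup_single when_def)

lemma keys_scl: "Poly_Mapping.keys (scl c p) \<subseteq> Poly_Mapping.keys p"
  by (auto simp: in_keys_iff lookup_scl)

lemma keys_minus_eq: "Poly_Mapping.keys (- p) = Poly_Mapping.keys (p :: 'a falg)"
  by (auto simp: in_keys_iff)

lemma falg_expand: "p = (\<Sum>w\<in>Poly_Mapping.keys p. scl (Poly_Mapping.lookup p w) (wd w))"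
proof (rule poly_mapping_eqI)
  fix k
  have "Poly_Mapping.lookup (\<Sum>w\<in>Poly_Mapping.keys p. scl (Poly_Mapping.lookup p w) (wd w)) k =
      (\<Sum>w\<in>Poly_Mapping.keys p. if w = k then Poly_Mapping.lookup p w else 0)"
    unfolding lookup_sum by (rule sum.cong) (auto simp: lookup_scl lookup_wd)
  then show "Poly_Mapping.lookup p k =
      Poly_Mapping.lookup (\<Sum>w\<in>Poly_Mapping.keys p. scl (Poly_Mapping.lookup p w) (wd w)) k"
    by (simp add: in_keys_iff)
qed

text \<open>Words are linearly independent, so membership in a span of words can be read off from
  the support.\<close>

lemma span_wd_iff: "p \<in> falg.span (wd ` S) \<longleftrightarrow> Poly_Mapping.keys p \<subseteq> S"
proof
  have "falg.subspace {p. Poly_Mapping.keys p \<subseteq> S}"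
    unfolding falg.subspace_def by (auto dest!: subsetD[OF keys_add] subsetD[OF keys_scl])
  then have "falg.span (wd ` S) \<subseteq> {p. Poly_Mapping.keys p \<subseteq> S}"
    by (intro falg.span_minimal) auto
  then show "p \<in> falg.span (wd ` S) \<Longrightarrow> Poly_Mapping.keys p \<subseteq> S" by auto
next
  assume "Poly_Mapping.keys p \<subseteq> S"
  then have "(\<Sum>w\<in>Poly_Mapping.keys p. scl (Poly_Mapping.lookup p w) (wd w)) \<in> falg.span (wd ` S)"
    by (intro falg.span_sum falg.span_scale falg.span_base) auto
  then show "p \<in> falg.span (wd ` S)" using falg_expand[of p] by simp
qed

lemma lin_eq_on_span:
  assumes "lin f" "lin g" "p \<in> falg.span (wd ` S)" "\<And>w. w \<in> S \<Longrightarrow> f (wd w) = g (wd w)"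
  shows "f p = g p"
  by (rule falg_pair.linear_eq_on_span[OF assms(1,2) _ assms(3)]) (use assms(4) in auto)

lemma lin_eqI: "lin f \<Longrightarrow> lin g \<Longrightarrow> (\<And>w. f (wd w) = g (wd w)) \<Longrightarrow> f p = g p"
  by (rule lin_eq_on_span[of f g p UNIV]) (auto simp: span_wd_iff)

lemma lin_into_subspace:
  assumes "lin f" "falg.subspace W" "p \<in> falg.span (wd ` S)" "\<And>w. w \<in> S \<Longrightarrow> f (wd w) \<in> W"
  shows "f p \<in> W"
proof -
  have "f p = (\<Sum>w\<in>Poly_Mapping.keys p. scl (Poly_Mapping.lookup p w) (f (wd w)))"
    by (subst falg_expand[of p]) (simp add: falg_pair.linear_sum assms(1) lin_simps)
  also have "\<dots> \<in> W"
    using assms by (intro falg.subspace_sum falg.subspace_scale) (auto simp: span_wd_iff)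
  finally show ?thesis .
qed

lemma lin_ext_superset:
  assumes "finite S" "Poly_Mapping.keys v \<subseteq> S"
  shows "lin_ext b v = (\<Sum>w\<in>S. scl (Poly_Mapping.lookup v w) (b w))"
  unfolding lin_ext_def using assms
  by (intro sum.mono_neutral_left) (auto simp: in_keys_iff)

lemma lin_lin_ext: "lin (lin_ext b)"
proof (rule linI)
  fix u v :: "'a falg" and c
  let ?S = "Poly_Mapping.keys u \<union> Poly_Mapping.keys v"
  show "lin_ext b (u + v) = lin_ext b u + lin_ext b v"
    using keys_add[of u v]
    by (simp add: lin_ext_superset[of ?S] lookup_add falg.scale_left_distrib sum.distrib)
  show "lin_ext b (scl c u) = scl c (lin_ext b u)"
    using keys_scl[of c u]
    by (simp add: lin_ext_superset[of "Poly_Mapping.keys u"] lookup_scl falg.scale_sum_right)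
qed

lemma lin_ext_wd [simp]: "lin_ext b (wd w) = b w"
  by (simp add: lin_ext_def lookup_wd)

lemma wd_mult: "wd u * wd v = wd (u @ v)"
  by (simp add: wd_def mult_single plus_list_def)

lemma wd_Nil: "wd [] = 1"
  by (simp add: wd_def flip: zero_list_def)

lemma mult_scl_left: "scl c p * p' = scl c (p * p')"
  by (simp add: scl_def mult_map_scale_conv_mult mult.assoc)

lemma lin_mult_left: "lin (\<lambda>p. p * p')"
  by (rule linI) (auto simp: distrib_right mult_scl_left)

text \<open>Scaling is left multiplication by the constant \<open>Poly_Mapping.single 0 c\<close>;
  moving it past the left factor amounts to this constant being central, which is checked on
  words.\<close>

lemma mult_scl_right: "p * scl c p' = scl c (p * p')"
proof -
  have "p * Poly_Mapping.single 0 c = scl c p"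
  proof (rule lin_eqI[OF lin_mult_left lin_scl[OF lin_id(1)]])
    fix w :: "'a list"
    show "wd w * Poly_Mapping.single 0 c = scl c (wd w)"
      by (simp add: wd_def scl_def mult_single mult_map_scale_conv_mult)
  qed
  then show ?thesis
    by (simp add: scl_def mult_map_scale_conv_mult flip: mult.assoc)
qed

lemma lin_mult_right: "lin (\<lambda>p. p' * p)"
  by (rule linI) (auto simp: distrib_left mult_scl_right)

lemma wd_Cons: "wd (a # w) = wd [a] * wd w"
  by (simp add: wd_mult)

lemma lin_tensor_op: "lin (tensor_op k A B)"
  unfolding tensor_op_def by (rule lin_lin_ext)

lemma word_op_Nil [simp]: "word_op \<rho> [] = id"
  and word_op_Cons [simp]: "word_op \<rho> (g # w) = \<rho> g \<circ> word_op \<rho> w"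
  by (simp_all add: word_op_def)

lemma word_op_append: "word_op \<rho> (u @ w) = word_op \<rho> u \<circ> word_op \<rho> w"
  by (induction u) auto

lemma lin_word_op: "(\<And>g. lin (\<rho> g)) \<Longrightarrow> lin (word_op \<rho> w)"
  by (induction w) (auto simp: o_def lin_id intro: lin_compose)

section \<open>Representations of presented algebras\<close>

text \<open>A counterpart of \<open>free_eval\<close> for total operators: no carrier and no
  extensionality enter until \<open>free_eval_End\<close> compares the two.\<close>

definition act :: "('g \<Rightarrow> 'a falg \<Rightarrow> 'a falg) \<Rightarrow> 'g falg \<Rightarrow> 'a falg \<Rightarrow> 'a falg"
  where "act \<rho> p v = lin_ext (\<lambda>w. word_op \<rho> w v) p"

lemma lin_act_left: "lin (\<lambda>p. act \<rho> p v)"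
  unfolding act_def by (rule lin_lin_ext)

lemma act_wd [simp]: "act \<rho> (wd w) v = word_op \<rho> w v"
  by (simp add: act_def)

lemma act_simps [simp]:
  "act \<rho> (p + p') v = act \<rho> p v + act \<rho> p' v"
  "act \<rho> (p - p') v = act \<rho> p v - act \<rho> p' v"
  "act \<rho> (- p) v = - act \<rho> p v"
  "act \<rho> 0 v = 0"
  "act \<rho> 1 v = v"
  "act \<rho> (scl c p) v = scl c (act \<rho> p v)"
  using lin_simps[OF lin_act_left[of \<rho> v]] act_wd[of \<rho> "[]" v] by (auto simp: wd_Nil)

lemma lin_act:
  assumes "\<And>g. lin (\<rho> g)"
  shows "lin (act \<rho> p)"
proof (rule linI)
  note [simp] = lin_simps[OF lin_word_op[OF assms]]
  fix u v c
  show "act \<rho> p (u + v) = act \<rho> p u + act \<rho> p v"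
    by (rule lin_eqI[of "\<lambda>p. act \<rho> p (u + v)"]) (auto intro: lin_act_left lin_add)
  show "act \<rho> p (scl c u) = scl c (act \<rho> p u)"
    by (rule lin_eqI[of "\<lambda>p. act \<rho> p (scl c u)"]) (auto intro: lin_act_left lin_scl)
qed

lemma act_mult:
  assumes "\<And>g. lin (\<rho> g)"
  shows "act \<rho> (p * p') v = act \<rho> p (act \<rho> p' v)"
proof (rule lin_eqI[of "\<lambda>p. act \<rho> (p * p') v"])
  show "lin (\<lambda>p. act \<rho> (p * p') v)" by (rule lin_compose[OF lin_mult_left lin_act_left])
  show "lin (\<lambda>p. act \<rho> p (act \<rho> p' v))" by (rule lin_act_left)
  show "act \<rho> (wd w * p') v = act \<rho> (wd w) (act \<rho> p' v)" for w
  proof (rule lin_eqI[of "\<lambda>p'. act \<rho> (wd w * p') v"])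
    show "lin (\<lambda>p'. act \<rho> (wd w * p') v)" by (rule lin_compose[OF lin_mult_right lin_act_left])
    show "lin (\<lambda>p'. act \<rho> (wd w) (act \<rho> p' v))"
      by (rule lin_compose[OF lin_act_left lin_act[OF assms]])
  qed (simp add: wd_mult word_op_append)
qed

lemma word_op_closed:
  "(\<And>g v. g \<in> G \<Longrightarrow> v \<in> W \<Longrightarrow> \<rho> g v \<in> W) \<Longrightarrow> set w \<subseteq> G \<Longrightarrow> v \<in> W \<Longrightarrow> word_op \<rho> w v \<in> W"
  by (induction w) auto

lemma keys_lists: "Poly_Mapping.keys p \<subseteq> lists G \<Longrightarrow> w \<in> Poly_Mapping.keys p \<Longrightarrow> set w \<subseteq> G"
  by auto

lemma act_closed:
  assumes "falg.subspace W" "\<And>g v. g \<in> G \<Longrightarrow> v \<in> W \<Longrightarrow> \<rho> g v \<in> W"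
    and "Poly_Mapping.keys p \<subseteq> lists G" "v \<in> W"
  shows "act \<rho> p v \<in> W"
  unfolding act_def lin_ext_def
  using assms(1,4) word_op_closed[of G W \<rho>, OF assms(2) keys_lists[OF assms(3)]]
  by (intro falg.subspace_sum falg.subspace_scale) auto

text \<open>Commutation is known only on the stable subspace W, so each partial word has to be kept
  inside W before the next letter is exchanged with f.\<close>

lemma act_commute:
  assumes "\<And>g v. g \<in> G \<Longrightarrow> v \<in> W \<Longrightarrow> \<rho> g v \<in> W"
    and "\<And>g v. g \<in> G \<Longrightarrow> v \<in> W \<Longrightarrow> f (\<rho> g v) = \<rho> g (f v)"
    and "lin f" "Poly_Mapping.keys p \<subseteq> lists G" "v \<in> W"
  shows "f (act \<rho> p v) = act \<rho> p (f v)"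
proof -
  have "f (word_op \<rho> w v) = word_op \<rho> w (f v)" if "set w \<subseteq> G" for w
    using that
  proof (induction w)
    case (Cons g w)
    then show ?case using assms(2)[of g "word_op \<rho> w v"] word_op_closed[of G W \<rho> w v] assms(1,5)
      by auto
  qed simp
  then have "f (act \<rho> p v) = (\<Sum>w\<in>Poly_Mapping.keys p. scl (Poly_Mapping.lookup p w) (word_op \<rho> w (f v)))"
    using assms(3,4) by (auto simp: act_def lin_ext_def falg_pair.linear_sum lin_simps in_lists_conv_set
        intro!: sum.cong arg_cong2[of _ _ _ _ scl])
  then show ?thesis by (simp add: act_def lin_ext_def)
qed

section \<open>Extensional endomorphism algebras\<close>

lemma End_alg_simps:
  "\<one>\<^bsub>End_alg W\<^esub> = (\<lambda>v\<in>W. v)" "\<zero>\<^bsub>End_alg W\<^esub> = (\<lambda>v\<in>W. 0)"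
  "f \<otimes>\<^bsub>End_alg W\<^esub> g = compose W f g" "f \<oplus>\<^bsub>End_alg W\<^esub> g = (\<lambda>v\<in>W. f v + g v)"
  "c \<odot>\<^bsub>End_alg W\<^esub> f = (\<lambda>v\<in>W. scl c (f v))"
  by (simp_all add: End_alg_def)

lemma restrict_in_End:
  assumes "falg.subspace W" "lin f" "\<And>v. v \<in> W \<Longrightarrow> f v \<in> W"
  shows "restrict f W \<in> carrier (End_alg W)"
  using assms by (auto simp: End_alg_def falg.subspace_add falg.subspace_scale lin_simps)

text \<open>\<open>free_eval\<close> is a sum taken in the record \<open>End_alg W\<close>, and the
  rules for \<open>finsum\<close> ask for an abelian monoid.\<close>

lemma abelian_monoid_End:
  assumes W: "falg.subspace W"
  shows "abelian_monoid (End_alg W)"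
proof (rule abelian_monoidI)
  show "\<zero>\<^bsub>End_alg W\<^esub> \<in> carrier (End_alg W)"
    unfolding End_alg_simps by (rule restrict_in_End[OF W lin_zero]) (simp add: W falg.subspace_0)
qed (use W in \<open>auto simp: End_alg_def falg.subspace_add falg.subspace_scale falg.scale_right_distrib
      fun_eq_iff Pi_iff PiE_def extensional_def restrict_def add_ac\<close>)

lemma End_finsum:
  assumes W: "falg.subspace W" and "finite S"
    and "\<And>i. i \<in> S \<Longrightarrow> lin (f i)" "\<And>i v. i \<in> S \<Longrightarrow> v \<in> W \<Longrightarrow> f i v \<in> W"
  shows "(\<Oplus>\<^bsub>End_alg W\<^esub>i\<in>S. restrict (f i) W) = restrict (\<lambda>v. \<Sum>i\<in>S. f i v) W"
  using assms(2-)
proof (induction S rule: finite_induct)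
  interpret abelian_monoid "End_alg W" by (rule abelian_monoid_End[OF W])
  case empty
  show ?case by (simp add: End_alg_simps)
next
  interpret abelian_monoid "End_alg W" by (rule abelian_monoid_End[OF W])
  case (insert i S)
  then have "(\<lambda>i. restrict (f i) W) \<in> insert i S \<rightarrow> carrier (End_alg W)"
    using restrict_in_End[OF W] by auto
  with insert show ?case
    by (subst finsum_insert) (auto simp: End_alg_simps fun_eq_iff restrict_def)
qed

text \<open>The bridge from the record operations to total operators. Stability of W makes
  \<open>compose W\<close> of two restrictions the restriction of the composite.\<close>

lemma free_eval_End:
  assumes W: "falg.subspace W" and lin: "\<And>g. lin (\<rho> g)"
    and closed: "\<And>g v. g \<in> G \<Longrightarrow> v \<in> W \<Longrightarrow> \<rho> g v \<in> W"
    and \<phi>: "\<And>g. g \<in> G \<Longrightarrow> \<phi> g = restrict (\<rho> g) W"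
    and p: "Poly_Mapping.keys p \<subseteq> lists G"
  shows "free_eval (End_alg W) \<phi> p = restrict (act \<rho> p) W"
proof -
  interpret abelian_monoid "End_alg W" by (rule abelian_monoid_End[OF W])
  have word: "foldr (\<lambda>g y. \<phi> g \<otimes>\<^bsub>End_alg W\<^esub> y) w \<one>\<^bsub>End_alg W\<^esub> = restrict (word_op \<rho> w) W"
    if "set w \<subseteq> G" for w
    using that
  proof (induction w)
    case (Cons g w)
    then show ?case using word_op_closed[of G W \<rho> w, OF closed]
      by (auto simp: \<phi> End_alg_simps compose_def fun_eq_iff)
  qed (simp add: End_alg_simps id_def)
  let ?f = "\<lambda>w v. scl (Poly_Mapping.lookup p w) (word_op \<rho> w v)"
  have f: "lin (?f w)" "\<And>v. v \<in> W \<Longrightarrow> ?f w v \<in> W" if "w \<in> Poly_Mapping.keys p" for w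
    using word_op_closed[of G W \<rho> w, OF closed keys_lists[OF p that]] W
    by (auto intro!: lin_scl lin_word_op lin falg.subspace_scale)
  have "free_eval (End_alg W) \<phi> p = (\<Oplus>\<^bsub>End_alg W\<^esub>w\<in>Poly_Mapping.keys p. restrict (?f w) W)"
    unfolding free_eval_def
  proof (rule finsum_cong')
    show "(\<lambda>w. restrict (?f w) W) \<in> Poly_Mapping.keys p \<rightarrow> carrier (End_alg W)"
      using restrict_in_End[OF W f] by blast
  qed (simp_all add: word keys_lists[OF p] End_alg_simps(5) cong: restrict_cong)
  also have "\<dots> = restrict (act \<rho> p) W"
    unfolding act_def lin_ext_def by (rule End_finsum[OF W]) (use f in auto)
  finally show ?thesis .
qed

section \<open>Free algebras and their quotients\<close>

lemma in_free_alg: "p \<in> carrier (free_alg G) \<longleftrightarrow> Poly_Mapping.keys p \<subseteq> lists G"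
  by (simp add: free_alg_def)

lemma free_alg_simps [simp]:
  "p \<otimes>\<^bsub>free_alg G\<^esub> p' = p * p'" "p \<oplus>\<^bsub>free_alg G\<^esub> p' = p + p'"
  "\<one>\<^bsub>free_alg G\<^esub> = 1" "\<zero>\<^bsub>free_alg G\<^esub> = 0"
  by (simp_all add: free_alg_def)

lemma free_alg_closed [intro]:
  "p \<in> carrier (free_alg G) \<Longrightarrow> p' \<in> carrier (free_alg G) \<Longrightarrow> p + p' \<in> carrier (free_alg G)"
  "p \<in> carrier (free_alg G) \<Longrightarrow> p' \<in> carrier (free_alg G) \<Longrightarrow> p - p' \<in> carrier (free_alg G)"
  "p \<in> carrier (free_alg G) \<Longrightarrow> p' \<in> carrier (free_alg G) \<Longrightarrow> p * p' \<in> carrier (free_alg G)"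
  "p \<in> carrier (free_alg G) \<Longrightarrow> - p \<in> carrier (free_alg G)"
  "p \<in> carrier (free_alg G) \<Longrightarrow> scl c p \<in> carrier (free_alg G)"
  "0 \<in> carrier (free_alg G)" "1 \<in> carrier (free_alg G)"
  "set w \<subseteq> G \<Longrightarrow> wd w \<in> carrier (free_alg G)"
proof -
  show "p * p' \<in> carrier (free_alg G)" if "p \<in> carrier (free_alg G)" "p' \<in> carrier (free_alg G)"
    using that keys_mult[of p p'] by (fastforce simp: in_free_alg plus_list_def)
  show "p - p' \<in> carrier (free_alg G)" if "p \<in> carrier (free_alg G)" "p' \<in> carrier (free_alg G)"
    using that keys_add[of p "- p'"] by (auto simp: in_free_alg keys_minus_eq)
  show "1 \<in> carrier (free_alg G)" by (auto simp: in_free_alg zero_list_def)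
qed (use keys_add[of p p'] keys_scl[of c p] in \<open>auto simp: in_free_alg keys_minus_eq\<close>)

lemma ring_free_alg: "ring (free_alg G)"
proof (intro ringI abelian_groupI monoidI)
  fix x assume "x \<in> carrier (free_alg G)"
  then show "\<exists>y\<in>carrier (free_alg G). y \<oplus>\<^bsub>free_alg G\<^esub> x = \<zero>\<^bsub>free_alg G\<^esub>"
    by (intro bexI[of _ "- x"]) auto
qed (auto simp: algebra_simps)

lemma subgroup_free_algI:
  assumes "K \<subseteq> carrier (free_alg G)" "0 \<in> K"
    and "\<And>a b. a \<in> K \<Longrightarrow> b \<in> K \<Longrightarrow> a + b \<in> K" "\<And>a. a \<in> K \<Longrightarrow> - a \<in> K"
  shows "subgroup K (add_monoid (free_alg G))"
proof -
  interpret ring "free_alg G" by (rule ring_free_alg)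
  show ?thesis
  proof (rule group.subgroupI[OF a_group])
    fix a assume a: "a \<in> K"
    have "\<ominus>\<^bsub>free_alg G\<^esub> a = - a"
      by (rule minus_equality) (use a assms(1) in auto)
    then show "inv\<^bsub>add_monoid (free_alg G)\<^esub> a \<in> K"
      using assms(4)[OF a] by (simp add: a_inv_def)
  qed (use assms in auto)
qed

text \<open>If a relator left the carrier, no ideal would contain it, and \<open>genideal\<close>,
  an intersection over the ideals containing the relators, would degenerate to
  \<open>UNIV\<close>.\<close>

locale presentation =
  fixes P :: "'g pres"
  assumes rels: "snd P \<subseteq> carrier (free_alg (fst P))"
begin

abbreviation "FA \<equiv> free_alg (fst P)"

sublocale FA: ring FA by (rule ring_free_alg)

sublocale I: ideal "rel_ideal P" FA
  unfolding rel_ideal_def by (rule FA.genideal_ideal[OF rels])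

lemma rel_in_ideal: "\<rho> \<in> snd P \<Longrightarrow> \<rho> \<in> rel_ideal P"
  unfolding rel_ideal_def using FA.genideal_self[OF rels] by blast

lemma rel_ideal_subset: "ideal K FA \<Longrightarrow> snd P \<subseteq> K \<Longrightarrow> rel_ideal P \<subseteq> K"
  unfolding rel_ideal_def by (rule FA.genideal_minimal)

lemma minus_FA: "a \<in> carrier FA \<Longrightarrow> \<ominus>\<^bsub>FA\<^esub> a = - a"
  by (rule FA.minus_equality) auto

lemma ideal_closed:
  "a \<in> rel_ideal P \<Longrightarrow> b \<in> rel_ideal P \<Longrightarrow> a + b \<in> rel_ideal P"
  "a \<in> rel_ideal P \<Longrightarrow> - a \<in> rel_ideal P"
  "a \<in> rel_ideal P \<Longrightarrow> b \<in> rel_ideal P \<Longrightarrow> a - b \<in> rel_ideal P"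
  "a \<in> rel_ideal P \<Longrightarrow> p \<in> carrier FA \<Longrightarrow> a * p \<in> rel_ideal P"
  "a \<in> rel_ideal P \<Longrightarrow> p \<in> carrier FA \<Longrightarrow> p * a \<in> rel_ideal P"
  "a \<in> rel_ideal P \<Longrightarrow> scl c a \<in> rel_ideal P"
  "0 \<in> rel_ideal P"
proof -
  show add: "a + b \<in> rel_ideal P" if "a \<in> rel_ideal P" "b \<in> rel_ideal P" for a b
    using I.a_closed[OF that] by simp
  show neg: "- a \<in> rel_ideal P" if "a \<in> rel_ideal P" for a
    using I.a_inv_closed[OF that] minus_FA[of a] I.a_subset that by auto
  show "a - b \<in> rel_ideal P" if "a \<in> rel_ideal P" "b \<in> rel_ideal P"
    using add[OF that(1) neg[OF that(2)]] by simp
  \<comment> \<open>Scalars belong to the free algebra: \<open>scl c a\<close> is the product of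
    \<open>scl c 1\<close> and a.\<close>
  show "scl c a \<in> rel_ideal P" if "a \<in> rel_ideal P"
    using I.I_l_closed[OF that, of "scl c 1"] by (auto simp: mult_scl_left)
  show "0 \<in> rel_ideal P" using I.zero_closed by simp
qed (use I.I_l_closed I.I_r_closed in auto)

lemma cls_eq: "cls P p = {i + p | i. i \<in> rel_ideal P}"
  by (auto simp: cls_def a_r_coset_def r_coset_def)

lemma cls_eq_iff:
  "cls P p = cls P p' \<longleftrightarrow> p - p' \<in> rel_ideal P"
proof
  assume "cls P p = cls P p'"
  moreover have "p \<in> cls P p" using ideal_closed(7) by (force simp: cls_eq)
  ultimately show "p - p' \<in> rel_ideal P" by (auto simp: cls_eq)
next
  assume d: "p - p' \<in> rel_ideal P"
  show "cls P p = cls P p'"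
  proof (intro equalityI subsetI)
    fix x assume "x \<in> cls P p"
    then obtain i where "i \<in> rel_ideal P" "x = i + p" by (auto simp: cls_eq)
    then have "x = (i + (p - p')) + p'" "i + (p - p') \<in> rel_ideal P" using d ideal_closed(1) by auto
    then show "x \<in> cls P p'" unfolding cls_eq by blast
  next
    fix x assume "x \<in> cls P p'"
    then obtain i where "i \<in> rel_ideal P" "x = i + p'" by (auto simp: cls_eq)
    then have "x = (i - (p - p')) + p" "i - (p - p') \<in> rel_ideal P" using d ideal_closed(3) by auto
    then show "x \<in> cls P p" unfolding cls_eq by blast
  qed
qed

lemma cls_diff_ideal: "x \<in> cls P p \<Longrightarrow> x - p \<in> rel_ideal P"
  by (auto simp: cls_eq)

lemma in_cls: "p \<in> cls P p"
  using ideal_closed(7) by (force simp: cls_eq)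

lemma cls_subset: "p \<in> carrier FA \<Longrightarrow> cls P p \<subseteq> carrier FA"
  using I.a_subset by (auto simp: cls_eq)

lemma cls_hom: "cls P \<in> ring_hom FA (FA Quot (rel_ideal P))"
  using I.rcos_ring_hom by (simp add: cls_def[abs_def])

lemma pres_alg_simps:
  "carrier (pres_alg P) = cls P ` carrier FA"
  "\<one>\<^bsub>pres_alg P\<^esub> = cls P 1" "\<zero>\<^bsub>pres_alg P\<^esub> = cls P 0"
  "p \<in> carrier FA \<Longrightarrow> p' \<in> carrier FA \<Longrightarrow> cls P p \<otimes>\<^bsub>pres_alg P\<^esub> cls P p' = cls P (p * p')"
  "p \<in> carrier FA \<Longrightarrow> p' \<in> carrier FA \<Longrightarrow> cls P p \<oplus>\<^bsub>pres_alg P\<^esub> cls P p' = cls P (p + p')"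
  "p \<in> carrier FA \<Longrightarrow> c \<odot>\<^bsub>pres_alg P\<^esub> cls P p = cls P (scl c p)"
proof -
  have ext: "carrier (pres_alg P) = carrier (FA Quot (rel_ideal P))"
    "\<And>X Y. X \<otimes>\<^bsub>pres_alg P\<^esub> Y = X \<otimes>\<^bsub>FA Quot (rel_ideal P)\<^esub> Y"
    "\<And>X Y. X \<oplus>\<^bsub>pres_alg P\<^esub> Y = X \<oplus>\<^bsub>FA Quot (rel_ideal P)\<^esub> Y"
    "\<one>\<^bsub>pres_alg P\<^esub> = \<one>\<^bsub>FA Quot (rel_ideal P)\<^esub>"
    "\<zero>\<^bsub>pres_alg P\<^esub> = \<zero>\<^bsub>FA Quot (rel_ideal P)\<^esub>"
    by (simp_all add: pres_alg_def ring.defs module.defs)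
  show "carrier (pres_alg P) = cls P ` carrier FA"
    by (auto simp: ext FactRing_def A_RCOSETS_def RCOSETS_def cls_def a_r_coset_def)
  show "\<one>\<^bsub>pres_alg P\<^esub> = cls P 1"
    by (simp add: ext FactRing_def cls_def)
  show "\<zero>\<^bsub>pres_alg P\<^esub> = cls P 0"
    unfolding cls_eq by (simp add: ext FactRing_def)
  assume p: "p \<in> carrier FA"
  show "cls P p \<otimes>\<^bsub>pres_alg P\<^esub> cls P p' = cls P (p * p')" if "p' \<in> carrier FA"
    using ring_hom_mult[OF cls_hom p that] by (simp add: ext)
  show "cls P p \<oplus>\<^bsub>pres_alg P\<^esub> cls P p' = cls P (p + p')" if "p' \<in> carrier FA"
    using ring_hom_add[OF cls_hom p that] by (simp add: ext)
  \<comment> \<open>The scalar action on a coset is defined as a union over all representatives;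
    every representative contributes the same coset.\<close>
  have const: "cls P (scl c x) = cls P (scl c p)" if "x \<in> cls P p" for x
    using ideal_closed(6)[OF cls_diff_ideal[OF that], of c]
    by (simp add: cls_eq_iff falg.scale_right_diff_distrib)
  have "cls P p \<noteq> {}" using in_cls[of p] by blast
  from SUP_eq_const[OF this const] have "(\<Union>x\<in>cls P p. cls P (scl c x)) = cls P (scl c p)" .
  then show "c \<odot>\<^bsub>pres_alg P\<^esub> cls P p = cls P (scl c p)"
    by (simp add: pres_alg_def ring.defs module.defs)
qed

text \<open>\<open>induced_hom\<close> applies \<open>the_elem\<close> to an image, so its value on
  a coset is known once \<open>free_eval\<close> is constant there. Both kinds of target,
  \<open>End_alg W\<close> and another presented algebra, go through this obligation.\<close>

lemma induced_hom_cls: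
  assumes "p \<in> carrier FA" "\<And>x. x \<in> carrier FA \<Longrightarrow> x - p \<in> rel_ideal P \<Longrightarrow> free_eval B \<phi> x = y"
  shows "induced_hom B \<phi> (cls P p) = y"
proof -
  have "free_eval B \<phi> ` cls P p = {y}"
    using assms cls_subset[OF assms(1)] cls_diff_ideal in_cls[of p] by fast
  then show ?thesis by (simp add: induced_hom_def)
qed

end

text \<open>\<phi> is kept apart from \<rho> because the generator map inside \<open>Psi\<close> is
  \<open>undefined\<close> at the letters \<open>X\<close>, while \<open>\<rho> g\<close> has to be
  a total linear map for every letter.\<close>

locale representation = presentation P for P :: "'g pres" +
  fixes W :: "'a falg set" and \<rho> :: "'g \<Rightarrow> 'a falg \<Rightarrow> 'a falg" and \<phi> :: "'g \<Rightarrow> 'a falg \<Rightarrow> 'a falg"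
  assumes W: "falg.subspace W" and lin: "\<And>g. lin (\<rho> g)"
    and closed: "\<And>g v. g \<in> fst P \<Longrightarrow> v \<in> W \<Longrightarrow> \<rho> g v \<in> W"
    and rel: "\<And>u v. u \<in> snd P \<Longrightarrow> v \<in> W \<Longrightarrow> act \<rho> u v = 0"
    and \<phi>: "\<And>g. g \<in> fst P \<Longrightarrow> \<phi> g = restrict (\<rho> g) W"
begin

lemma act_in_W: "p \<in> carrier FA \<Longrightarrow> v \<in> W \<Longrightarrow> act \<rho> p v \<in> W"
  using act_closed[OF W closed] by (auto simp: in_free_alg)

text \<open>The annihilator of W in the free algebra is a two-sided ideal, closed under
  multiplication from the right because W is stable. It contains the relators, hence the ideal that
  they generate.\<close>

lemma act_rel_ideal:
  assumes "u \<in> rel_ideal P" "v \<in> W"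
  shows "act \<rho> u v = 0"
proof -
  let ?K = "{p \<in> carrier FA. \<forall>v\<in>W. act \<rho> p v = 0}"
  have "ideal ?K FA"
    by (intro idealI subgroup_free_algI ring_free_alg)
       (auto simp: act_mult lin act_in_W lin_simps[OF lin_act[OF lin]])
  then have "rel_ideal P \<subseteq> ?K"
    by (rule rel_ideal_subset) (use rels rel in auto)
  then show ?thesis using assms by auto
qed

lemma induced_hom_cls_eq:
  assumes p: "p \<in> carrier FA"
  shows "induced_hom (End_alg W) \<phi> (cls P p) = restrict (act \<rho> p) W"
proof (rule induced_hom_cls[OF p])
  fix x assume x: "x \<in> carrier FA" "x - p \<in> rel_ideal P"
  have "act \<rho> x v = act \<rho> p v" if "v \<in> W" for v
    using act_rel_ideal[OF x(2) that] by simp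
  then show "free_eval (End_alg W) \<phi> x = restrict (act \<rho> p) W"
    using free_eval_End[OF W lin closed \<phi>, where p = x] x(1) by (auto simp: in_free_alg)
qed

lemma induced_hom_alg_hom: "induced_hom (End_alg W) \<phi> \<in> alg_hom (pres_alg P) (End_alg W)"
  unfolding alg_hom_def
proof (intro CollectI conjI ring_hom_memI allI ballI)
  note [simp] = pres_alg_simps induced_hom_cls_eq End_alg_simps
  show "induced_hom (End_alg W) \<phi> x \<in> carrier (End_alg W)" if "x \<in> carrier (pres_alg P)" for x
    using that restrict_in_End[OF W lin_act[OF lin] act_in_W] by auto
  show "induced_hom (End_alg W) \<phi> (x \<otimes>\<^bsub>pres_alg P\<^esub> y) =
      induced_hom (End_alg W) \<phi> x \<otimes>\<^bsub>End_alg W\<^esub> induced_hom (End_alg W) \<phi> y"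
    if "x \<in> carrier (pres_alg P)" "y \<in> carrier (pres_alg P)" for x y
    using that by (auto simp: free_alg_closed compose_def act_mult lin act_in_W)
  show "induced_hom (End_alg W) \<phi> (x \<oplus>\<^bsub>pres_alg P\<^esub> y) =
      induced_hom (End_alg W) \<phi> x \<oplus>\<^bsub>End_alg W\<^esub> induced_hom (End_alg W) \<phi> y"
    if "x \<in> carrier (pres_alg P)" "y \<in> carrier (pres_alg P)" for x y
    using that by (auto simp: free_alg_closed)
  show "induced_hom (End_alg W) \<phi> \<one>\<^bsub>pres_alg P\<^esub> = \<one>\<^bsub>End_alg W\<^esub>"
    by (auto simp: free_alg_closed)
  show "induced_hom (End_alg W) \<phi> (c \<odot>\<^bsub>pres_alg P\<^esub> x) =
      c \<odot>\<^bsub>End_alg W\<^esub> induced_hom (End_alg W) \<phi> x" if "x \<in> carrier (pres_alg P)" for x c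
    using that by (auto simp: free_alg_closed)
qed

lemma induced_hom_gen:
  "g \<in> fst P \<Longrightarrow> induced_hom (End_alg W) \<phi> (cls P (wd [g])) = restrict (\<rho> g) W"
  by (subst induced_hom_cls_eq) (auto simp: free_alg_closed)

end

lemma (in presentation) free_eval_pres_alg:
  assumes p: "p \<in> carrier FA"
  shows "free_eval (pres_alg P) (\<lambda>g. cls P (wd [g])) p = cls P p"
proof -
  interpret B: abelian_monoid "pres_alg P"
    by (rule abelian_monoidI) (auto simp: pres_alg_simps free_alg_closed add_ac)
  have word: "foldr (\<lambda>g y. cls P (wd [g]) \<otimes>\<^bsub>pres_alg P\<^esub> y) w \<one>\<^bsub>pres_alg P\<^esub> = cls P (wd w)"
    if "set w \<subseteq> fst P" for w
    using that
  proof (induction w)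
    case (Cons g w)
    then show ?case by (subst wd_Cons) (auto simp: pres_alg_simps free_alg_closed)
  qed (simp add: pres_alg_simps wd_Nil)
  have sum: "(\<Oplus>\<^bsub>pres_alg P\<^esub>w\<in>S. cls P (f w)) = cls P (\<Sum>w\<in>S. f w) \<and> (\<Sum>w\<in>S. f w) \<in> carrier FA"
    if "finite S" "\<And>w. w \<in> S \<Longrightarrow> f w \<in> carrier FA" for S and f :: "'g list \<Rightarrow> 'g falg"
    using that
  proof (induction S rule: finite_induct)
    case empty
    show ?case by (auto simp: pres_alg_simps)
  next
    case (insert w S)
    then have "(\<lambda>i. cls P (f i)) \<in> insert w S \<rightarrow> carrier (pres_alg P)"
      by (auto simp: pres_alg_simps)
    with insert show ?case
      by (subst B.finsum_insert) (auto simp: pres_alg_simps free_alg_closed)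
  qed
  let ?f = "\<lambda>w. scl (Poly_Mapping.lookup p w) (wd w)"
  have f: "set w \<subseteq> fst P" "?f w \<in> carrier FA" if "w \<in> Poly_Mapping.keys p" for w
    using that p by (auto simp: in_free_alg lookup_scl dest!: subsetD[OF keys_scl])
  have "free_eval (pres_alg P) (\<lambda>g. cls P (wd [g])) p =
      (\<Oplus>\<^bsub>pres_alg P\<^esub>w\<in>Poly_Mapping.keys p. cls P (?f w))"
    unfolding free_eval_def
    by (rule B.finsum_cong') (use f word in \<open>auto simp: pres_alg_simps free_alg_closed\<close>)
  also have "\<dots> = cls P p"
    using sum[of "Poly_Mapping.keys p" ?f] f falg_expand[of p] by simp
  finally show ?thesis .
qed

text \<open>Made for \<open>uq_embed\<close>. The ideal of Q cuts out of the smaller free algebra an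
  ideal that contains the relators of P, hence the whole ideal of P.\<close>

lemma induced_hom_mono_pres:
  assumes "presentation P" "presentation Q" "fst P \<subseteq> fst Q" "snd P \<subseteq> snd Q"
    and p: "p \<in> carrier (free_alg (fst P))"
  shows "induced_hom (pres_alg Q) (\<lambda>g. cls Q (wd [g])) (cls P p) = cls Q p"
proof -
  interpret P: presentation P by fact
  interpret Q: presentation Q by fact
  have sub: "x \<in> carrier Q.FA" if "x \<in> carrier P.FA" for x
    using that assms(3) by (auto simp: in_free_alg in_lists_conv_set)
  let ?K = "carrier P.FA \<inter> rel_ideal Q"
  have "ideal ?K P.FA"
    by (intro idealI subgroup_free_algI ring_free_alg)
       (auto intro: Q.ideal_closed sub)
  then have ideal: "rel_ideal P \<subseteq> rel_ideal Q"
    using P.rel_ideal_subset[of ?K] P.rels assms(4) Q.rel_in_ideal by auto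
  show ?thesis
  proof (rule P.induced_hom_cls[OF p])
    fix x assume x: "x \<in> carrier P.FA" "x - p \<in> rel_ideal P"
    then have "cls Q x = cls Q p" using ideal by (auto simp: Q.cls_eq_iff)
    then show "free_eval (pres_alg Q) (\<lambda>g. cls Q (wd [g])) x = cls Q p"
      using Q.free_eval_pres_alg[OF sub[OF x(1)]] by simp
  qed
qed

section \<open>Reduced words\<close>

definition inversions :: "nat \<Rightarrow> (nat \<Rightarrow> nat) \<Rightarrow> (nat \<times> nat) set"
  where "inversions m \<sigma> = {(a, b). a \<in> {1..m} \<and> b \<in> {1..m} \<and> a < b \<and> \<sigma> b < \<sigma> a}"

abbreviation perm_inv :: "(nat \<Rightarrow> nat) \<Rightarrow> nat \<Rightarrow> nat"
  where "perm_inv \<equiv> inv_into UNIV"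

lemma finite_inversions: "finite (inversions m \<sigma>)"
  by (rule finite_subset[of _ "{1..m} \<times> {1..m}"]) (auto simp: inversions_def)

lemma inversions_id: "inversions m id = {}"
  by (auto simp: inversions_def)

lemma srefl_permutes: "i \<in> {1..<m} \<Longrightarrow> srefl i permutes {1..m}"
  by (rule permutes_swap_id) auto

lemma srefl_comp_permutes:
  "\<sigma> permutes {1..m} \<Longrightarrow> i \<in> {1..<m} \<Longrightarrow> srefl i \<circ> \<sigma> permutes {1..m}"
  "\<sigma> permutes {1..m} \<Longrightarrow> i \<in> {1..<m} \<Longrightarrow> \<sigma> \<circ> srefl i permutes {1..m}"
  by (rule permutes_compose[OF _ srefl_permutes] permutes_compose[OF srefl_permutes]; assumption)+

lemma transpose_comp_cancel [simp]:
  "Transposition.transpose a b \<circ> (Transposition.transpose a b \<circ> f) = f"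
  "f \<circ> Transposition.transpose a b \<circ> Transposition.transpose a b = f"
  by (simp_all add: fun_eq_iff)

lemma srefl_prod_simps [simp]:
  "srefl_prod [] = id" "srefl_prod (i # is) = srefl i \<circ> srefl_prod is"
  by (simp_all add: srefl_prod_def)

lemma srefl_prod_append: "srefl_prod (is @ js) = srefl_prod is \<circ> srefl_prod js"
  by (induction "is") (simp_all add: o_assoc)

lemma srefl_prod_permutes: "set is \<subseteq> {1..<m} \<Longrightarrow> srefl_prod is permutes {1..m}"
proof (induction "is")
  case (Cons i js)
  then show ?case using srefl_comp_permutes(1)[of "srefl_prod js" m i] by (simp del: o_apply)
qed (simp only: srefl_prod_simps permutes_id)

lemma inv_transpose_comp:
  assumes "\<sigma> permutes S"
  shows "perm_inv (Transposition.transpose a b \<circ> \<sigma>) = perm_inv \<sigma> \<circ> Transposition.transpose a b"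
proof -
  have "bij \<sigma>" using assms by (rule permutes_bij)
  then show ?thesis by (subst o_inv_distrib) (auto simp: inv_equality)
qed

text \<open>Composing with \<open>srefl i\<close> on the left exchanges the values i and i + 1 and
  keeps the order of every other pair of values. So only the pair of positions of these two values
  changes its status.\<close>

lemma card_inversions_ascent:
  assumes \<sigma>: "\<sigma> permutes {1..m}" and i: "i \<in> {1..<m}" and asc: "perm_inv \<sigma> i < perm_inv \<sigma> (Suc i)"
  shows "card (inversions m (srefl i \<circ> \<sigma>)) = Suc (card (inversions m \<sigma>))"
proof -
  define a b where "a = perm_inv \<sigma> i" and "b = perm_inv \<sigma> (Suc i)"
  have a: "\<sigma> x = i \<longleftrightarrow> a = x" and b: "\<sigma> x = Suc i \<longleftrightarrow> b = x" for x
    unfolding a_def b_def by (rule permutes_inv_eq[OF \<sigma>, symmetric])+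
  have ab: "a \<in> {1..m}" "b \<in> {1..m}" "a < b"
    unfolding a_def b_def permutes_in_image[OF permutes_inv[OF \<sigma>]] using i asc by simp_all
  have "srefl i (\<sigma> d) < srefl i (\<sigma> c) \<longleftrightarrow> (c = a \<and> d = b) \<or> \<sigma> d < \<sigma> c" if "c < d" for c d
    using that ab(3) a[of c] b[of c] a[of d] b[of d] by (auto simp: transpose_def)
  then have "inversions m (srefl i \<circ> \<sigma>) = insert (a, b) (inversions m \<sigma>)"
    using ab by (auto simp: inversions_def)
  moreover have "(a, b) \<notin> inversions m \<sigma>"
    using a[of a] b[of b] by (simp add: inversions_def)
  ultimately show ?thesis by (simp add: finite_inversions)
qed

lemma card_inversions_descent:
  assumes \<sigma>: "\<sigma> permutes {1..m}" and i: "i \<in> {1..<m}" and "perm_inv \<sigma> (Suc i) < perm_inv \<sigma> i"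
  shows "card (inversions m \<sigma>) = Suc (card (inversions m (srefl i \<circ> \<sigma>)))"
  using card_inversions_ascent[OF srefl_comp_permutes(1)[OF \<sigma> i] i] assms(3)
  by (simp add: inv_transpose_comp[OF \<sigma>])

lemma descent_cases:
  assumes "\<sigma> permutes {1..m}"
  obtains "perm_inv \<sigma> i < perm_inv \<sigma> (Suc i)" | "perm_inv \<sigma> (Suc i) < perm_inv \<sigma> i"
proof -
  have "perm_inv \<sigma> i \<noteq> perm_inv \<sigma> (Suc i)"
    by (simp add: inj_eq[OF permutes_inj[OF permutes_inv[OF assms]]])
  then show ?thesis using that by (meson linorder_neqE_nat)
qed

text \<open>The inverse increases strictly on {1..m} with values there, so it satisfies k \<le>
  \<open>perm_inv \<sigma> k\<close>; a permutation of {1..m} that never decreases a point is the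
  identity.\<close>

lemma no_descents_imp_id:
  assumes \<sigma>: "\<sigma> permutes {1..m}" and asc: "\<And>i. i \<in> {1..<m} \<Longrightarrow> perm_inv \<sigma> i < perm_inv \<sigma> (Suc i)"
  shows "\<sigma> = id"
proof -
  have perm: "perm_inv \<sigma> permutes {1..m}" by (rule permutes_inv[OF \<sigma>])
  have "1 \<le> k \<Longrightarrow> k \<le> m \<Longrightarrow> k \<le> perm_inv \<sigma> k" for k
  proof (induction k)
    case (Suc k)
    then show ?case using asc[of k] permutes_in_image[OF perm, of "Suc k"] by (cases k) auto
  qed simp
  then have "perm_inv \<sigma> = id" by (intro permutes_natset_ge[OF perm]) auto
  then have "perm_inv (perm_inv \<sigma>) = id" by (simp add: inv_id)
  then show ?thesis using permutes_inv_inv[OF \<sigma>] by simp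
qed

text \<open>Sorting: as long as there is an inversion there is a descent i, and splitting off
  \<open>srefl i\<close> removes exactly one inversion.\<close>

lemma ex_reduced_word:
  assumes "\<sigma> permutes {1..m}"
  shows "\<exists>is. set is \<subseteq> {1..<m} \<and> length is = card (inversions m \<sigma>) \<and> srefl_prod is = \<sigma>"
  using assms
proof (induction "card (inversions m \<sigma>)" arbitrary: \<sigma>)
  case 0
  have "perm_inv \<sigma> i < perm_inv \<sigma> (Suc i)" if "i \<in> {1..<m}" for i
    using descent_cases[OF "0.prems", of i] card_inversions_descent[OF "0.prems" that] 0 by auto
  then have "\<sigma> = id" by (rule no_descents_imp_id[OF "0.prems"])
  then show ?case using 0 by (intro exI[of _ "[]"]) simp
next
  case (Suc k)
  have "\<sigma> \<noteq> id" using Suc.hyps(2) by (auto simp: inversions_id)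
  then obtain i where i: "i \<in> {1..<m}" "perm_inv \<sigma> (Suc i) < perm_inv \<sigma> i"
    using no_descents_imp_id[OF Suc.prems] descent_cases[OF Suc.prems] by metis
  have "card (inversions m (srefl i \<circ> \<sigma>)) = k"
    using card_inversions_descent[OF Suc.prems i] Suc.hyps(2) by simp
  then obtain js where "set js \<subseteq> {1..<m}" "length js = k" "srefl_prod js = srefl i \<circ> \<sigma>"
    using Suc.hyps(1)[of "srefl i \<circ> \<sigma>"] srefl_comp_permutes(1)[OF Suc.prems i(1)] by auto
  then show ?case using i Suc.hyps(2) by (intro exI[of _ "i # js"]) auto
qed

lemma card_inversions_Suc_le:
  assumes "\<sigma> permutes {1..m}" "i \<in> {1..<m}"
  shows "card (inversions m (srefl i \<circ> \<sigma>)) \<le> Suc (card (inversions m \<sigma>))"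
  using descent_cases[OF assms(1), of i] card_inversions_ascent[OF assms]
    card_inversions_descent[OF assms] by fastforce

lemma card_inversions_le_length:
  "set is \<subseteq> {1..<m} \<Longrightarrow> card (inversions m (srefl_prod is)) \<le> length is"
proof (induction "is")
  case Nil
  show ?case unfolding srefl_prod_simps inversions_id by simp
next
  case (Cons i js)
  have "card (inversions m (srefl i \<circ> srefl_prod js)) \<le> Suc (card (inversions m (srefl_prod js)))"
    by (rule card_inversions_Suc_le[OF srefl_prod_permutes]) (use Cons.prems in auto)
  also have "\<dots> \<le> length (i # js)" using Cons by simp
  finally show ?case unfolding srefl_prod_simps .
qed

lemma len_eq_card_inversions:
  assumes "\<sigma> permutes {1..m}"
  shows "len m \<sigma> = card (inversions m \<sigma>)"
  unfolding len_def
proof (rule Least_equality)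
  fix k assume "\<exists>is. set is \<subseteq> {1..<m} \<and> length is = k \<and> srefl_prod is = \<sigma>"
  then obtain js where "set js \<subseteq> {1..<m}" "length js = k" "srefl_prod js = \<sigma>" by blast
  then show "card (inversions m \<sigma>) \<le> k" using card_inversions_le_length[of js m] by simp
qed (rule ex_reduced_word[OF assms])

lemma reduced_word:
  assumes "\<sigma> permutes {1..m}"
  shows "set (reduced_word m \<sigma>) \<subseteq> {1..<m}" "length (reduced_word m \<sigma>) = len m \<sigma>"
    "srefl_prod (reduced_word m \<sigma>) = \<sigma>"
  using someI_ex[OF ex_reduced_word[OF assms, folded len_eq_card_inversions[OF assms]]]
  unfolding reduced_word_def by auto

text \<open>Matsumoto's theorem concerns the braid monoid, so it is proved for any action of that
  monoid. The set A is there because \<open>hecke_op\<close> satisfies the braid relations on words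
  of a suitable length.\<close>

locale braid_action =
  fixes m :: nat and A :: "'v set" and t :: "nat \<Rightarrow> 'v \<Rightarrow> 'v"
  assumes t_closed: "\<And>i x. i \<in> {1..<m} \<Longrightarrow> x \<in> A \<Longrightarrow> t i x \<in> A"
    and t_braid: "\<And>i x. i \<in> {1..<m} \<Longrightarrow> Suc i \<in> {1..<m} \<Longrightarrow> x \<in> A \<Longrightarrow>
      t i (t (Suc i) (t i x)) = t (Suc i) (t i (t (Suc i) x))"
    and t_far: "\<And>i j x. i \<in> {1..<m} \<Longrightarrow> j \<in> {1..<m} \<Longrightarrow> Suc i < j \<Longrightarrow> x \<in> A \<Longrightarrow>
      t i (t j x) = t j (t i x)"
begin

lemma t_word_closed: "set is \<subseteq> {1..<m} \<Longrightarrow> x \<in> A \<Longrightarrow> word_op t is x \<in> A"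
  using word_op_closed[of "{1..<m}" A t] t_closed by blast

text \<open>
  Matsumoto's theorem. If two reduced words of \<open>\<sigma>\<close> start with different letters \<open>i\<close> and \<open>j\<close>, then
  \<open>\<sigma>\<close> also has a reduced word starting with the longest element of the parabolic subgroup
  generated by \<open>i\<close> and \<open>j\<close>.
\<close>

theorem word_op_reduced_unique:
  assumes "set is \<subseteq> {1..<m}" "set js \<subseteq> {1..<m}" "srefl_prod is = srefl_prod js"
    and "length is = card (inversions m (srefl_prod is))" "length js = length is" "x \<in> A"
  shows "word_op t is x = word_op t js x"
  using assms
proof (induction "length is" arbitrary: "is" js rule: less_induct)
  case less
  define R where "R \<sigma> u \<longleftrightarrow> set u \<subseteq> {1..<m} \<and> srefl_prod u = \<sigma> \<and> length u = card (inversions m \<sigma>)"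
    for \<sigma> u
  have IH: "word_op t u x = word_op t v x" if "R \<tau> u" "R \<tau> v" "length u < length is" for \<tau> u v
    using less.hyps[of u v] that less.prems(6) by (auto simp: R_def)
  define \<sigma> where "\<sigma> = srefl_prod is"
  have \<sigma>: "\<sigma> permutes {1..m}" unfolding \<sigma>_def by (rule srefl_prod_permutes[OF less.prems(1)])
  \<comment> \<open>The first letter of a reduced word is a descent: otherwise removing it would
    leave an element with more inversions than u has letters.\<close>
  have tail: "R (srefl i \<circ> \<sigma>) u" "i \<in> {1..<m}" "perm_inv \<sigma> (Suc i) < perm_inv \<sigma> i" if iu: "R \<sigma> (i # u)" for i u
  proof -
    show i: "i \<in> {1..<m}" using iu by (simp add: R_def)
    have u: "srefl_prod u = srefl i \<circ> \<sigma>" "set u \<subseteq> {1..<m}" using iu by (auto simp: R_def)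
    then have le: "card (inversions m (srefl i \<circ> \<sigma>)) \<le> length u"
      using card_inversions_le_length[of u m] by simp
    have k: "Suc (length u) = card (inversions m \<sigma>)" using iu by (simp add: R_def)
    show "perm_inv \<sigma> (Suc i) < perm_inv \<sigma> i"
      using descent_cases[OF \<sigma>, of i] card_inversions_ascent[OF \<sigma> i] le k by auto
    then show "R (srefl i \<circ> \<sigma>) u"
      using u card_inversions_descent[OF \<sigma> i] k by (simp add: R_def)
  qed
  \<comment> \<open>By symmetry i < j may be assumed, so that the braid case is exactly
    \<open>j = Suc i\<close>.\<close>
  have diff: "t i (word_op t u x) = t j (word_op t v x)"
    if "i < j" "R \<sigma> (i # u)" "R \<sigma> (j # v)" "length is = Suc (length u)" for i j u v
  proof -
    note iu = tail[OF that(2)] and jv = tail[OF that(3)]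
    note \<sigma>i = srefl_comp_permutes(1)[OF \<sigma> iu(2)]
    \<comment> \<open>Removing i keeps the descent at j. For j = i + 1 the value j now sits where i
      sat in \<sigma>, and the two given descents chain together to put i + 2 before it.\<close>
    have desc_j: "perm_inv (srefl i \<circ> \<sigma>) (Suc j) < perm_inv (srefl i \<circ> \<sigma>) j"
      using iu(3) jv(3) that(1) by (cases "j = Suc i") (auto simp: inv_transpose_comp[OF \<sigma>])
    note \<sigma>ij = srefl_comp_permutes(1)[OF \<sigma>i jv(2)]
    have lens: "length v = length u" using that(2,3) by (auto simp: R_def)
    have k: "length u = Suc (card (inversions m (srefl j \<circ> (srefl i \<circ> \<sigma>))))"
      using card_inversions_descent[OF \<sigma>i jv(2) desc_j] iu(1) by (simp add: R_def)
    show ?thesis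
    proof (cases "j = Suc i")
      case False
      then have far: "Suc i < j" using that(1) by simp
      obtain w where w: "R (srefl j \<circ> (srefl i \<circ> \<sigma>)) w"
        using ex_reduced_word[OF \<sigma>ij] by (auto simp: R_def)
      have eq: "srefl j \<circ> (srefl i \<circ> \<sigma>) = srefl i \<circ> (srefl j \<circ> \<sigma>)"
        using far by (auto simp: fun_eq_iff transpose_def)
      \<comment> \<open>By induction u may be replaced by \<open>j # w\<close> and v by
        \<open>i # w\<close>; the two full words then differ by one commutation.\<close>
      have "R (srefl i \<circ> \<sigma>) (j # w)" using w jv(2) k iu(1) by (auto simp: R_def)
      moreover have "srefl_prod (i # w) = srefl j \<circ> \<sigma>"
        using w by (simp only: R_def eq srefl_prod_simps transpose_comp_cancel)
      then have "R (srefl j \<circ> \<sigma>) (i # w)"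
        using w iu(2) k jv(1) lens by (auto simp: R_def simp del: srefl_prod_simps)
      ultimately have "word_op t u x = t j (word_op t w x)" "word_op t v x = t i (word_op t w x)"
        using IH[OF iu(1)] IH[OF jv(1)] that(4) lens by auto
      moreover have "word_op t w x \<in> A" using w t_word_closed less.prems(6) by (auto simp: R_def)
      ultimately show ?thesis using t_far iu(2) jv(2) far by simp
    next
      case True
      \<comment> \<open>Now i + 1 and i sit where i + 2 and i + 1 sat in \<sigma>, so the original
        descent at j has become one at i.\<close>
      have desc_i: "perm_inv (srefl j \<circ> (srefl i \<circ> \<sigma>)) (Suc i) < perm_inv (srefl j \<circ> (srefl i \<circ> \<sigma>)) i"
        using jv(3)
        unfolding inv_transpose_comp[OF \<sigma>i] inv_transpose_comp[OF \<sigma>] by (simp add: True)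
      note \<sigma>iji = srefl_comp_permutes(1)[OF \<sigma>ij iu(2)]
      have k': "length u = Suc (Suc (card (inversions m (srefl i \<circ> (srefl j \<circ> (srefl i \<circ> \<sigma>))))))"
        using card_inversions_descent[OF \<sigma>ij iu(2) desc_i] k by simp
      obtain w where w: "R (srefl i \<circ> (srefl j \<circ> (srefl i \<circ> \<sigma>))) w"
        using ex_reduced_word[OF \<sigma>iji] by (auto simp: R_def)
      have eq: "srefl i \<circ> (srefl j \<circ> (srefl i \<circ> \<sigma>)) = srefl j \<circ> (srefl i \<circ> (srefl j \<circ> \<sigma>))"
        unfolding True by (auto simp: fun_eq_iff transpose_def)
      \<comment> \<open>By induction u may be replaced by \<open>j # i # w\<close> and v by
        \<open>i # j # w\<close>; the two full words then differ by one braid relation.\<close>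
      have "R (srefl i \<circ> \<sigma>) (j # i # w)" using w iu(1,2) jv(2) k' by (auto simp: R_def)
      moreover have "srefl_prod (i # j # w) = srefl j \<circ> \<sigma>"
        using w by (simp only: R_def eq srefl_prod_simps transpose_comp_cancel)
      then have "R (srefl j \<circ> \<sigma>) (i # j # w)"
        using w iu(2) jv(1,2) k' lens by (auto simp: R_def simp del: srefl_prod_simps)
      ultimately have "word_op t u x = t j (t i (word_op t w x))"
          "word_op t v x = t i (t j (word_op t w x))"
        using IH[OF iu(1)] IH[OF jv(1)] that(4) lens by auto
      moreover have "word_op t w x \<in> A" using w t_word_closed less.prems(6) by (auto simp: R_def)
      ultimately show ?thesis using t_braid iu(2) jv(2) True by simp
    qed
  qed
  have R: "R \<sigma> is" "R \<sigma> js" using less.prems by (auto simp: R_def \<sigma>_def)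
  show ?case
  proof (cases "is")
    case Nil
    then show ?thesis using less.prems by simp
  next
    case (Cons i u)
    then obtain j v where js: "js = j # v" using less.prems(5) by (cases js) auto
    have lens: "length v = length u" using less.prems(5) Cons js by simp
    consider "i = j" | "i < j" | "j < i" by linarith
    then show ?thesis
    proof cases
      case 1
      then have iu: "R \<sigma> (i # u)" and iv: "R \<sigma> (i # v)" using R Cons js by auto
      show ?thesis using IH[OF tail(1)[OF iu] tail(1)[OF iv]] Cons js 1 by simp
    next
      case 2
      then show ?thesis using diff[of i j u v] R Cons js by auto
    next
      case 3
      then show ?thesis using diff[of j i v u] R Cons js lens by auto
    qed
  qed
qed

definition t_perm :: "(nat \<Rightarrow> nat) \<Rightarrow> 'v \<Rightarrow> 'v"
  where "t_perm \<sigma> = word_op t (reduced_word m \<sigma>)"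

text \<open>The form in which Matsumoto's theorem is used: whenever a simple reflection increases
  the length, attaching its letter to the chosen word of \<sigma> gives a reduced word of the
  product.\<close>

lemma t_perm_eqI:
  assumes "set is \<subseteq> {1..<m}" "length is = len m (srefl_prod is)" "x \<in> A"
  shows "t_perm (srefl_prod is) x = word_op t is x"
  unfolding t_perm_def
  using reduced_word[OF srefl_prod_permutes[OF assms(1)]] assms srefl_prod_permutes[OF assms(1)]
  by (intro word_op_reduced_unique) (simp_all add: len_eq_card_inversions)

lemma t_perm_closed: "\<sigma> permutes {1..m} \<Longrightarrow> x \<in> A \<Longrightarrow> t_perm \<sigma> x \<in> A"
  unfolding t_perm_def using t_word_closed reduced_word(1) by blast

lemma t_perm_srefl: "i \<in> {1..<m} \<Longrightarrow> x \<in> A \<Longrightarrow> t_perm (srefl i) x = t i x"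
proof -
  assume i: "i \<in> {1..<m}" and x: "x \<in> A"
  have "perm_inv id i < perm_inv id (Suc i)" by (simp add: inv_id)
  then have "len m (srefl i) = 1"
    using card_inversions_ascent[of id m i] i permutes_id[of "{1..m}"]
      len_eq_card_inversions[OF srefl_permutes[OF i]] by (simp add: inversions_id)
  then show "t_perm (srefl i) x = t i x"
    using t_perm_eqI[of "[i]" x] i x by simp
qed

lemma t_perm_left_up:
  assumes "\<sigma> permutes {1..m}" "i \<in> {1..<m}" "len m (srefl i \<circ> \<sigma>) = len m \<sigma> + 1" "x \<in> A"
  shows "t i (t_perm \<sigma> x) = t_perm (srefl i \<circ> \<sigma>) x"
  using t_perm_eqI[of "i # reduced_word m \<sigma>" x] reduced_word[OF assms(1)] assms
  by (simp add: t_perm_def)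

lemma t_perm_right_up:
  assumes "\<sigma> permutes {1..m}" "i \<in> {1..<m}" "len m (\<sigma> \<circ> srefl i) = len m \<sigma> + 1" "x \<in> A"
  shows "t_perm \<sigma> (t i x) = t_perm (\<sigma> \<circ> srefl i) x"
  using t_perm_eqI[of "reduced_word m \<sigma> @ [i]" x] reduced_word[OF assms(1)] assms
  by (simp add: t_perm_def srefl_prod_append word_op_append)

end

section \<open>Hecke operators\<close>

lemma q_nonzero [simp]: "q \<noteq> 0"
  by (simp add: q_def Zero_fract_def eq_fract)

lemma q_square_neq_1: "q * q \<noteq> 1"
  by (simp add: q_def One_fract_def eq_fract one_pCons)

lemma q_minus_inverse_nonzero [simp]: "q - inverse q \<noteq> 0"
proof
  assume "q - inverse q = 0"
  then have "q * q = q * inverse q" by simp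
  then show False using q_square_neq_1 by simp
qed

text \<open>The letters are unbounded on purpose: relations checked here hold for every n, and the
  spaces of the theorem are subspaces.\<close>

definition tens :: "nat \<Rightarrow> nat falg set"
  where "tens r = falg.span (wd ` {w. length w = r})"

lemma subspace_tens: "falg.subspace (tens r)"
  by (simp add: tens_def)

lemma wd_in_tens: "length w = r \<Longrightarrow> wd w \<in> tens r"
  unfolding tens_def by (rule falg.span_base) simp

lemma tens_eqI:
  "lin f \<Longrightarrow> lin g \<Longrightarrow> x \<in> tens r \<Longrightarrow> (\<And>w. length w = r \<Longrightarrow> f (wd w) = g (wd w)) \<Longrightarrow> f x = g x"
  unfolding tens_def by (erule (2) lin_eq_on_span) auto

lemma tens_closedI:
  "lin f \<Longrightarrow> falg.subspace W \<Longrightarrow> x \<in> tens r \<Longrightarrow> (\<And>w. length w = r \<Longrightarrow> f (wd w) \<in> W) \<Longrightarrow> f x \<in> W"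
  unfolding tens_def by (erule (2) lin_into_subspace) auto

abbreviation hecke_op :: "nat \<Rightarrow> nat falg \<Rightarrow> nat falg"
  where "hecke_op i \<equiv> lin_ext (hecke_basis i)"

lemma lin_hecke_op [simp]: "lin (hecke_op i)"
  by (rule lin_lin_ext)

text \<open>Splitting a word around the two letters acted on removes all list updates; the later
  Hecke computations on words use this form.\<close>

lemma hecke_basis_append:
  "hecke_basis (Suc (length xs)) (xs @ a # b # ys) =
    (if a < b then wd (xs @ b # a # ys)
     else if a > b then wd (xs @ b # a # ys) + scl (inverse q - q) (wd (xs @ a # b # ys))
     else scl (inverse q) (wd (xs @ a # b # ys)))"
  by (simp add: hecke_basis_def Let_def nth_append list_update_append)

lemma split_adjacent:
  assumes "i \<in> {1..<length w}"
  obtains xs a b ys where "w = xs @ a # b # ys" "i = Suc (length xs)"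
proof -
  have "i - 1 < length w" using assms by auto
  then have "w = take (i - 1) w @ w ! (i - 1) # w ! i # drop (Suc i) w"
    using assms id_take_nth_drop[of "i - 1" w] Cons_nth_drop_Suc[of i w] by simp
  moreover have "i = Suc (length (take (i - 1) w))" using assms by auto
  ultimately show ?thesis using that by blast
qed

lemma hecke_op_tens: "i \<in> {1..<r} \<Longrightarrow> x \<in> tens r \<Longrightarrow> hecke_op i x \<in> tens r"
proof (rule tens_closedI[OF lin_hecke_op subspace_tens])
  fix w :: "nat list" assume "i \<in> {1..<r}" "length w = r"
  then obtain xs a b ys where "w = xs @ a # b # ys" "i = Suc (length xs)" "length w = r"
    using split_adjacent[of i w] by metis
  then show "hecke_op i (wd w) \<in> tens r"
    by (auto simp: hecke_basis_append intro!: wd_in_tens falg.subspace_add falg.subspace_scale subspace_tens)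
qed

text \<open>The quadratic relation (T + q)(T - q^-1) = 0 multiplied out and solved for the
  square.\<close>

lemma hecke_op_square:
  assumes i: "i \<in> {1..<r}" and x: "x \<in> tens r"
  shows "hecke_op i (hecke_op i x) = x + scl (inverse q - q) (hecke_op i x)"
proof (rule tens_eqI[OF _ _ x, of "\<lambda>x. hecke_op i (hecke_op i x)"])
  fix w :: "nat list" assume "length w = r"
  then obtain xs a b ys where w: "w = xs @ a # b # ys" "i = Suc (length xs)"
    using split_adjacent[of i w] i by metis
  \<comment> \<open>Comparing coefficients turns an identity of vectors into identities in the
    ground field, which \<open>field_simps\<close> settles. The same device recurs below.\<close>
  show "hecke_op i (hecke_op i (wd w)) = wd w + scl (inverse q - q) (hecke_op i (wd w))"
    by (rule poly_mapping_eqI)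
       (simp add: w hecke_basis_append lin_simps lookup_add lookup_scl field_simps)
qed (auto intro!: lin_compose[OF lin_hecke_op] lin_add lin_id lin_scl)

lemma hecke_op_braid:
  assumes i: "i \<in> {1..<r}" "Suc i \<in> {1..<r}" and x: "x \<in> tens r"
  shows "hecke_op i (hecke_op (Suc i) (hecke_op i x)) =
    hecke_op (Suc i) (hecke_op i (hecke_op (Suc i) x))"
proof (rule tens_eqI[OF _ _ x, of "\<lambda>x. hecke_op i (hecke_op (Suc i) (hecke_op i x))"])
  fix w :: "nat list" assume len: "length w = r"
  then obtain xs a b ys where w: "w = xs @ a # b # ys" "i = Suc (length xs)"
    using split_adjacent[of i w] i by metis
  obtain c zs where ys: "ys = c # zs" using w len i(2) by (cases ys) auto
  \<comment> \<open>The next operator sees the same word with its first letter a absorbed into the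
    prefix.\<close>
  have snd: "hecke_basis (Suc (Suc (length xs))) (xs @ a # b # ys) =
      (if b < hd ys then wd (xs @ a # hd ys # b # tl ys)
       else if b > hd ys then wd (xs @ a # hd ys # b # tl ys) + scl (inverse q - q) (wd (xs @ a # b # ys))
       else scl (inverse q) (wd (xs @ a # b # ys)))" if "ys \<noteq> []" for a b ys
    using that hecke_basis_append[of "xs @ [a]" b "hd ys" "tl ys"] by simp
  \<comment> \<open>The three comparisons together enumerate the order types of (a, b, c);
    inconsistent combinations are refuted along the way.\<close>
  consider "a < b" | "a = b" | "b < a" by linarith
  note ab = this
  consider "b < c" | "b = c" | "c < b" by linarith
  note bc = this
  consider "a < c" | "a = c" | "c < a" by linarith
  note ac = this
  show "hecke_op i (hecke_op (Suc i) (hecke_op i (wd w))) =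
      hecke_op (Suc i) (hecke_op i (hecke_op (Suc i) (wd w)))"
    by (rule poly_mapping_eqI, rule ab; rule bc; rule ac)
       (simp_all add: w ys hecke_basis_append snd lin_simps lookup_add lookup_scl field_simps)
qed (auto intro!: lin_compose[OF lin_hecke_op] lin_hecke_op)

lemma hecke_op_far:
  assumes ij: "i \<in> {1..<r}" "j \<in> {1..<r}" "Suc i < j" and x: "x \<in> tens r"
  shows "hecke_op i (hecke_op j x) = hecke_op j (hecke_op i x)"
proof (rule tens_eqI[OF _ _ x, of "\<lambda>x. hecke_op i (hecke_op j x)"])
  fix w :: "nat list" assume len: "length w = r"
  then obtain us c d zs where w: "w = us @ c # d # zs" "j = Suc (length us)"
    using split_adjacent[of j w] ij by metis
  then obtain xs a b ys where us: "us = xs @ a # b # ys" "i = Suc (length xs)"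
    using split_adjacent[of i us] ij by (metis atLeastLessThan_iff Suc_less_SucD)
  have ww: "w = xs @ a # b # ys @ c # d # zs" and j: "j = Suc (Suc (Suc (length xs + length ys)))"
    using w us by auto
  have snd: "hecke_basis (Suc (Suc (Suc (length xs + length ys)))) (xs @ a # b # ys @ c # d # zs) =
      (if c < d then wd (xs @ a # b # ys @ d # c # zs)
       else if c > d then wd (xs @ a # b # ys @ d # c # zs) +
         scl (inverse q - q) (wd (xs @ a # b # ys @ c # d # zs))
       else scl (inverse q) (wd (xs @ a # b # ys @ c # d # zs)))" for a b c d
    using hecke_basis_append[of "xs @ a # b # ys" c d zs] by simp
  show "hecke_op i (hecke_op j (wd w)) = hecke_op j (hecke_op i (wd w))"
    by (rule poly_mapping_eqI)
       (simp add: ww us(2) j hecke_basis_append snd lin_simps lookup_add lookup_scl lookup_minus algebra_simps)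
qed (auto intro!: lin_compose[OF lin_hecke_op] lin_hecke_op)

text \<open>Used with m = l: then T_\<sigma> for \<sigma> in the symmetric group on l letters acts
  on the whole r-th power through the first l factors.\<close>

lemma braid_action_hecke: "m \<le> r \<Longrightarrow> braid_action m (tens r) hecke_op"
  by unfold_locales
     ((rule hecke_op_tens hecke_op_braid[where r = r] hecke_op_far[where r = r]; simp)+)

lemma hecke_op_Cons:
  assumes "k \<in> {1..<r}" "x \<in> tens r"
  shows "hecke_op (Suc k) (wd [j] * x) = wd [j] * hecke_op k x"
proof (rule tens_eqI[OF _ _ assms(2), of "\<lambda>x. hecke_op (Suc k) (wd [j] * x)"])
  fix w :: "nat list" assume "length w = r"
  then obtain xs a b ys where w: "w = xs @ a # b # ys" "k = Suc (length xs)"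
    using split_adjacent[of k w] assms(1) by metis
  show "hecke_op (Suc k) (wd [j] * wd w) = wd [j] * hecke_op k (wd w)"
    using hecke_basis_append[of "j # xs" a b ys]
    by (simp add: w hecke_basis_append wd_mult distrib_left mult_scl_right)
qed (auto intro!: lin_compose[OF lin_mult_right] lin_compose[OF lin_hecke_op] lin_hecke_op lin_mult_right)

text \<open>Needed to recognise T_\<sigma> \<otimes> id, as it occurs in \<open>psi\<close>, as
  T_\<sigma> acting on the longer word.\<close>

lemma hecke_op_append:
  assumes "i \<in> {1..<l}" "x \<in> tens l"
  shows "hecke_op i (x * wd v) = hecke_op i x * wd v"
proof (rule tens_eqI[OF _ _ assms(2), of "\<lambda>x. hecke_op i (x * wd v)"])
  fix w :: "nat list" assume "length w = l"
  then obtain xs a b ys where w: "w = xs @ a # b # ys" "i = Suc (length xs)"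
    using split_adjacent[of i w] assms(1) by metis
  show "hecke_op i (wd w * wd v) = hecke_op i (wd w) * wd v"
    by (simp add: w hecke_basis_append wd_mult distrib_right mult_scl_left)
qed (auto intro!: lin_compose[OF lin_mult_left] lin_compose[OF lin_hecke_op] lin_hecke_op lin_mult_left)

section \<open>The action of the quantum group\<close>

lemma lin_nat_op: "lin (nat_op g)"
  unfolding nat_op_def by (rule lin_lin_ext)

lemma nat_op_wd [simp]: "nat_op g (wd [j]) = nat_basis g j"
  by (simp add: nat_op_def)

lemma lin_uq_op: "lin (uq_op r g)"
proof (cases r)
  case 0
  then show ?thesis by (cases g) (simp_all add: lin_zero lin_id)
next
  case (Suc r')
  then show ?thesis by (cases g) (simp_all add: lin_add lin_tensor_op)
qed

lemma lin_uq_op_comp: "lin f \<Longrightarrow> lin (\<lambda>x. uq_op r g (f x))"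
  by (rule lin_compose[OF _ lin_uq_op])

lemma lin_diff: "lin f \<Longrightarrow> lin g \<Longrightarrow> lin (\<lambda>x. f x - g x)"
  by (auto intro!: linI simp: lin_simps falg.scale_right_diff_distrib)

lemma lin_if: "lin f \<Longrightarrow> lin g \<Longrightarrow> lin (\<lambda>x. if b then f x else g x)"
  by (cases b) simp_all

lemma lin_comp: "lin f \<Longrightarrow> lin g \<Longrightarrow> lin (f \<circ> g)"
  unfolding o_def by (rule lin_compose)

lemma lin_hecke_op_comp: "lin f \<Longrightarrow> lin (\<lambda>x. hecke_op i (f x))"
  by (rule lin_compose[OF _ lin_hecke_op])

lemmas lin_intros = lin_id lin_zero lin_add lin_diff lin_scl lin_if lin_uq_op_comp lin_hecke_op_comp
  lin_uq_op lin_hecke_op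

lemmas uq_lin = lin_simps[OF lin_uq_op] mult_scl_right mult_scl_left distrib_left right_diff_distrib

lemma tensor_op_Cons:
  assumes "lin B"
  shows "tensor_op (Suc 0) A B (wd [j] * x) = A (wd [j]) * B x"
proof (rule lin_eqI[of "\<lambda>x. tensor_op (Suc 0) A B (wd [j] * x)"])
  show "tensor_op (Suc 0) A B (wd [j] * wd w) = A (wd [j]) * B (wd w)" for w
    by (simp add: tensor_op_def wd_mult)
qed (auto intro: lin_compose[OF lin_mult_right] lin_compose[OF assms] lin_tensor_op lin_mult_right)

text \<open>The eigenvalue of H_a on the j-th basis vector of the natural module.\<close>

definition wt :: "nat \<Rightarrow> nat \<Rightarrow> rat_q"
  where "wt a j = (if j = a then q else 1)"

lemma wt_nonzero [simp]: "wt a j \<noteq> 0"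
  by (simp add: wt_def)

text \<open>The comultiplication made explicit for one split letter. For E_i the factor K_i^-1
  remains an operator on the other letters; for F_i the factor K_i falls on the split letter and is
  already a scalar.\<close>

lemma uq_op_Cons:
  "uq_op (Suc r) (H a) (wd [j] * x) = scl (wt a j) (wd [j] * uq_op r (H a) x)"
  "uq_op (Suc r) (Hinv a) (wd [j] * x) = scl (inverse (wt a j)) (wd [j] * uq_op r (Hinv a) x)"
  "uq_op (Suc r) (E i) (wd [j] * x) = wd [j] * uq_op r (E i) x +
    (if j = Suc i then wd [i] * uq_op r (H (Suc i)) (uq_op r (Hinv i) x) else 0)"
  "uq_op (Suc r) (F i) (wd [j] * x) = (if j = i then wd [Suc i] * x else 0) +
    scl (wt i j / wt (Suc i) j) (wd [j] * uq_op r (F i) x)"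
  by (simp_all add: tensor_op_Cons lin_uq_op lin_comp lin_id K_word_def Kinv_word_def wt_def
      lin_simps[OF lin_nat_op] mult_scl_left field_simps)

declare uq_op.simps(2) [simp del]

lemma uq_op_diagonal:
  "length w = r \<Longrightarrow> uq_op r (H a) (wd w) = scl (prod_list (map (wt a) w)) (wd w)"
  "length w = r \<Longrightarrow> uq_op r (Hinv a) (wd w) = scl (inverse (prod_list (map (wt a) w))) (wd w)"
proof (induction w arbitrary: r)
  case (Cons j w)
  { case 1
    then show ?case using Cons.IH(1)[of "r - 1"] by (cases r) (auto simp: wd_Cons[of j w] uq_op_Cons uq_lin)
  next
    case 2
    then show ?case using Cons.IH(2)[of "r - 1"] by (cases r) (auto simp: wd_Cons[of j w] uq_op_Cons uq_lin) }
qed auto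

lemma weight_nonzero [simp]: "prod_list (map (wt a) w) \<noteq> 0"
  by (induction w) auto

text \<open>The relation \<open>P\<close> records which letters may be turned into which by \<open>g\<close>.\<close>

lemma uq_op_pattern:
  assumes refl: "\<And>j. P j j" and E: "\<And>i. g = E i \<Longrightarrow> P (Suc i) i" and F: "\<And>i. g = F i \<Longrightarrow> P i (Suc i)"
    and "length w = r"
  shows "uq_op r g (wd w) \<in> falg.span (wd ` {w'. list_all2 P w w'})"
  using assms(4)
proof (induction w arbitrary: r)
  case Nil
  have "wd [] \<in> falg.span (wd ` {w'. list_all2 P [] w'})" by (rule falg.span_base) simp
  then show ?case using Nil by (cases g) (auto simp: falg.span_zero)
next
  case (Cons j w)
  then obtain r' where r: "r = Suc r'" "length w = r'" by auto
  have cons: "wd [k] * x \<in> falg.span (wd ` {w'. list_all2 P (j # w) w'})"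
    if "P j k" "x \<in> falg.span (wd ` {w'. list_all2 P w w'})" for j k x
    by (rule lin_into_subspace[OF lin_mult_right _ that(2)])
       (use that(1) in \<open>auto simp: wd_mult intro!: falg.span_base\<close>)
  have IH: "uq_op r' g (wd w) \<in> falg.span (wd ` {w'. list_all2 P w w'})" by (rule Cons.IH[OF r(2)])
  have self: "wd w \<in> falg.span (wd ` {w'. list_all2 P w w'})"
    by (rule falg.span_base) (auto intro: list_all2_refl refl)
  have "uq_op r g (wd [j] * wd w) \<in> falg.span (wd ` {w'. list_all2 P (j # w) w'})"
    using IH self r E F refl
    by (cases g) (auto simp: uq_op_Cons uq_lin uq_op_diagonal
      intro!: falg.span_add falg.span_scale cons)
  then show ?case by (simp add: wd_mult)
qed

lemma uq_op_tens:
  assumes "x \<in> tens r"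
  shows "uq_op r g x \<in> tens r"
proof (rule tens_closedI[OF lin_uq_op subspace_tens assms])
  fix w :: "nat list" assume w: "length w = r"
  have "{w'. list_all2 (\<lambda>_ _. True) w w'} \<subseteq> {w'. length w' = r}"
    using w by (auto dest: list_all2_lengthD)
  then show "uq_op r g (wd w) \<in> tens r"
    using uq_op_pattern[of "\<lambda>_ _. True" g w r] w falg.span_mono[of "wd ` {w'. list_all2 (\<lambda>_ _. True) w w'}"]
    unfolding tens_def by blast
qed

lemma tens_Suc_eqI:
  assumes "lin f" "lin g" "y \<in> tens (Suc r)"
    and "\<And>j x. x \<in> tens r \<Longrightarrow> f (wd [j] * x) = g (wd [j] * x)"
  shows "f y = g y"
proof (rule tens_eqI[OF assms(1-3)])
  fix w :: "nat list" assume "length w = Suc r"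
  then obtain j v where "w = j # v" "length v = r" by (cases w) auto
  then show "f (wd w) = g (wd w)"
    using assms(4)[of "wd v" j] wd_in_tens by (simp add: wd_mult)
qed

lemma tens_0_eqI: "lin f \<Longrightarrow> lin g \<Longrightarrow> y \<in> tens 0 \<Longrightarrow> f (wd []) = g (wd []) \<Longrightarrow> f y = g y"
  by (rule tens_eqI[of f g y 0]) auto

section \<open>The defining relations of the quantum group on tensor powers\<close>

lemma uq_H_rels:
  assumes x: "x \<in> tens r"
  shows "uq_op r (H a) (uq_op r (Hinv a) x) = x" "uq_op r (Hinv a) (uq_op r (H a) x) = x"
    "uq_op r (H a) (uq_op r (H b) x) = uq_op r (H b) (uq_op r (H a) x)"
    "uq_op r (Hinv a) (uq_op r (Hinv b) x) = uq_op r (Hinv b) (uq_op r (Hinv a) x)"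
    "uq_op r (Hinv a) (uq_op r (H b) x) = uq_op r (H b) (uq_op r (Hinv a) x)"
  by (rule tens_eqI[OF _ _ x]; (intro lin_intros)?; simp add: uq_op_diagonal uq_lin mult.commute)+

text \<open>E_i turns one letter i + 1 into i, which changes the H_a-weight by this quotient. It is
  q for a = i, q^-1 for a = i + 1 and 1 otherwise, so three relations are treated together.\<close>

lemma uq_H_E:
  assumes "x \<in> tens r"
  shows "uq_op r (H a) (uq_op r (E i) x) = scl (wt a i / wt a (Suc i)) (uq_op r (E i) (uq_op r (H a) x))"
  using assms
proof (induction r arbitrary: x)
  case 0
  show ?case by (rule tens_0_eqI[OF _ _ 0]; (intro lin_intros)?; simp)
next
  case (Suc r)
  show ?case
  proof (rule tens_Suc_eqI[OF _ _ Suc.prems]; (intro lin_intros)?)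
    fix j x assume x: "x \<in> tens r"
    note [simp] = x Suc.IH uq_H_rels(1,2,5)[where r = r] uq_op_tens
    show "uq_op (Suc r) (H a) (uq_op (Suc r) (E i) (wd [j] * x)) =
        scl (wt a i / wt a (Suc i)) (uq_op (Suc r) (E i) (uq_op (Suc r) (H a) (wd [j] * x)))"
      by (simp add: uq_op_Cons uq_lin falg.scale_right_distrib uq_H_rels(3)[of _ r a "Suc i"])
  qed
qed

lemma uq_H_F:
  assumes "x \<in> tens r"
  shows "uq_op r (H a) (uq_op r (F i) x) = scl (wt a (Suc i) / wt a i) (uq_op r (F i) (uq_op r (H a) x))"
  using assms
proof (induction r arbitrary: x)
  case 0
  show ?case by (rule tens_0_eqI[OF _ _ 0]; (intro lin_intros)?; simp)
next
  case (Suc r)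
  show ?case
  proof (rule tens_Suc_eqI[OF _ _ Suc.prems]; (intro lin_intros)?)
    fix j x assume x: "x \<in> tens r"
    note [simp] = x Suc.IH uq_op_tens
    show "uq_op (Suc r) (H a) (uq_op (Suc r) (F i) (wd [j] * x)) =
        scl (wt a (Suc i) / wt a i) (uq_op (Suc r) (F i) (uq_op (Suc r) (H a) (wd [j] * x)))"
      by (simp add: uq_op_Cons uq_lin falg.scale_right_distrib mult.commute)
  qed
qed

lemma uq_Hinv_E:
  assumes x: "x \<in> tens r"
  shows "uq_op r (Hinv a) (uq_op r (E i) x) = scl (wt a (Suc i) / wt a i) (uq_op r (E i) (uq_op r (Hinv a) x))"
proof -
  have "uq_op r (E i) x = uq_op r (E i) (uq_op r (H a) (uq_op r (Hinv a) x))"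
    by (simp add: uq_H_rels(1) x)
  also have "\<dots> = scl (wt a (Suc i) / wt a i) (uq_op r (H a) (uq_op r (E i) (uq_op r (Hinv a) x)))"
    by (simp add: uq_H_E uq_op_tens x)
  finally show ?thesis by (simp add: uq_lin uq_H_rels(2) uq_op_tens x)
qed

lemma uq_Hinv_F:
  assumes x: "x \<in> tens r"
  shows "uq_op r (Hinv a) (uq_op r (F i) x) = scl (wt a i / wt a (Suc i)) (uq_op r (F i) (uq_op r (Hinv a) x))"
proof -
  have "uq_op r (F i) x = uq_op r (F i) (uq_op r (H a) (uq_op r (Hinv a) x))"
    by (simp add: uq_H_rels(1) x)
  also have "\<dots> = scl (wt a i / wt a (Suc i)) (uq_op r (H a) (uq_op r (F i) (uq_op r (Hinv a) x)))"
    by (simp add: uq_H_F uq_op_tens x)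
  finally show ?thesis by (simp add: uq_lin uq_H_rels(2) uq_op_tens x)
qed

text \<open>As rewrite rules these move every H and Hinv inward past E and F. What remains is to
  reorder E and F, which is the task of the induction hypotheses.\<close>

lemmas uq_normalize = uq_op_Cons uq_lin uq_H_E uq_H_F uq_Hinv_E uq_Hinv_F uq_op_tens

lemma uq_E_F:
  assumes "x \<in> tens r"
  shows "uq_op r (E i) (uq_op r (F k) x) = uq_op r (F k) (uq_op r (E i) x) +
    (if i = k then scl (inverse (q - inverse q))
      (uq_op r (H i) (uq_op r (Hinv (Suc i)) x) - uq_op r (H (Suc i)) (uq_op r (Hinv i) x)) else 0)"
  using assms
proof (induction r arbitrary: x)
  case 0
  show ?case by (rule tens_0_eqI[OF _ _ 0]; (intro lin_intros)?; simp)
next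
  case (Suc r)
  show ?case
  proof (rule tens_Suc_eqI[OF _ _ Suc.prems]; (intro lin_intros)?)
    fix j x assume x: "x \<in> tens r"
    let ?c = "inverse (q - inverse q)"
    \<comment> \<open>On the split letter the commutator of E_i and F_i has coefficients without
      denominator, while the K-terms carry \<open>?c * q\<close> and \<open>?c * inverse q\<close>.
      The rules \<open>c'\<close> bring both to one normal form.\<close>
    have "?c * (q - inverse q) = 1" by (rule left_inverse[OF q_minus_inverse_nonzero])
    then have c: "?c * q - ?c * inverse q = 1" by (simp only: right_diff_distrib)
    have c': "?c * (q * L) = L + ?c * (inverse q * L)" "q * (?c * L) = L + ?c * (inverse q * L)"
      "inverse q * (?c * L) = ?c * (inverse q * L)" for L
      using arg_cong[OF c, of "\<lambda>t. t * L"] by (simp_all add: algebra_simps)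
    note defs = x uq_normalize wt_def lookup_add lookup_scl lookup_minus divide_inverse
    show "uq_op (Suc r) (E i) (uq_op (Suc r) (F k) (wd [j] * x)) =
        uq_op (Suc r) (F k) (uq_op (Suc r) (E i) (wd [j] * x)) +
        (if i = k then scl ?c
          (uq_op (Suc r) (H i) (uq_op (Suc r) (Hinv (Suc i)) (wd [j] * x)) -
           uq_op (Suc r) (H (Suc i)) (uq_op (Suc r) (Hinv i) (wd [j] * x))) else 0)"
    proof (cases "i = k")
      case True
      note IH = Suc.IH[OF x, folded True]
      consider "j = i" | "j = Suc i" | "j \<noteq> i" "j \<noteq> Suc i" by blast
      then show ?thesis unfolding True[symmetric]
        by cases (rule poly_mapping_eqI, simp add: defs IH c')+
    next
      case False
      then have IH: "uq_op r (E i) (uq_op r (F k) x) = uq_op r (F k) (uq_op r (E i) x)"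
        using Suc.IH[OF x] by simp
      show ?thesis using False IH
        by (cases "j = i"; cases "j = Suc i"; cases "j = k"; cases "j = Suc k") (auto simp: defs falg.scale_right_distrib)
    qed
  qed
qed

lemma uq_E_E_far:
  assumes "x \<in> tens r" "Suc i < k"
  shows "uq_op r (E i) (uq_op r (E k) x) = uq_op r (E k) (uq_op r (E i) x)"
  using assms(1)
proof (induction r arbitrary: x)
  case 0
  show ?case by (rule tens_0_eqI[OF _ _ 0]; (intro lin_intros)?; simp)
next
  case (Suc r)
  show ?case
  proof (rule tens_Suc_eqI[OF _ _ Suc.prems]; (intro lin_intros)?)
    fix j x assume x: "x \<in> tens r"
    show "uq_op (Suc r) (E i) (uq_op (Suc r) (E k) (wd [j] * x)) =
        uq_op (Suc r) (E k) (uq_op (Suc r) (E i) (wd [j] * x))"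
      using assms(2) by (simp add: x Suc.IH uq_normalize wt_def)
  qed
qed

lemma uq_F_F_far:
  assumes "x \<in> tens r" "Suc i < k"
  shows "uq_op r (F i) (uq_op r (F k) x) = uq_op r (F k) (uq_op r (F i) x)"
  using assms(1)
proof (induction r arbitrary: x)
  case 0
  show ?case by (rule tens_0_eqI[OF _ _ 0]; (intro lin_intros)?; simp)
next
  case (Suc r)
  show ?case
  proof (rule tens_Suc_eqI[OF _ _ Suc.prems]; (intro lin_intros)?)
    fix j x assume x: "x \<in> tens r"
    show "uq_op (Suc r) (F i) (uq_op (Suc r) (F k) (wd [j] * x)) =
        uq_op (Suc r) (F k) (uq_op (Suc r) (F i) (wd [j] * x))"
      using assms(2) by (simp add: x Suc.IH uq_normalize wt_def)
  qed
qed

text \<open>The Serre relation is solved for the product with E_k innermost, so that the induction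
  hypothesis is a rewrite rule.\<close>

lemma uq_Serre_E:
  assumes "x \<in> tens r" "k = Suc i \<or> i = Suc k"
  shows "uq_op r (E i) (uq_op r (E i) (uq_op r (E k) x)) =
    scl (q + inverse q) (uq_op r (E i) (uq_op r (E k) (uq_op r (E i) x))) -
    uq_op r (E k) (uq_op r (E i) (uq_op r (E i) x))"
  using assms(1)
proof (induction r arbitrary: x)
  case 0
  show ?case by (rule tens_0_eqI[OF _ _ 0]; (intro lin_intros)?; simp)
next
  case (Suc r)
  show ?case
  proof (rule tens_Suc_eqI[OF _ _ Suc.prems]; (intro lin_intros)?)
    fix j x assume x: "x \<in> tens r"
    \<comment> \<open>Powers of q produced by the weights have to cancel in front of an opaque
      coefficient L.\<close>
    have q: "inverse q * (q * L) = L" "q * (inverse q * L) = L" for L by (simp_all add: field_simps)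
    from assms(2) show "uq_op (Suc r) (E i) (uq_op (Suc r) (E i) (uq_op (Suc r) (E k) (wd [j] * x))) =
      scl (q + inverse q) (uq_op (Suc r) (E i) (uq_op (Suc r) (E k) (uq_op (Suc r) (E i) (wd [j] * x)))) -
      uq_op (Suc r) (E k) (uq_op (Suc r) (E i) (uq_op (Suc r) (E i) (wd [j] * x)))"
    proof
      assume k: "k = Suc i"
      \<comment> \<open>These are the split letters that E_i or E_k can change; on any other letter
        the relation is the induction hypothesis.\<close>
      consider "j = Suc i" | "j = Suc k" | "j \<noteq> Suc i" "j \<noteq> Suc k" by blast
      then show ?thesis unfolding k
        by cases (rule poly_mapping_eqI, (simp add: x Suc.IH[unfolded k] uq_normalize wt_def lookup_add
          lookup_scl lookup_minus divide_inverse; simp add: algebra_simps q))+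
    next
      assume k: "i = Suc k"
      consider "j = Suc i" | "j = Suc k" | "j \<noteq> Suc i" "j \<noteq> Suc k" by blast
      then show ?thesis unfolding k
        by cases (rule poly_mapping_eqI, (simp add: x Suc.IH[unfolded k] uq_normalize wt_def lookup_add
          lookup_scl lookup_minus divide_inverse; simp add: algebra_simps q))+
    qed
  qed
qed

lemma uq_Serre_F:
  assumes "x \<in> tens r" "k = Suc i \<or> i = Suc k"
  shows "uq_op r (F i) (uq_op r (F i) (uq_op r (F k) x)) =
    scl (q + inverse q) (uq_op r (F i) (uq_op r (F k) (uq_op r (F i) x))) -
    uq_op r (F k) (uq_op r (F i) (uq_op r (F i) x))"
  using assms(1)
proof (induction r arbitrary: x)
  case 0
  show ?case by (rule tens_0_eqI[OF _ _ 0]; (intro lin_intros)?; simp)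
next
  case (Suc r)
  show ?case
  proof (rule tens_Suc_eqI[OF _ _ Suc.prems]; (intro lin_intros)?)
    fix j x assume x: "x \<in> tens r"
    have q: "inverse q * (q * L) = L" "q * (inverse q * L) = L" for L by (simp_all add: field_simps)
    from assms(2) show "uq_op (Suc r) (F i) (uq_op (Suc r) (F i) (uq_op (Suc r) (F k) (wd [j] * x))) =
      scl (q + inverse q) (uq_op (Suc r) (F i) (uq_op (Suc r) (F k) (uq_op (Suc r) (F i) (wd [j] * x)))) -
      uq_op (Suc r) (F k) (uq_op (Suc r) (F i) (uq_op (Suc r) (F i) (wd [j] * x)))"
    proof
      assume k: "k = Suc i"
      \<comment> \<open>For F the letters that can change are i and k themselves, and K_i
        contributes further powers of q there.\<close>
      consider "j = i" | "j = k" | "j \<noteq> i" "j \<noteq> k" by blast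
      then show ?thesis unfolding k
        by cases (rule poly_mapping_eqI, (simp add: x Suc.IH[unfolded k] uq_normalize wt_def lookup_add
          lookup_scl lookup_minus divide_inverse; simp add: algebra_simps q))+
    next
      assume k: "i = Suc k"
      consider "j = i" | "j = k" | "j \<noteq> i" "j \<noteq> k" by blast
      then show ?thesis unfolding k
        by cases (rule poly_mapping_eqI, (simp add: x Suc.IH[unfolded k] uq_normalize wt_def lookup_add
          lookup_scl lookup_minus divide_inverse; simp add: algebra_simps q))+
    qed
  qed
qed

section \<open>Commutation of the quantum group with the Hecke operators\<close>

lemma hecke_op_1:
  "hecke_op (Suc 0) (wd [a] * (wd [b] * x)) =
    (if a < b then wd [b] * (wd [a] * x)
     else if a > b then wd [b] * (wd [a] * x) + scl (inverse q - q) (wd [a] * (wd [b] * x))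
     else scl (inverse q) (wd [a] * (wd [b] * x)))"
proof (rule lin_eqI[of "\<lambda>x. hecke_op (Suc 0) (wd [a] * (wd [b] * x))"])
  show "hecke_op (Suc 0) (wd [a] * (wd [b] * wd w)) =
    (if a < b then wd [b] * (wd [a] * wd w)
     else if a > b then wd [b] * (wd [a] * wd w) + scl (inverse q - q) (wd [a] * (wd [b] * wd w))
     else scl (inverse q) (wd [a] * (wd [b] * wd w)))" for w
    using hecke_basis_append[of "[]" a b w] by (simp add: wd_mult)
qed (intro lin_intros lin_compose[OF lin_mult_right lin_mult_right])+

text \<open>For k > 1 the first letter is a spectator of T_k and the induction hypothesis applies to
  the others. Only k = 1 is a genuine computation, with two letters split off.\<close>

theorem uq_op_hecke_op_commute:
  assumes "x \<in> tens r" "k \<in> {1..<r}"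
  shows "uq_op r g (hecke_op k x) = hecke_op k (uq_op r g x)"
  using assms
\<comment> \<open>The generator is generalised because the comultiplication of E_i puts H and Hinv
  on the remaining factors.\<close>
proof (induction r arbitrary: g k x)
  case 0
  then show ?case by simp
next
  case (Suc r)
  show ?case
  proof (rule tens_Suc_eqI[OF _ _ Suc.prems(1)]; (intro lin_intros)?)
    fix j x assume x: "x \<in> tens r"
    show "uq_op (Suc r) g (hecke_op k (wd [j] * x)) = hecke_op k (uq_op (Suc r) g (wd [j] * x))"
    proof (cases "k = 1")
      case True
      \<comment> \<open>T_1 involves the split letter, so a second letter is split off; the rest y
        is then touched by the quantum group alone.\<close>
      then obtain r' where r: "r = Suc r'" using Suc.prems(2) by (cases r) auto
      note simps = hecke_op_1 uq_normalize lin_simps[OF lin_hecke_op] wt_def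
        lookup_add lookup_scl lookup_minus
      have "uq_op (Suc r) g (hecke_op 1 (wd [j] * x)) = hecke_op 1 (uq_op (Suc r) g (wd [j] * x))"
      proof (rule tens_Suc_eqI[of "\<lambda>x. uq_op (Suc r) g (hecke_op 1 (wd [j] * x))", OF _ _ x[unfolded r]])
        fix a y assume y: "y \<in> tens r'"
        consider "a < j" | "a = j" | "j < a" by linarith
        note aj = this
        show "uq_op (Suc r) g (hecke_op 1 (wd [j] * (wd [a] * y))) =
            hecke_op 1 (uq_op (Suc r) g (wd [j] * (wd [a] * y)))"
        proof (cases g)
          case (E i)
          then show ?thesis
            by (intro poly_mapping_eqI, cases rule: aj; cases "a = i"; cases "a = Suc i"; cases "j = i"; cases "j = Suc i")
               (simp_all add: r y simps field_simps)
        next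
          case (F i)
          then show ?thesis
            by (intro poly_mapping_eqI, cases rule: aj; cases "a = i"; cases "a = Suc i"; cases "j = i"; cases "j = Suc i")
               (simp_all add: r y simps field_simps)
        next
          case (H i)
          then show ?thesis
            by (intro poly_mapping_eqI, cases rule: aj)
               (simp_all add: r y simps field_simps)
        next
          case (Hinv i)
          then show ?thesis
            by (intro poly_mapping_eqI, cases rule: aj)
               (simp_all add: r y simps field_simps)
        qed
      qed (intro lin_intros lin_mult_right)+
      with True show ?thesis by simp
    next
      case False
      then obtain k' where k: "k = Suc k'" "k' \<in> {1..<r}" using Suc.prems(2) by (cases k) auto
      show ?thesis
        by (cases g) (simp_all add: k(1) hecke_op_Cons[OF k(2)] x uq_normalize Suc.IH[OF _ k(2)]
            lin_simps[OF lin_hecke_op])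
    qed
  qed
qed

section \<open>The projections and the operators of the duplex Hecke algebra\<close>

context braid_action
begin

lemma t_perm_commute:
  assumes "\<sigma> permutes {1..m}" "x \<in> A"
    and "\<And>i x. i \<in> {1..<m} \<Longrightarrow> x \<in> A \<Longrightarrow> f (t i x) = t i (f x)"
  shows "f (t_perm \<sigma> x) = t_perm \<sigma> (f x)"
proof -
  have "f (word_op t u x) = word_op t u (f x)" if "set u \<subseteq> {1..<m}" for u
    using that
  proof (induction u)
    case (Cons i u)
    then show ?case using t_word_closed[of u x] assms(2,3) by simp
  qed simp
  then show ?thesis using reduced_word(1)[OF assms(1)] by (simp add: t_perm_def)
qed

end

lemma lin_word_hecke: "lin (word_op hecke_op u)"
  by (rule lin_word_op) simp

text \<open>Here \<open>srefl i \<circ> \<sigma>\<close> is the shorter element, so T_\<sigma> = T_i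
  T_{s_i \<sigma>} by the ascending rule, and T_i T_\<sigma> is rewritten by the formula for the
  square of T_i.\<close>

lemma hecke_perm_left_down:
  assumes "l \<le> r" "\<sigma> permutes {1..l}" "i \<in> {1..<l}" "len l (srefl i \<circ> \<sigma>) + 1 = len l \<sigma>" "x \<in> tens r"
  shows "hecke_op i (braid_action.t_perm l hecke_op \<sigma> x) =
    braid_action.t_perm l hecke_op (srefl i \<circ> \<sigma>) x + scl (inverse q - q) (braid_action.t_perm l hecke_op \<sigma> x)"
proof -
  interpret braid_action l "tens r" hecke_op by (rule braid_action_hecke[OF assms(1)])
  note \<sigma>' = srefl_comp_permutes(1)[OF assms(2,3)]
  have up: "hecke_op i (t_perm (srefl i \<circ> \<sigma>) x) = t_perm \<sigma> x"
    using t_perm_left_up[OF \<sigma>' assms(3) _ assms(5)] assms(4) by (simp only: transpose_comp_cancel)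
  show ?thesis
    using hecke_op_square[of i r, OF _ t_perm_closed[OF \<sigma>' assms(5)]] assms(1,3) by (simp only: up) auto
qed

lemma hecke_perm_right_down:
  assumes "l \<le> r" "\<sigma> permutes {1..l}" "i \<in> {1..<l}" "len l (\<sigma> \<circ> srefl i) + 1 = len l \<sigma>" "x \<in> tens r"
  shows "braid_action.t_perm l hecke_op \<sigma> (hecke_op i x) =
    braid_action.t_perm l hecke_op (\<sigma> \<circ> srefl i) x + scl (inverse q - q) (braid_action.t_perm l hecke_op \<sigma> x)"
proof -
  interpret braid_action l "tens r" hecke_op by (rule braid_action_hecke[OF assms(1)])
  note \<sigma>' = srefl_comp_permutes(2)[OF assms(2,3)]
  \<comment> \<open>For all y, because it is applied both to x and to
    \<open>hecke_op i x\<close>.\<close>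
  have up: "t_perm \<sigma> y = t_perm (\<sigma> \<circ> srefl i) (hecke_op i y)" if "y \<in> tens r" for y
    using t_perm_right_up[OF \<sigma>' assms(3) _ that] assms(4) by (simp only: transpose_comp_cancel)
  have i: "i \<in> {1..<r}" using assms(1,3) by auto
  have "lin (t_perm (\<sigma> \<circ> srefl i))" unfolding t_perm_def by (rule lin_word_hecke)
  then show ?thesis
    using up[OF t_closed[OF assms(3,5)]] up[OF assms(5)] hecke_op_square[OF i assms(5)]
    by (simp only: lin_simps)
qed

text \<open>Trades positions, counted from 1, for conditions on a prefix and a suffix, which fit the
  splitting of words.\<close>

lemma V_words_iff:
  assumes "l \<le> r"
  shows "w \<in> V_words n r {1..l} \<longleftrightarrow>
    length w = r \<and> set (take l w) \<subseteq> {1..n} \<and> set (drop l w) \<subseteq> {n + 1}"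
proof (cases "length w = r")
  case True
  have "w \<in> V_words n r {1..l} \<longleftrightarrow> (\<forall>k<r. if k < l then w ! k \<in> {1..n} else w ! k = n + 1)"
  proof -
    have "{1..r} = Suc ` {..<r}" by (simp add: image_Suc_lessThan)
    then have "w \<in> V_words n r {1..l} \<longleftrightarrow>
      (\<forall>k\<in>Suc ` {..<r}. if k \<in> {1..l} then w ! (k - 1) \<in> {1..n} else w ! (k - 1) = n + 1)"
      using True by (simp add: V_words_def)
    then show ?thesis by (auto simp: Suc_le_eq)
  qed
  also have "\<dots> \<longleftrightarrow> (\<forall>k<l. w ! k \<in> {1..n}) \<and> (\<forall>k<r - l. w ! (l + k) = n + 1)"
  proof (intro iffI conjI allI impI)
    fix k assume H: "(\<forall>k<l. w ! k \<in> {1..n}) \<and> (\<forall>k<r - l. w ! (l + k) = n + 1)" and "k < r"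
    then show "if k < l then w ! k \<in> {1..n} else w ! k = n + 1"
    proof (cases "k < l")
      case False
      then have "w ! (l + (k - l)) = n + 1"
        using H[THEN conjunct2, rule_format, of "k - l"] \<open>k < r\<close> by linarith
      then show ?thesis using False by simp
    qed (use H in simp)
  next
    fix k assume "\<forall>k<r. if k < l then w ! k \<in> {1..n} else w ! k = n + 1" "k < l"
    then show "w ! k \<in> {1..n}" using assms by (meson order_less_le_trans)
  next
    fix k assume "\<forall>k<r. if k < l then w ! k \<in> {1..n} else w ! k = n + 1" "k < r - l"
    then show "w ! (l + k) = n + 1" by (metis add.commute less_diff_conv not_add_less1)
  qed
  also have "\<dots> \<longleftrightarrow> set (take l w) \<subseteq> {1..n} \<and> set (drop l w) \<subseteq> {n + 1}"
    using assms True by (auto simp: set_conv_nth subset_eq)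
  finally show ?thesis using True by simp
qed (simp add: V_words_def)

text \<open>If l < k, position l + 1 would have to carry n + 1 and also a letter at most n.\<close>

lemma V_words_unique:
  assumes "w \<in> V_words n r {1..l}" "w \<in> V_words n r {1..k}" "l \<le> r" "k \<le> r"
  shows "l = k"
proof -
  have "\<not> l < k" if w: "w \<in> V_words n r {1..l}" "w \<in> V_words n r {1..k}" "k \<le> r" for l k
  proof
    assume "l < k"
    then have l: "Suc l \<in> {1..r}" "Suc l \<in> {1..k}" "Suc l \<notin> {1..l}" using w(3) by auto
    have "if Suc l \<in> {1..l} then w ! (Suc l - 1) \<in> {1..n} else w ! (Suc l - 1) = n + 1"
      "if Suc l \<in> {1..k} then w ! (Suc l - 1) \<in> {1..n} else w ! (Suc l - 1) = n + 1"
      using w(1,2) l(1) unfolding V_words_def by blast+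
    then show False using l(2,3) by simp
  qed
  from this[of l k] this[of k l] show ?thesis using assms by force
qed

text \<open>This is \<open>\<pi>\<^sub>l\<close>.\<close>

definition V_proj :: "nat \<Rightarrow> nat \<Rightarrow> nat \<Rightarrow> nat falg \<Rightarrow> nat falg"
  where "V_proj n r l = lin_ext (\<lambda>w. if w \<in> V_words n r {1..l} then wd w else 0)"

lemma lin_V_proj: "lin (V_proj n r l)"
  unfolding V_proj_def by (rule lin_lin_ext)

lemma V_proj_wd [simp]: "V_proj n r l (wd w) = (if w \<in> V_words n r {1..l} then wd w else 0)"
  by (simp add: V_proj_def)

lemma V_proj_span:
  assumes "x \<in> falg.span (wd ` S)"
  shows "V_proj n r l x \<in> falg.span (wd ` S)"
  by (rule lin_into_subspace[OF lin_V_proj _ assms]) (auto intro: falg.span_base falg.span_zero)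

lemma V_proj_tens: "x \<in> tens r \<Longrightarrow> V_proj n r l x \<in> tens r"
  unfolding tens_def by (rule V_proj_span)

lemma V_proj_idem: "V_proj n r l (V_proj n r l x) = V_proj n r l x"
  by (rule lin_eqI[of "\<lambda>x. V_proj n r l (V_proj n r l x)"])
     (auto intro: lin_compose[OF lin_V_proj] lin_V_proj simp: lin_simps[OF lin_V_proj])

lemma V_proj_orthogonal: "l \<noteq> k \<Longrightarrow> l \<le> r \<Longrightarrow> k \<le> r \<Longrightarrow> V_proj n r l (V_proj n r k x) = 0"
  by (rule lin_eqI[of "\<lambda>x. V_proj n r l (V_proj n r k x)"])
     (auto intro: lin_compose[OF lin_V_proj] lin_V_proj lin_zero simp: lin_simps[OF lin_V_proj]
       dest: V_words_unique[unfolded One_nat_def])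

text \<open>The two letters are on the same side of the boundary after position l; the excluded case
  is the one where they straddle it.\<close>

lemma V_words_swap:
  assumes "l \<le> r" "Suc (length xs) \<noteq> l"
  shows "xs @ b # a # ys \<in> V_words n r {1..l} \<longleftrightarrow> xs @ a # b # ys \<in> V_words n r {1..l}"
proof (cases "l \<le> length xs")
  case True
  then show ?thesis using assms(1) by (auto simp: V_words_iff[unfolded One_nat_def])
next
  case False
  \<comment> \<open>Both letters lie in the prefix; the two successors let \<open>take\<close> and
    \<open>drop\<close> run past them.\<close>
  then have "l - length xs = Suc (Suc (l - length xs - 2))" using assms(2) by linarith
  then show ?thesis using False assms(1) by (auto simp: V_words_iff[unfolded One_nat_def])
qed

lemma V_proj_hecke_op:
  assumes "l \<le> r" "i \<in> {1..<r}" "i \<noteq> l" "x \<in> tens r"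
  shows "V_proj n r l (hecke_op i x) = hecke_op i (V_proj n r l x)"
proof (rule tens_eqI[OF _ _ assms(4), of "\<lambda>x. V_proj n r l (hecke_op i x)"])
  fix w :: "nat list" assume "length w = r"
  then obtain xs a b ys where w: "w = xs @ a # b # ys" "i = Suc (length xs)"
    using split_adjacent[of i w] assms(2) by metis
  show "V_proj n r l (hecke_op i (wd w)) = hecke_op i (V_proj n r l (wd w))"
    using V_words_swap[OF assms(1), of xs b a ys] assms(3)
    by (simp add: w hecke_basis_append lin_simps[OF lin_V_proj] lin_simps[OF lin_hecke_op])
qed (auto intro: lin_compose[OF lin_V_proj] lin_compose[OF lin_hecke_op] lin_V_proj lin_hecke_op)

text \<open>Beyond position l every letter is n + 1, and on equal neighbours the Hecke operator is
  the scalar q^-1.\<close>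

lemma hecke_op_V_proj:
  assumes "l < i" "i \<in> {1..<r}" "x \<in> tens r"
  shows "hecke_op i (V_proj n r l x) = scl (inverse q) (V_proj n r l x)"
proof (rule tens_eqI[OF _ _ assms(3), of "\<lambda>x. hecke_op i (V_proj n r l x)"])
  fix w :: "nat list" assume "length w = r"
  then obtain xs a b ys where w: "w = xs @ a # b # ys" "i = Suc (length xs)"
    using split_adjacent[of i w] assms(2) by metis
  have "a = b" if "w \<in> V_words n r {1..l}"
    using that assms(1,2) by (auto simp: V_words_iff[unfolded One_nat_def] w)
  then show "hecke_op i (V_proj n r l (wd w)) = scl (inverse q) (V_proj n r l (wd w))"
    by (cases "a = b") (auto simp: w hecke_basis_append lin_simps[OF lin_hecke_op])
qed (auto intro: lin_compose[OF lin_V_proj] lin_scl lin_V_proj lin_hecke_op)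

text \<open>\<open>psi\<close> before its restriction to a level, so that one operator serves on all
  levels and on the whole tensor power.\<close>

definition x_op :: "nat \<Rightarrow> nat \<Rightarrow> nat \<Rightarrow> (nat \<Rightarrow> nat) \<Rightarrow> nat falg \<Rightarrow> nat falg"
  where "x_op n r l \<sigma> = lin_ext (\<lambda>w. if w \<in> V_words n r {1..l}
    then tensor_op l (Psi n l (T_perm l \<sigma>)) id (wd w) else 0)"

definition duplex_op :: "nat \<Rightarrow> nat \<Rightarrow> hecke_gen \<Rightarrow> nat falg \<Rightarrow> nat falg"
  where "duplex_op n r g = (case g of T i \<Rightarrow> hecke_op i | X l \<sigma> \<Rightarrow> x_op n r l \<sigma>)"

lemma duplex_op_simps [simp]:
  "duplex_op n r (T i) = hecke_op i" "duplex_op n r (X l \<sigma>) = x_op n r l \<sigma>"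
  by (simp_all add: duplex_op_def)

lemma lin_x_op: "lin (x_op n r l \<sigma>)"
  unfolding x_op_def by (rule lin_lin_ext)

lemma lin_duplex_op: "lin (duplex_op n r g)"
  by (cases g) (simp_all add: lin_x_op)

lemma psi_eq: "psi n r l \<sigma> = restrict (x_op n r l \<sigma>) (V_level n r l)"
  by (simp add: psi_def x_op_def)

lemma tensor_power_eq: "tensor_power m r = falg.span (wd ` {w. length w = r \<and> set w \<subseteq> {1..m}})"
  unfolding tensor_power_def by (rule arg_cong[of _ _ falg.span]) auto

lemma tensor_power_subset_tens: "tensor_power m r \<subseteq> tens r"
  unfolding tensor_power_eq tens_def by (rule falg.span_mono) auto

text \<open>T_i sends a word to a combination of itself and its swap, so a swap-closed set of words
  spans a stable subspace. Both \<open>tensor_power\<close> and the levels are of this kind.\<close>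

lemma hecke_op_span:
  assumes "i \<in> {1..<r}" "S \<subseteq> {w. length w = r}" "x \<in> falg.span (wd ` S)"
    and "\<And>xs a b ys. xs @ a # b # ys \<in> S \<Longrightarrow> xs @ b # a # ys \<in> S"
  shows "hecke_op i x \<in> falg.span (wd ` S)"
proof (rule lin_into_subspace[OF lin_hecke_op falg.subspace_span assms(3)])
  fix w assume w: "w \<in> S"
  then obtain xs a b ys where "w = xs @ a # b # ys" "i = Suc (length xs)"
    using split_adjacent[of i w] assms(1,2) by blast
  then show "hecke_op i (wd w) \<in> falg.span (wd ` S)"
    using w assms(4)[of xs a b ys]
    by (auto simp: hecke_basis_append intro!: falg.span_add falg.span_scale intro: falg.span_base)
qed

section \<open>The Hecke algebra representation \<open>Psi\<close> and the relations of the
  generators x\<close>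

lemma presentation_hecke: "presentation (hecke_pres m)"
proof
  show "snd (hecke_pres m) \<subseteq> carrier (free_alg (fst (hecke_pres m)))"
  proof
    fix u assume "u \<in> snd (hecke_pres m)"
    then have "u \<in> hecke_rels m" by (simp add: hecke_pres_def)
    then show "u \<in> carrier (free_alg (fst (hecke_pres m)))"
      by cases (auto simp: hecke_pres_def intro!: free_alg_closed)
  qed
qed

lemma hecke_rels_act:
  assumes "u \<in> hecke_rels r" "x \<in> tens r"
  shows "act (duplex_op n r') u x = 0"
  using assms(1)
proof cases
  case (quadratic i)
  have "act (duplex_op n r') u x = hecke_op i (hecke_op i x) - (x + scl (inverse q - q) (hecke_op i x))"
    by (simp add: quadratic(1) act_mult lin_duplex_op lin_simps[OF lin_hecke_op] falg.scale_right_diff_distrib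
        falg.scale_left_diff_distrib)
  then show ?thesis using hecke_op_square[OF quadratic(2) assms(2)] by simp
next
  case (braid i)
  then show ?thesis using hecke_op_braid[OF _ _ assms(2), of i] by simp
next
  case (far i j)
  then have "Suc i < j \<or> Suc j < i" by linarith
  then show ?thesis
    using far hecke_op_far[of i r j x] hecke_op_far[of j r i x] assms(2) by auto
qed

text \<open>\<open>duplex_op\<close> serves here as a total extension of the operators T_i to the
  letters \<open>X\<close>, hence the free parameters n and r'.\<close>

lemma representation_hecke:
  "representation (hecke_pres r) (tensor_power m r) (duplex_op n r')
    (\<lambda>g. case g of T i \<Rightarrow> restrict (hecke_op i) (tensor_power m r) | X _ _ \<Rightarrow> undefined)"
proof (intro representation.intro representation_axioms.intro presentation_hecke lin_duplex_op)
  show "falg.subspace (tensor_power m r)" by (simp add: tensor_power_def)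
  show "duplex_op n r' g v \<in> tensor_power m r" if gv: "g \<in> fst (hecke_pres r)" "v \<in> tensor_power m r" for g v
  proof -
    obtain i where i: "g = T i" "i \<in> {1..<r}" using gv(1) unfolding hecke_pres_def fst_conv by blast
    show ?thesis unfolding tensor_power_eq i duplex_op_simps
      by (rule hecke_op_span[OF i(2) _ gv(2)[unfolded tensor_power_eq]]) auto
  qed
  show "act (duplex_op n r') u v = 0" if "u \<in> snd (hecke_pres r)" "v \<in> tensor_power m r" for u v
    using that hecke_rels_act[of u r v] tensor_power_subset_tens[of m r] by (auto simp: hecke_pres_def)
qed (auto simp: hecke_pres_def)

lemma Psi_cls:
  assumes "set u \<subseteq> {1..<r}"
  shows "Psi m r (cls (hecke_pres r) (wd (map T u))) = restrict (word_op hecke_op u) (tensor_power m r)"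
proof -
  interpret representation "hecke_pres r" "tensor_power m r" "duplex_op 0 0"
    "\<lambda>g. case g of T i \<Rightarrow> restrict (hecke_op i) (tensor_power m r) | X _ _ \<Rightarrow> undefined"
    by (rule representation_hecke)
  have gens: "set (map T u) \<subseteq> fst (hecke_pres r)"
    unfolding hecke_pres_def fst_conv set_map by (rule image_mono[OF assms])
  have "word_op (duplex_op 0 0) (map T u) = word_op hecke_op u" by (induction u) auto
  then have "act (duplex_op 0 0) (wd (map T u)) = word_op hecke_op u" by (simp add: fun_eq_iff)
  then show ?thesis
    unfolding Psi_def induced_hom_cls_eq[OF free_alg_closed(8)[OF gens]] by simp
qed

text \<open>The letters of a reduced word of \<sigma> are below l, so they act within the prefix of
  length l, and T_\<sigma> \<otimes> id becomes T_\<sigma> on the full word.\<close>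

lemma x_op_eq:
  assumes "l \<le> r" "\<sigma> permutes {1..l}"
  shows "x_op n r l \<sigma> x = word_op hecke_op (reduced_word l \<sigma>) (V_proj n r l x)"
proof (rule lin_eqI[of "x_op n r l \<sigma>"])
  let ?u = "reduced_word l \<sigma>"
  have u: "set ?u \<subseteq> {1..<l}" by (rule reduced_word(1)[OF assms(2)])
  have append: "word_op hecke_op v (y * wd z) = word_op hecke_op v y * wd z"
    if "set v \<subseteq> {1..<l}" "y \<in> tens l" for v y z
    using that(1)
  proof (induction v)
    case (Cons i v)
    then show ?case
      using hecke_op_append[of i l "word_op hecke_op v y" z] that(2)
        braid_action.t_word_closed[OF braid_action_hecke[of l l], of v y] by simp
  qed simp
  show "x_op n r l \<sigma> (wd w) = word_op hecke_op ?u (V_proj n r l (wd w))" for w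
  proof (cases "w \<in> V_words n r {1..l}")
    case True
    then have w: "length w = r" "set (take l w) \<subseteq> {1..n}" using V_words_iff[OF assms(1)] by auto
    \<comment> \<open>\<open>Psi n l\<close> is extensional: its values are known only on
      \<open>tensor_power n l\<close>, which is where the letters at most n are used.\<close>
    then have tp: "wd (take l w) \<in> tensor_power n l"
      unfolding tensor_power_def using assms(1) by (intro falg.span_base) auto
    have "x_op n r l \<sigma> (wd w) = word_op hecke_op ?u (wd (take l w)) * wd (drop l w)"
      using True tp by (simp add: x_op_def tensor_op_def T_perm_def Psi_cls[OF u])
    also have "\<dots> = word_op hecke_op ?u (wd (take l w) * wd (drop l w))"
      using append[OF u, of "wd (take l w)"] tp tensor_power_subset_tens[of n l] by auto
    finally show ?thesis using True by (simp add: wd_mult)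
  qed (simp add: x_op_def lin_simps[OF lin_word_hecke])
qed (auto intro: lin_x_op lin_compose[OF lin_V_proj lin_word_hecke])

text \<open>The x-operators inherit stability from the T_i, since \<open>V_proj\<close> merely
  discards words.\<close>

lemma duplex_op_span:
  assumes g: "g \<in> fst (duplex_pres r)" and S: "S \<subseteq> {w. length w = r}"
    and swap: "\<And>xs a b ys. xs @ a # b # ys \<in> S \<Longrightarrow> xs @ b # a # ys \<in> S"
    and x: "x \<in> falg.span (wd ` S)"
  shows "duplex_op n r g x \<in> falg.span (wd ` S)"
proof -
  have hecke: "hecke_op i y \<in> falg.span (wd ` S)" if "i \<in> {1..<r}" "y \<in> falg.span (wd ` S)" for i y
    by (rule hecke_op_span[OF that(1) S that(2) swap])
  consider (T) i where "g = T i" "i \<in> {1..<r}"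
    | (X) l \<sigma> where "g = X l \<sigma>" "l \<in> {1..r}" "\<sigma> permutes {1..l}"
    using g unfolding duplex_pres_def fst_conv by blast
  then show ?thesis
  proof cases
    case T
    then show ?thesis using hecke x by simp
  next
    case X
    have l: "l \<le> r" using X(2) by simp
    have "word_op hecke_op (reduced_word l \<sigma>) (V_proj n r l x) \<in> falg.span (wd ` S)"
      by (rule word_op_closed[of "{1..<r}", OF hecke])
         (use reduced_word(1)[OF X(3)] l V_proj_span[OF x] in auto)
    then show ?thesis by (simp add: X(1) x_op_eq[OF l X(3)])
  qed
qed

text \<open>The operator of x_\<sigma> lies in the corner cut out by \<pi>_l on both sides, because
  T_\<sigma> is a product of T_i with i < l and these commute with \<pi>_l.\<close>

lemma x_op_rels:
  assumes l: "l \<in> {1..r}" and \<sigma>: "\<sigma> permutes {1..l}" and x: "x \<in> tens r"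
  shows V_proj_x_op: "V_proj n r l (x_op n r l \<sigma> x) = x_op n r l \<sigma> x"
    and x_op_V_proj: "x_op n r l \<sigma> (V_proj n r l x) = x_op n r l \<sigma> x"
    and x_op_tens: "x_op n r l \<sigma> x \<in> tens r"
proof -
  have lr: "l \<le> r" using l by simp
  interpret braid_action l "tens r" hecke_op by (rule braid_action_hecke[OF lr])
  have x_op: "x_op n r l \<sigma> y = t_perm \<sigma> (V_proj n r l y)" for y
    by (simp add: x_op_eq[OF lr \<sigma>] t_perm_def)
  show "V_proj n r l (x_op n r l \<sigma> x) = x_op n r l \<sigma> x"
    unfolding x_op
    by (subst t_perm_commute[OF \<sigma> V_proj_tens[OF x]])
       (use lr in \<open>auto simp: V_proj_hecke_op V_proj_idem\<close>)
  show "x_op n r l \<sigma> (V_proj n r l x) = x_op n r l \<sigma> x"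
    by (simp add: x_op V_proj_idem)
  show "x_op n r l \<sigma> x \<in> tens r"
    unfolding x_op by (rule t_perm_closed[OF \<sigma> V_proj_tens[OF x]])
qed

text \<open>This is why the relations treat x_{s_i} and T_i alike: they differ by \<pi>_l, which a
  neighbouring x_\<sigma> absorbs.\<close>

lemma x_op_srefl:
  assumes "l \<in> {1..r}" "i \<in> {1..<l}" "x \<in> tens r"
  shows "x_op n r l (srefl i) x = hecke_op i (V_proj n r l x)"
proof -
  have lr: "l \<le> r" using assms(1) by simp
  interpret braid_action l "tens r" hecke_op by (rule braid_action_hecke[OF lr])
  show ?thesis
    unfolding x_op_eq[OF lr srefl_permutes[OF assms(2)]]
    using t_perm_srefl[OF assms(2) V_proj_tens[OF assms(3)]] unfolding t_perm_def .
qed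

lemma x_rels_act:
  assumes l: "l \<in> {1..r}" and u: "u \<in> x_rels l r" and x: "x \<in> tens r"
  shows "act (duplex_op n r) u x = 0"
proof -
  have lr: "l \<le> r" using l by simp
  interpret braid_action l "tens r" hecke_op by (rule braid_action_hecke[OF lr])
  have x_op: "x_op n r l \<sigma> y = t_perm \<sigma> (V_proj n r l y)" if "\<sigma> permutes {1..l}" for \<sigma> y
    by (simp add: x_op_eq[OF lr that] t_perm_def)
  let ?p = "V_proj n r l"
  have px: "?p x \<in> tens r" by (rule V_proj_tens[OF x])
  \<comment> \<open>For either choice of g the product acts as T_\<sigma> T_i after \<pi>_l. With
    \<open>left\<close>, the four length relations become facts about T_\<sigma> at the vector
    \<open>?p x\<close>.\<close>
  have right: "x_op n r l \<sigma> (duplex_op n r g x) = t_perm \<sigma> (hecke_op i (?p x))"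
    if "\<sigma> permutes {1..l}" "i \<in> {1..<l}" "g \<in> {X l (srefl i), T i}" for \<sigma> i g
  proof -
    have i: "i \<in> {1..<r}" "i \<noteq> l" using that(2) lr by auto
    have "?p (duplex_op n r g x) = hecke_op i (?p x)"
      using that(3) x_op_srefl[OF l that(2) x, of n] V_proj_hecke_op[OF lr i x, of n]
        V_proj_hecke_op[OF lr i px, of n] by (auto simp: V_proj_idem)
    then show ?thesis by (simp add: x_op[OF that(1)])
  qed
  have left: "duplex_op n r g (x_op n r l \<sigma> x) = hecke_op i (t_perm \<sigma> (?p x))"
    if "\<sigma> permutes {1..l}" "i \<in> {1..<l}" "g \<in> {X l (srefl i), T i}" for \<sigma> i g
    using that(3) x_op_srefl[OF l that(2) x_op_tens[OF l that(1) x], of n n]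
      V_proj_x_op[OF l that(1) x, of n] by (auto simp: x_op[OF that(1)])
  from u show ?thesis
  proof cases
    case (right_up \<sigma> i g)
    then show ?thesis
      using t_perm_right_up[OF right_up(2,3,5) px] right[OF right_up(2-4)]
        x_op[OF srefl_comp_permutes(2)[OF right_up(2,3)]] by simp
  next
    case (right_down \<sigma> i g)
    then show ?thesis
      using hecke_perm_right_down[OF lr right_down(2,3,5) px] right[OF right_down(2-4)]
        x_op[OF srefl_comp_permutes(2)[OF right_down(2,3)]] x_op[OF right_down(2)] by simp
  next
    case (left_up \<sigma> i g)
    then show ?thesis
      using t_perm_left_up[OF left_up(2,3,5) px] left[OF left_up(2-4)]
        x_op[OF srefl_comp_permutes(1)[OF left_up(2,3)]] by simp
  next
    case (left_down \<sigma> i g)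
    then show ?thesis
      using hecke_perm_left_down[OF lr left_down(2,3,5) px] left[OF left_down(2-4)]
        x_op[OF srefl_comp_permutes(1)[OF left_down(2,3)]] x_op[OF left_down(2)] by simp
  next
    case (T_x \<sigma> i)
    then show ?thesis
      using hecke_op_V_proj[OF T_x(3,4) x_op_tens[OF l T_x(2) x, of n], of n]
        V_proj_x_op[OF l T_x(2) x, of n] by simp
  next
    case (x_T \<sigma> i)
    have "t_perm \<sigma> (scl c y) = scl c (t_perm \<sigma> y)" for c y
      unfolding t_perm_def by (rule lin_simps(2)[OF lin_word_hecke])
    then show ?thesis
      using x_T V_proj_hecke_op[OF lr x_T(4) _ x, of n] hecke_op_V_proj[OF x_T(3,4) x, of n]
      by (simp add: x_op)
  qed
qed

lemma duplex_rels_act: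
  assumes "u \<in> snd (duplex_pres r)" "x \<in> tens r"
  shows "act (duplex_op n r) u x = 0"
proof -
  have "act (duplex_op n r) (wd [X l \<sigma>, X k \<gamma>]) x = 0"
    if "l \<in> {1..r}" "k \<in> {1..r}" "k \<noteq> l" "\<sigma> permutes {1..l}" "\<gamma> permutes {1..k}" for l k \<sigma> \<gamma>
  proof -
    have lk: "l \<le> r" "k \<le> r" using that by auto
    have "V_proj n r l (x_op n r k \<gamma> x) = V_proj n r l (V_proj n r k (x_op n r k \<gamma> x))"
      by (simp only: V_proj_x_op[OF that(2,5) assms(2)])
    also have "\<dots> = 0" using that(3) lk by (simp add: V_proj_orthogonal)
    finally have "x_op n r l \<sigma> (x_op n r k \<gamma> x) = 0"
      by (simp add: x_op_eq[OF lk(1) that(4)] lin_simps[OF lin_word_hecke])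
    then show ?thesis by simp
  qed
  then show ?thesis
    using assms hecke_rels_act[of u r x] x_rels_act[of _ r u x] unfolding duplex_pres_def snd_conv by blast
qed

section \<open>The presentations and their inclusions\<close>

lemma hecke_rels_closed:
  assumes "u \<in> hecke_rels r" "T ` {1..<r} \<subseteq> G"
  shows "u \<in> carrier (free_alg G)"
proof -
  have T: "T i \<in> G" if "i \<in> {1..<r}" for i using that assms(2) by blast
  show ?thesis using assms(1)
    by cases (auto intro!: free_alg_closed T)
qed

lemma x_rels_closed:
  assumes "u \<in> x_rels l r" "l \<le> r" "T ` {1..<r} \<subseteq> G" "\<And>\<sigma>. \<sigma> permutes {1..l} \<Longrightarrow> X l \<sigma> \<in> G"
  shows "u \<in> carrier (free_alg G)"
proof -
  have T: "T i \<in> G" if "i \<in> {1..<r}" for i using that assms(3) by blast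
  have g: "g \<in> G" if "i \<in> {1..<l}" "g \<in> {X l (srefl i), T i}" for g i
    using that T[of i] assms(2) assms(4)[OF srefl_permutes[OF that(1)]] by auto
  note X = assms(4) and sX = assms(4)[OF srefl_comp_permutes(1)] assms(4)[OF srefl_comp_permutes(2)]
  note intros = free_alg_closed(1,2,5,8)
  show ?thesis using assms(1)
  proof cases
    case (right_up \<sigma> i g')
    show ?thesis unfolding right_up(1)
      by (intro intros) (simp_all only: list.set insert_subset empty_subsetI g[OF right_up(3,4)] X[OF right_up(2)] sX[OF right_up(2,3)] simp_thms)
  next
    case (right_down \<sigma> i g')
    show ?thesis unfolding right_down(1)
      by (intro intros) (simp_all only: list.set insert_subset empty_subsetI g[OF right_down(3,4)] X[OF right_down(2)] sX[OF right_down(2,3)] simp_thms)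
  next
    case (left_up \<sigma> i g')
    show ?thesis unfolding left_up(1)
      by (intro intros) (simp_all only: list.set insert_subset empty_subsetI g[OF left_up(3,4)] X[OF left_up(2)] sX[OF left_up(2,3)] simp_thms)
  next
    case (left_down \<sigma> i g')
    show ?thesis unfolding left_down(1)
      by (intro intros) (simp_all only: list.set insert_subset empty_subsetI g[OF left_down(3,4)] X[OF left_down(2)] sX[OF left_down(2,3)] simp_thms)
  next
    case (T_x \<sigma> i)
    show ?thesis unfolding T_x(1)
      by (intro intros) (simp_all only: list.set insert_subset empty_subsetI T[OF T_x(4)] X[OF T_x(2)] simp_thms)
  next
    case (x_T \<sigma> i)
    show ?thesis unfolding x_T(1)
      by (intro intros) (simp_all only: list.set insert_subset empty_subsetI T[OF x_T(4)] X[OF x_T(2)] simp_thms)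
  qed
qed

lemma presentation_duplex: "presentation (duplex_pres r)"
proof
  let ?G = "fst (duplex_pres r)"
  have T: "T ` {1..<r} \<subseteq> ?G" and X: "\<And>l \<sigma>. l \<in> {1..r} \<Longrightarrow> \<sigma> permutes {1..l} \<Longrightarrow> X l \<sigma> \<in> ?G"
    unfolding duplex_pres_def fst_conv by blast+
  have "wd [X l \<sigma>, X k \<gamma>] \<in> carrier (free_alg ?G)"
    if "l \<in> {1..r}" "k \<in> {1..r}" "\<sigma> permutes {1..l}" "\<gamma> permutes {1..k}" for l k \<sigma> \<gamma>
    using X[OF that(1,3)] X[OF that(2,4)] by (intro free_alg_closed(8)) simp
  moreover have "u \<in> carrier (free_alg ?G)" if "u \<in> x_rels l r" "l \<in> {1..r}" for u l
    by (rule x_rels_closed[OF that(1) _ T X]) (use that(2) in auto)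
  ultimately show "snd (duplex_pres r) \<subseteq> carrier (free_alg ?G)"
    using hecke_rels_closed[OF _ T] unfolding duplex_pres_def snd_conv by blast
qed

lemma HH_subset_duplex:
  assumes "l \<le> r"
  shows "fst (HH_pres l r) \<subseteq> fst (duplex_pres r)" "snd (HH_pres l r) \<subseteq> snd (duplex_pres r)"
proof -
  show "fst (HH_pres l r) \<subseteq> fst (duplex_pres r)"
    using assms by (cases "l = 0") (auto simp: HH_pres_def duplex_pres_def hecke_pres_def)
  have "l = 0 \<or> l \<in> {1..r}" using assms by auto
  then show "snd (HH_pres l r) \<subseteq> snd (duplex_pres r)"
    unfolding HH_pres_def duplex_pres_def hecke_pres_def by (cases "l = 0") auto
qed

lemma presentation_HH:
  assumes "l \<le> r"
  shows "presentation (HH_pres l r)"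
proof (cases "l = 0")
  case True
  then show ?thesis by (simp add: HH_pres_def presentation_hecke)
next
  case False
  let ?G = "fst (HH_pres l r)"
  have T: "T ` {1..<r} \<subseteq> ?G" and X: "\<And>\<sigma>. \<sigma> permutes {1..l} \<Longrightarrow> X l \<sigma> \<in> ?G"
    using False unfolding HH_pres_def by auto
  have "snd (HH_pres l r) = hecke_rels r \<union> x_rels l r" using False by (simp add: HH_pres_def)
  then show ?thesis
    using hecke_rels_closed[OF _ T] x_rels_closed[OF _ assms T X] by (intro presentation.intro) blast
qed

text \<open>Counting the letters other than n + 1 replaces the union over the subsets I; this count
  is visibly unchanged by swaps and by changes of letters within {1..n}.\<close>

definition level_words :: "nat \<Rightarrow> nat \<Rightarrow> nat \<Rightarrow> nat list set"
  where "level_words n r l =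
    {w. length w = r \<and> set w \<subseteq> {1..n + 1} \<and> length (filter (\<lambda>j. j \<noteq> n + 1) w) = l}"

lemma V_words_card:
  assumes "w \<in> V_words n r I" "I \<subseteq> {1..r}"
  shows "w \<in> level_words n r (card I)"
proof -
  have len: "length w = r" using assms(1) by (simp add: V_words_def)
  have nth: "if Suc k \<in> I then w ! k \<in> {1..n} else w ! k = n + 1" if "k < r" for k
    using assms(1) that unfolding V_words_def by (auto dest!: bspec[of _ _ "Suc k"])
  \<comment> \<open>The word determines I: it is the set of positions, counted from 1, of the
    letters other than n + 1.\<close>
  have "I = Suc ` {k. k < r \<and> w ! k \<noteq> n + 1}"
  proof (intro equalityI subsetI)
    fix i assume i: "i \<in> I"
    then obtain k where "i = Suc k" "k < r" using assms(2) by (cases i) auto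
    then show "i \<in> Suc ` {k. k < r \<and> w ! k \<noteq> n + 1}" using nth[of k] i by auto
  next
    fix i assume "i \<in> Suc ` {k. k < r \<and> w ! k \<noteq> n + 1}"
    then obtain k where "i = Suc k" "k < r" "w ! k \<noteq> n + 1" by auto
    then show "i \<in> I" using nth[of k] by (auto split: if_splits)
  qed
  then have "card I = length (filter (\<lambda>j. j \<noteq> n + 1) w)"
    using len by (simp add: card_image length_filter_conv_card)
  moreover have "set w \<subseteq> {1..n + 1}"
    unfolding set_conv_nth using nth len by (fastforce split: if_splits)
  ultimately show ?thesis using len by (simp add: level_words_def)
qed

lemma V_level_eq: "V_level n r l = falg.span (wd ` level_words n r l)"
proof -
  let ?U = "\<Union>{V_words n r I | I. I \<subseteq> {1..r} \<and> card I = l}"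
  have "level_words n r l = ?U"
  proof (intro equalityI subsetI)
    fix w assume w: "w \<in> level_words n r l"
    let ?I = "Suc ` {k. k < r \<and> w ! k \<noteq> n + 1}"
    have I: "?I \<subseteq> {1..r}" by auto
    have len: "length w = r" using w by (simp add: level_words_def)
    have "w ! (k - 1) \<in> {1..n + 1}" if "k \<in> {1..r}" for k
      using w that nth_mem[of "k - 1" w] unfolding level_words_def by fastforce
    moreover have "k \<in> ?I \<longleftrightarrow> w ! (k - 1) \<noteq> n + 1" if "k \<in> {1..r}" for k
      using that by (cases k) auto
    ultimately have "w \<in> V_words n r ?I"
      using len unfolding V_words_def by (force simp: le_Suc_eq)
    moreover from V_words_card[OF this I] have "card ?I = l"
      using w by (simp add: level_words_def)
    ultimately show "w \<in> ?U" using I by blast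
  next
    fix w assume "w \<in> ?U"
    then show "w \<in> level_words n r l" using V_words_card by blast
  qed
  moreover have "V_level n r l = falg.span (wd ` ?U)"
  proof (rule antisym)
    have "V_set n r I \<subseteq> falg.span (wd ` ?U)" if "I \<subseteq> {1..r}" "card I = l" for I
      unfolding V_set_def by (rule falg.span_mono) (use that in blast)
    then show "V_level n r l \<subseteq> falg.span (wd ` ?U)"
      unfolding V_level_def by (intro falg.span_minimal) auto
    have "wd w \<in> V_set n r I" if "w \<in> V_words n r I" for w I
      unfolding V_set_def by (rule falg.span_base) (use that in blast)
    then show "falg.span (wd ` ?U) \<subseteq> V_level n r l"
      unfolding V_level_def by (intro falg.span_mono) blast
  qed
  ultimately show ?thesis by simp
qed

lemma V_level_subset_tensor_power: "V_level n r l \<subseteq> tensor_power (n + 1) r"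
  unfolding V_level_eq tensor_power_eq by (rule falg.span_mono) (auto simp: level_words_def)

lemma V_level_subset_tens: "V_level n r l \<subseteq> tens r"
  using V_level_subset_tensor_power tensor_power_subset_tens by blast

text \<open>The level k is independent of l: the relators of \<open>HH_pres l r\<close> vanish on
  all of \<open>tens r\<close>, and every level is stable.\<close>

lemma representation_HH:
  assumes "l \<le> r"
  shows "representation (HH_pres l r) (V_level n r k) (duplex_op n r)
    (\<lambda>g. restrict (duplex_op n r g) (V_level n r k))"
proof (intro representation.intro representation_axioms.intro presentation_HH assms lin_duplex_op)
  show "duplex_op n r g v \<in> V_level n r k" if "g \<in> fst (HH_pres l r)" "v \<in> V_level n r k" for g v
    unfolding V_level_eq
    by (rule duplex_op_span[OF _ _ _ that(2)[unfolded V_level_eq]])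
       (use that(1) HH_subset_duplex(1)[OF assms] in \<open>auto simp: level_words_def\<close>)
  show "act (duplex_op n r) u v = 0" if "u \<in> snd (HH_pres l r)" "v \<in> V_level n r k" for u v
    by (rule duplex_rels_act) (use that HH_subset_duplex(2)[OF assms] V_level_subset_tens in blast)+
qed (simp_all add: V_level_def)

lemma representation_duplex:
  "representation (duplex_pres r) (tensor_power (n + 1) r) (duplex_op n r)
    (\<lambda>g. restrict (duplex_op n r g) (tensor_power (n + 1) r))"
proof (intro representation.intro representation_axioms.intro presentation_duplex lin_duplex_op)
  show "duplex_op n r g v \<in> tensor_power (n + 1) r"
    if "g \<in> fst (duplex_pres r)" "v \<in> tensor_power (n + 1) r" for g v
    unfolding tensor_power_eq
    by (rule duplex_op_span[OF that(1) _ _ that(2)[unfolded tensor_power_eq]]) auto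
  show "act (duplex_op n r) u v = 0" if "u \<in> snd (duplex_pres r)" "v \<in> tensor_power (n + 1) r" for u v
    by (rule duplex_rels_act) (use that tensor_power_subset_tens in blast)+
qed (simp_all add: tensor_power_def)

section \<open>The representation of the quantum group\<close>

lemma uq_rels_act:
  assumes u: "u \<in> uq_rels m" and x: "x \<in> tens r"
  shows "act (uq_op r) u x = 0"
  using u
proof cases
  case (E_F i j)
  then show ?thesis using uq_E_F[OF x, of i j] by (simp add: K_word_def Kinv_word_def)
next
  case (E_E i j)
  then have "Suc i < j \<or> Suc j < i" by linarith
  then show ?thesis using uq_E_E_far[OF x, of i j] uq_E_E_far[OF x, of j i] E_E(1) by auto
next
  case (F_F i j)
  then have "Suc i < j \<or> Suc j < i" by linarith
  then show ?thesis using uq_F_F_far[OF x, of i j] uq_F_F_far[OF x, of j i] F_F(1) by auto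
next
  case (Serre_E i j)
  then have "j = Suc i \<or> i = Suc j" by linarith
  from uq_Serre_E[OF x this] show ?thesis by (simp add: Serre_E(1))
next
  case (Serre_F i j)
  then have "j = Suc i \<or> i = Suc j" by linarith
  from uq_Serre_F[OF x this] show ?thesis by (simp add: Serre_F(1))
qed (use x in \<open>simp_all add: uq_H_rels(1,2) uq_H_rels(3)[OF x] uq_H_E uq_H_F uq_op_tens wt_def divide_inverse\<close>)

lemma presentation_uq: "presentation (uq_pres m)"
proof
  let ?G = "fst (uq_pres m)"
  have G: "\<And>i. i \<in> {1..<m} \<Longrightarrow> E i \<in> ?G" "\<And>i. i \<in> {1..<m} \<Longrightarrow> F i \<in> ?G"
    "\<And>a. a \<in> {1..m} \<Longrightarrow> H a \<in> ?G" "\<And>a. a \<in> {1..m} \<Longrightarrow> Hinv a \<in> ?G"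
    unfolding uq_pres_def fst_conv by blast+
  have "u \<in> carrier (free_alg ?G)" if "u \<in> uq_rels m" for u
    using that by cases (auto simp: K_word_def Kinv_word_def intro!: free_alg_closed G)
  then show "snd (uq_pres m) \<subseteq> carrier (free_alg ?G)" by (auto simp: uq_pres_def)
qed

lemma uq_op_span:
  assumes "\<And>j. P j j" "\<And>i. g = E i \<Longrightarrow> P (Suc i) i" "\<And>i. g = F i \<Longrightarrow> P i (Suc i)"
    and S: "S \<subseteq> {w. length w = r}" "\<And>w w'. w \<in> S \<Longrightarrow> list_all2 P w w' \<Longrightarrow> w' \<in> S"
    and x: "x \<in> falg.span (wd ` S)"
  shows "uq_op r g x \<in> falg.span (wd ` S)"
proof (rule lin_into_subspace[OF lin_uq_op falg.subspace_span x])
  fix w assume w: "w \<in> S"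
  then have "uq_op r g (wd w) \<in> falg.span (wd ` {w'. list_all2 P w w'})"
    using S(1) by (intro uq_op_pattern assms(1-3)) auto
  also have "\<dots> \<subseteq> falg.span (wd ` S)"
    by (rule falg.span_mono) (use w S(2) in auto)
  finally show "uq_op r g (wd w) \<in> falg.span (wd ` S)" .
qed

lemma list_all2_set_subset:
  "list_all2 P w w' \<Longrightarrow> (\<And>j k. P j k \<Longrightarrow> j \<in> A \<Longrightarrow> k \<in> A) \<Longrightarrow> set w \<subseteq> A \<Longrightarrow> set w' \<subseteq> A"
  by (induction rule: list_all2_induct) auto

lemma representation_uq:
  "representation (uq_pres m) (tensor_power m r) (uq_op r) (\<lambda>g. restrict (uq_op r g) (tensor_power m r))"
proof (intro representation.intro representation_axioms.intro presentation_uq lin_uq_op)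
  show "uq_op r g v \<in> tensor_power m r" if "g \<in> fst (uq_pres m)" "v \<in> tensor_power m r" for g v
    unfolding tensor_power_eq
  \<comment> \<open>An implication suffices as pattern: a generator with index i < m turns i + 1
    into i or i into i + 1, and both lie in {1..m}.\<close>
  proof (rule uq_op_span[where P = "\<lambda>j k. j \<in> {1..m} \<longrightarrow> k \<in> {1..m}"])
    show "v \<in> falg.span (wd ` {w. length w = r \<and> set w \<subseteq> {1..m}})"
      using that(2) by (simp only: tensor_power_eq)
    show "w' \<in> {w. length w = r \<and> set w \<subseteq> {1..m}}"
      if "w \<in> {w. length w = r \<and> set w \<subseteq> {1..m}}" "list_all2 (\<lambda>j k. j \<in> {1..m} \<longrightarrow> k \<in> {1..m}) w w'" for w w'
      using that list_all2_set_subset[OF that(2), of "{1..m}"] by (auto dest: list_all2_lengthD)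
  qed (use that(1) in \<open>auto simp: uq_pres_def\<close>)
  show "act (uq_op r) u v = 0" if "u \<in> snd (uq_pres m)" "v \<in> tensor_power m r" for u v
    using that uq_rels_act[of u m v r] tensor_power_subset_tens[of m r] by (auto simp: uq_pres_def)
qed (simp_all add: tensor_power_def)

text \<open>The letters fall into {1..n}, the single letter n + 1, and all others. The generators
  for n stay within a class because E_n and F_n are absent, and both the level and membership in
  \<open>V_words\<close> depend on the classes only.\<close>

definition same_kind :: "nat \<Rightarrow> nat \<Rightarrow> nat \<Rightarrow> bool"
  where "same_kind n j k \<longleftrightarrow> (j \<in> {1..n} \<longleftrightarrow> k \<in> {1..n}) \<and> (j = n + 1 \<longleftrightarrow> k = n + 1)"

lemma same_kind_generators:
  assumes "g \<in> fst (uq_pres n)"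
  shows "same_kind n j j" "g = E i \<Longrightarrow> same_kind n (Suc i) i" "g = F i \<Longrightarrow> same_kind n i (Suc i)"
  using assms by (auto simp: same_kind_def uq_pres_def)

lemma same_kind_level_words:
  assumes "w \<in> level_words n r l" "list_all2 (same_kind n) w w'"
  shows "w' \<in> level_words n r l"
proof -
  have "length (filter (\<lambda>j. j \<noteq> n + 1) w) = length (filter (\<lambda>j. j \<noteq> n + 1) w')"
    using assms(2) by (induction rule: list_all2_induct) (auto simp: same_kind_def)
  moreover have "set w' \<subseteq> {1..n + 1}"
    by (rule list_all2_set_subset[OF assms(2)]) (use assms(1) in \<open>auto simp: same_kind_def level_words_def\<close>)
  ultimately show ?thesis
    using assms list_all2_lengthD[OF assms(2)] by (simp add: level_words_def)
qed

lemma same_kind_V_words: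
  assumes "l \<le> r" "list_all2 (same_kind n) w w'"
  shows "w \<in> V_words n r {1..l} \<longleftrightarrow> w' \<in> V_words n r {1..l}"
proof -
  have imp: "v' \<in> V_words n r {1..l}" if "v \<in> V_words n r {1..l}" "list_all2 (same_kind n) v v'" for v v'
    unfolding V_words_iff[OF assms(1)]
  proof (intro conjI)
    note v = that(1)[unfolded V_words_iff[OF assms(1)]]
    show "length v' = r" using v list_all2_lengthD[OF that(2)] by simp
    show "set (take l v') \<subseteq> {1..n}"
      by (rule list_all2_set_subset[OF list_all2_takeI[OF that(2)]]) (use v in \<open>auto simp: same_kind_def\<close>)
    show "set (drop l v') \<subseteq> {n + 1}"
      by (rule list_all2_set_subset[OF list_all2_dropI[OF that(2)]]) (use v in \<open>auto simp: same_kind_def\<close>)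
  qed
  have "list_all2 (same_kind n) w' w"
    using assms(2) by (auto simp: list_all2_conv_all_nth same_kind_def)
  then show ?thesis using imp assms(2) by blast
qed

lemma uq_op_V_level:
  assumes "g \<in> fst (uq_pres n)" "x \<in> V_level n r l"
  shows "uq_op r g x \<in> V_level n r l"
  unfolding V_level_eq
  by (rule uq_op_span[of "same_kind n", OF same_kind_generators[OF assms(1)] _ same_kind_level_words assms(2)[unfolded V_level_eq]])
     (auto simp: level_words_def)

text \<open>All words occurring in the image of w have letters of the same kinds as w, so \<pi>_l
  keeps all of them or none.\<close>

lemma uq_op_V_proj:
  assumes "l \<le> r" "g \<in> fst (uq_pres n)" "x \<in> tens r"
  shows "uq_op r g (V_proj n r l x) = V_proj n r l (uq_op r g x)"
proof (rule tens_eqI[OF _ _ assms(3), of "\<lambda>x. uq_op r g (V_proj n r l x)"])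
  fix w :: "nat list" assume w: "length w = r"
  let ?S = "{w'. list_all2 (same_kind n) w w'}"
  have span: "uq_op r g (wd w) \<in> falg.span (wd ` ?S)"
    by (rule uq_op_pattern[of "same_kind n", OF same_kind_generators[OF assms(2)] w])
  have "V_proj n r l (uq_op r g (wd w)) = (if w \<in> V_words n r {1..l} then uq_op r g (wd w) else 0)"
    by (rule lin_eq_on_span[OF lin_V_proj _ span, of "\<lambda>x. if w \<in> V_words n r {1..l} then x else 0"])
       (use same_kind_V_words[OF assms(1)] in \<open>auto intro: lin_if lin_id lin_zero\<close>)
  then show "uq_op r g (V_proj n r l (wd w)) = V_proj n r l (uq_op r g (wd w))"
    by (simp add: lin_simps[OF lin_uq_op])
qed (auto intro: lin_compose[OF lin_V_proj lin_uq_op] lin_compose[OF lin_uq_op lin_V_proj])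

lemma uq_op_duplex_op_commute:
  assumes "g \<in> fst (uq_pres n)" "h \<in> fst (duplex_pres r)" "x \<in> tens r"
  shows "uq_op r g (duplex_op n r h x) = duplex_op n r h (uq_op r g x)"
proof -
  consider (T) i where "h = T i" "i \<in> {1..<r}"
    | (X) l \<sigma> where "h = X l \<sigma>" "l \<in> {1..r}" "\<sigma> permutes {1..l}"
    using assms(2) unfolding duplex_pres_def fst_conv by blast
  then show ?thesis
  proof cases
    case T
    then show ?thesis using uq_op_hecke_op_commute[OF assms(3)] by simp
  next
    case X
    have l: "l \<le> r" using X(2) by simp
    interpret braid_action l "tens r" hecke_op by (rule braid_action_hecke[OF l])
    have "uq_op r g (t_perm \<sigma> (V_proj n r l x)) = t_perm \<sigma> (uq_op r g (V_proj n r l x))"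
      by (rule t_perm_commute[OF X(3) V_proj_tens[OF assms(3)]])
         (use l in \<open>auto intro: uq_op_hecke_op_commute\<close>)
    then show ?thesis
      by (simp add: X(1) x_op_eq[OF l X(3)] t_perm_def uq_op_V_proj[OF l assms(1,3)])
  qed
qed

text \<open>\<open>act_commute\<close> is used twice: for a fixed generator g it passes from
  generators of the duplex algebra to a, and then from the generators g to p.\<close>

lemma act_uq_duplex_commute:
  assumes p: "Poly_Mapping.keys p \<subseteq> lists (fst (uq_pres n))"
    and a: "Poly_Mapping.keys a \<subseteq> lists (fst (duplex_pres r))" and x: "x \<in> V_level n r l"
  shows "act (uq_op r) p (act (duplex_op n r) a x) = act (duplex_op n r) a (act (uq_op r) p x)"
proof (rule act_commute[where W = "V_level n r l" and G = "fst (uq_pres n)", symmetric])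
  have closed: "duplex_op n r h v \<in> V_level n r l" if "h \<in> fst (duplex_pres r)" "v \<in> V_level n r l" for h v
    unfolding V_level_eq
    by (rule duplex_op_span[OF that(1) _ _ that(2)[unfolded V_level_eq]]) (auto simp: level_words_def)
  show "act (duplex_op n r) a (uq_op r g v) = uq_op r g (act (duplex_op n r) a v)"
    if "g \<in> fst (uq_pres n)" "v \<in> V_level n r l" for g v
    by (rule act_commute[where W = "V_level n r l" and G = "fst (duplex_pres r)", symmetric])
       (use that closed a in \<open>auto intro: uq_op_duplex_op_commute lin_uq_op subsetD[OF V_level_subset_tens]\<close>)
qed (use p x in \<open>auto intro: uq_op_V_level lin_act lin_duplex_op\<close>)

theorem lemma3p3:
  fixes n r :: nat
  assumes "n \<ge> 1" and "r \<ge> 1"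
  shows "\<exists>\<Xi> :: nat \<Rightarrow> hecke_gen falg set \<Rightarrow> nat falg \<Rightarrow> nat falg.
    (\<forall>l\<in>{1..r}.
       \<Xi> l \<in> alg_hom (HH l r) (End_alg (V_level n r l)) \<and>
       (\<forall>i\<in>{1..<r}. \<Xi> l (cls (HH_pres l r) (wd [T i])) =
          restrict (Psi (n + 1) r (cls (hecke_pres r) (wd [T i]))) (V_level n r l)) \<and>
       (\<forall>\<sigma>. \<sigma> permutes {1..l} \<longrightarrow> \<Xi> l (cls (HH_pres l r) (wd [X l \<sigma>])) = psi n r l \<sigma>)) \<and>
    (\<Xi> 0 \<in> alg_hom (HH 0 r) (End_alg (V_level n r 0)) \<and>
       (\<forall>i\<in>{1..<r}.
          \<Xi> 0 (cls (HH_pres 0 r) (wd [T i])) =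
            restrict (Psi (n + 1) r (cls (hecke_pres r) (wd [T i]))) (V_level n r 0) \<and>
          restrict (Psi (n + 1) r (cls (hecke_pres r) (wd [T i]))) (V_level n r 0) =
            inverse q \<odot>\<^bsub>End_alg (V_level n r 0)\<^esub> \<one>\<^bsub>End_alg (V_level n r 0)\<^esub>)) \<and>
    (\<forall>l\<in>{0..r}. \<forall>g\<in>carrier (uq n). \<forall>a\<in>carrier (HH l r).
       restrict (Phi (n + 1) r (uq_embed n g)) (V_level n r l) \<in> carrier (End_alg (V_level n r l)) \<and>
       restrict (Phi (n + 1) r (uq_embed n g)) (V_level n r l) \<otimes>\<^bsub>End_alg (V_level n r l)\<^esub> \<Xi> l a =
         \<Xi> l a \<otimes>\<^bsub>End_alg (V_level n r l)\<^esub> restrict (Phi (n + 1) r (uq_embed n g)) (V_level n r l)) \<and>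
    (\<exists>\<Theta> \<in> alg_hom (duplex r) (End_alg (tensor_power (n + 1) r)).
       (\<forall>i\<in>{1..<r}. \<Theta> (cls (duplex_pres r) (wd [T i])) =
          Psi (n + 1) r (cls (hecke_pres r) (wd [T i]))) \<and>
       (\<forall>l\<in>{1..r}. \<forall>\<sigma>. \<sigma> permutes {1..l} \<longrightarrow>
          restrict (\<Theta> (cls (duplex_pres r) (wd [X l \<sigma>]))) (V_level n r l) =
            \<Xi> l (cls (HH_pres l r) (wd [X l \<sigma>])) \<and>
          (\<forall>k\<in>{0..r}. k \<noteq> l \<longrightarrow>
             (\<forall>v\<in>V_level n r k. \<Theta> (cls (duplex_pres r) (wd [X l \<sigma>])) v = 0))))"
proof -
  let ?V = "V_level n r" and ?W = "tensor_power (n + 1) r"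
  \<comment> \<open>The same formula covers l = 0, where the presentation has only the generators
    \<open>T i\<close>.\<close>
  define \<Xi> where "\<Xi> l = induced_hom (End_alg (?V l)) (\<lambda>g. restrict (duplex_op n r g) (?V l))" for l
  define \<Theta> where "\<Theta> = induced_hom (End_alg ?W) (\<lambda>g. restrict (duplex_op n r g) ?W)"
  note rep = representation_HH[of _ r n]
  interpret D: representation "duplex_pres r" ?W "duplex_op n r" "\<lambda>g. restrict (duplex_op n r g) ?W"
    by (rule representation_duplex)
  \<comment> \<open>\<open>Psi\<close> and \<open>Phi\<close> take values that are extensional on
    the full tensor power, and each level lies inside it.\<close>
  have restrict_W: "restrict (restrict f ?W) (?V l) = restrict f (?V l)" for f :: "nat falg \<Rightarrow> nat falg" and l
    using V_level_subset_tensor_power[of n r l] by (simp add: Int_absorb1)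
  have hom: "\<Xi> l \<in> alg_hom (HH l r) (End_alg (?V l))" if "l \<le> r" for l
    unfolding \<Xi>_def by (rule representation.induced_hom_alg_hom[OF rep[OF that]])
  have Psi_T: "Psi (n + 1) r (cls (hecke_pres r) (wd [T i])) = restrict (hecke_op i) ?W" if "i \<in> {1..<r}" for i
    using Psi_cls[of "[i]" r "n + 1"] that by simp
  have \<Xi>_T: "\<Xi> l (cls (HH_pres l r) (wd [T i])) =
      restrict (Psi (n + 1) r (cls (hecke_pres r) (wd [T i]))) (?V l)" if "l \<le> r" "i \<in> {1..<r}" for l i
  proof -
    have "T i \<in> fst (HH_pres l r)" using that(2) by (auto simp: HH_pres_def hecke_pres_def)
    then show ?thesis
      unfolding \<Xi>_def Psi_T[OF that(2)] restrict_W
      by (subst representation.induced_hom_gen[OF rep[OF that(1)]]) simp_all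
  qed
  have \<Xi>_X: "\<Xi> l (cls (HH_pres l r) (wd [X l \<sigma>])) = psi n r l \<sigma>"
    if "l \<in> {1..r}" "\<sigma> permutes {1..l}" for l \<sigma>
  proof -
    have "X l \<sigma> \<in> fst (HH_pres l r)" using that by (auto simp: HH_pres_def)
    moreover have "l \<le> r" using that(1) by simp
    ultimately show ?thesis
      unfolding \<Xi>_def psi_eq by (subst representation.induced_hom_gen[OF rep]) simp_all
  qed
  have level_0: "restrict (Psi (n + 1) r (cls (hecke_pres r) (wd [T i]))) (?V 0) =
      inverse q \<odot>\<^bsub>End_alg (?V 0)\<^esub> \<one>\<^bsub>End_alg (?V 0)\<^esub>" if i: "i \<in> {1..<r}" for i
  proof -
    have "hecke_op i v = scl (inverse q) v" if "v \<in> ?V 0" for v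
    proof (rule lin_eq_on_span[OF lin_hecke_op lin_scl[OF lin_id(1)] that[unfolded V_level_eq]])
      \<comment> \<open>A word of level 0 repeats the letter n + 1, so its neighbouring letters
        agree.\<close>
      fix w assume w: "w \<in> level_words n r 0"
      then have "length w = r" by (simp add: level_words_def)
      then obtain xs a b ys where "w = xs @ a # b # ys" "i = Suc (length xs)"
        using split_adjacent[of i w] i by metis
      with w show "hecke_op i (wd w) = scl (inverse q) (wd w)"
        by (auto simp: level_words_def hecke_basis_append split: if_splits)
    qed
    then show ?thesis
      unfolding Psi_T[OF i] restrict_W by (auto simp: End_alg_simps fun_eq_iff)
  qed
  have commute: "restrict (Phi (n + 1) r (uq_embed n g)) (?V l) \<in> carrier (End_alg (?V l)) \<and>
      restrict (Phi (n + 1) r (uq_embed n g)) (?V l) \<otimes>\<^bsub>End_alg (?V l)\<^esub> \<Xi> l a =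
      \<Xi> l a \<otimes>\<^bsub>End_alg (?V l)\<^esub> restrict (Phi (n + 1) r (uq_embed n g)) (?V l)"
    if l: "l \<le> r" and g: "g \<in> carrier (uq n)" and a: "a \<in> carrier (HH l r)" for l g a
  proof -
    interpret U: representation "uq_pres (n + 1)" ?W "uq_op r" "\<lambda>g. restrict (uq_op r g) ?W"
      by (rule representation_uq)
    interpret X: representation "HH_pres l r" "?V l" "duplex_op n r" "\<lambda>g. restrict (duplex_op n r g) (?V l)"
      by (rule rep[OF l])
    obtain p where p: "g = cls (uq_pres n) p" "p \<in> carrier (free_alg (fst (uq_pres n)))"
      using g by (auto simp: presentation.pres_alg_simps[OF presentation_uq])
    obtain b where b: "a = cls (HH_pres l r) b" "b \<in> carrier (free_alg (fst (HH_pres l r)))"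
      using a by (auto simp: X.pres_alg_simps)
    have gens: "fst (uq_pres n) \<subseteq> fst (uq_pres (n + 1))" by (auto simp: uq_pres_def)
    have "uq_rels n \<subseteq> uq_rels (n + 1)"
    proof
      fix u assume "u \<in> uq_rels n"
      then show "u \<in> uq_rels (n + 1)"
        by induction (rule uq_rels.intros; simp)+
    qed
    \<comment> \<open>The embedding keeps the representative p, so the image of g acts through
      \<open>act (uq_op r) p\<close>, an expression in generators for n alone.\<close>
    then have embed: "uq_embed n g = cls (uq_pres (n + 1)) p"
      unfolding uq_embed_def p(1)
      by (intro induced_hom_mono_pres presentation_uq gens p(2)) (simp add: uq_pres_def)
    have "p \<in> carrier U.FA" using p(2) gens by (auto simp: in_free_alg)
    then have Phi: "restrict (Phi (n + 1) r (uq_embed n g)) (?V l) = restrict (act (uq_op r) p) (?V l)"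
      unfolding embed Phi_def by (simp only: U.induced_hom_cls_eq restrict_W)
    note keys = p(2)[unfolded in_free_alg]
      subset_trans[OF b(2)[unfolded in_free_alg] lists_mono[OF HH_subset_duplex(1)[OF l]]]
    have closed: "act (uq_op r) p v \<in> ?V l" if "v \<in> ?V l" for v
      by (rule act_closed[OF X.W _ keys(1) that]) (rule uq_op_V_level)
    have \<Xi>: "\<Xi> l a = restrict (act (duplex_op n r) b) (?V l)"
      unfolding \<Xi>_def b(1) by (rule X.induced_hom_cls_eq[OF b(2)])
    show ?thesis
      unfolding Phi \<Xi> using restrict_in_End[OF X.W lin_act[OF lin_uq_op] closed] closed X.act_in_W[OF b(2)]
      by (auto simp: End_alg_simps compose_def fun_eq_iff act_uq_duplex_commute[OF keys])
  qed
  have \<Theta>_T: "\<Theta> (cls (duplex_pres r) (wd [T i])) = Psi (n + 1) r (cls (hecke_pres r) (wd [T i]))"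
    if "i \<in> {1..<r}" for i
    unfolding \<Theta>_def Psi_T[OF that]
    by (subst D.induced_hom_gen) (use that in \<open>auto simp: duplex_pres_def\<close>)
  have \<Theta>_X: "\<Theta> (cls (duplex_pres r) (wd [X l \<sigma>])) = restrict (x_op n r l \<sigma>) ?W"
    if "l \<in> {1..r}" "\<sigma> permutes {1..l}" for l \<sigma>
    unfolding \<Theta>_def by (subst D.induced_hom_gen) (use that in \<open>auto simp: duplex_pres_def\<close>)
  \<comment> \<open>Words with letters at most n exactly in positions 1 to l have level l, so no
    word of another level is in the support of \<pi>_l.\<close>
  have zero: "x_op n r l \<sigma> v = 0"
    if "l \<in> {1..r}" "\<sigma> permutes {1..l}" "k \<noteq> l" "v \<in> ?V k" for l \<sigma> k v
  proof (rule lin_eq_on_span[OF lin_x_op lin_zero that(4)[unfolded V_level_eq]])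
    fix w assume w: "w \<in> level_words n r k"
    have "{1..l} \<subseteq> {1..r}" "card {1..l} = l" using that(1) by auto
    then have "w \<notin> V_words n r {1..l}"
      using V_words_card[of w n r "{1..l}"] w that(3) by (auto simp: level_words_def)
    then show "x_op n r l \<sigma> (wd w) = 0" by (simp add: x_op_def)
  qed
  have "\<forall>k\<in>{0..r}. k \<noteq> l \<longrightarrow> (\<forall>v\<in>?V k. \<Theta> (cls (duplex_pres r) (wd [X l \<sigma>])) v = 0)"
    if "l \<in> {1..r}" "\<sigma> permutes {1..l}" for l \<sigma>
    using zero[OF that] V_level_subset_tensor_power[of n r] by (auto simp: \<Theta>_X[OF that])
  moreover have "restrict (\<Theta> (cls (duplex_pres r) (wd [X l \<sigma>]))) (?V l) = \<Xi> l (cls (HH_pres l r) (wd [X l \<sigma>]))"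
    if "l \<in> {1..r}" "\<sigma> permutes {1..l}" for l \<sigma>
    unfolding \<Theta>_X[OF that] \<Xi>_X[OF that] restrict_W psi_eq ..
  ultimately show ?thesis
    using hom \<Xi>_T \<Xi>_X level_0 commute \<Theta>_T D.induced_hom_alg_hom[folded \<Theta>_def]
    by (intro exI[of _ \<Xi>] conjI bexI[of _ \<Theta>] ballI allI impI) simp_all
qed

end
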